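(* Let $\alpha,\beta>0$ and $m\in\mathbb{N}$. Put $p=\frac{m+1-2m\beta}{2\alpha m}$, $a_0=\frac{1}{\alpha\sqrt m}(2\pi)^{(1-m)/2}$, $$G(t)=2a_0\,t^{p}\exp\!\Big(m\,t^{\frac{1}{\alpha m}}\cos\tfrac{\pi}{\alpha m}\Big)\cos\!\Big(\pi p+m\,t^{\frac{1}{\alpha m}}\sin\tfrac{\pi}{\alpha m}\Big),\qquad H_K(t)=\sum_{k=1}^{K}\frac{(-1)^{k+1}t^{-k}}{[\Gamma(\beta-\alpha k)]^{m}},$$ with the convention $1/\Gamma(-n)=0$ for $n=0,1,2,\dots$. Then, as $t\to+\infty$: (i) if $0<\alpha m<2$, for every $K\in\mathbb{N}$, $F_{\alpha,\beta}^{(m)}(-t)=H_K(t)+O(t^{-K-1})$; (ii) if $\alpha m=2$, for every $K\in\mathbb{N}$, $F_{\alpha,\beta}^{(m)}(-t)=G(t)+H_K(t)+O(t^{p-\frac{1}{2}})+O(t^{-K-1})$; (iii) if $\alpha m>2$, $F_{\alpha,\beta}^{(m)}(-t)=G(t)+O\!\Big(t^{p-\frac{1}{\alpha m}}\exp\big(m\,t^{\frac{1}{\alpha m}}\cos\tfrac{\pi}{\alpha m}\big)\Big)$.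
   Context: For $\alpha,\beta>0$ and $m\in\mathbb{N}$, $F_{\alpha,\beta}^{(m)}(z)=\sum_{k=0}^{\infty}\frac{z^k}{[\Gamma(\alpha k+\beta)]^{m}}$, an entire function of $z$. *)

theory Defs
  imports "HOL-Analysis.Analysis" "HOL-Library.Landau_Symbols"
begin

definition Fm :: "real \<Rightarrow> real \<Rightarrow> nat \<Rightarrow> real \<Rightarrow> real" where
  "Fm \<alpha> \<beta> m z = (\<Sum>k. z ^ k / (Gamma (\<alpha> * real k + \<beta>)) ^ m)"

definition p_exp :: "real \<Rightarrow> real \<Rightarrow> nat \<Rightarrow> real" where
  "p_exp \<alpha> \<beta> m = (real m + 1 - 2 * real m * \<beta>) / (2 * \<alpha> * real m)"

definition a0 :: "real \<Rightarrow> nat \<Rightarrow> real" where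
  "a0 \<alpha> m = 1 / (\<alpha> * sqrt (real m)) * (2 * pi) powr ((1 - real m) / 2)"

definition Gfun :: "real \<Rightarrow> real \<Rightarrow> nat \<Rightarrow> real \<Rightarrow> real" where
  "Gfun \<alpha> \<beta> m t = 2 * a0 \<alpha> m * t powr (p_exp \<alpha> \<beta> m)
     * exp (real m * t powr (1 / (\<alpha> * real m)) * cos (pi / (\<alpha> * real m)))
     * cos (pi * p_exp \<alpha> \<beta> m + real m * t powr (1 / (\<alpha> * real m)) * sin (pi / (\<alpha> * real m)))"

text \<open>rGamma is the reciprocal Gamma function, which is 0 at non-positive integers,
  matching the convention 1/Gamma(-n) = 0.\<close>
definition Hfun :: "real \<Rightarrow> real \<Rightarrow> nat \<Rightarrow> nat \<Rightarrow> real \<Rightarrow> real" where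
  "Hfun \<alpha> \<beta> m K t = (\<Sum>k=1..K. (-1) ^ (k + 1) * t powr (- real k) * (rGamma (\<beta> - \<alpha> * real k)) ^ m)"

end

theory Submission
  imports Defs "HOL-Complex_Analysis.Complex_Analysis" "HOL-Real_Asymp.Real_Asymp"
begin

text \<open>
  Write the series as $F(w) = \sum_k e^{lk} g(k)$ with $w = e^l$ and the entire function
  $g(s) = \Gamma(\alpha s + \beta)^{-m}$. For $\alpha m < 2$ the Abel-Plana formula turns the sum over
  $k > c$ into $\int_c^\infty e^{ls} g(s)\,ds$ up to $O(|w|^c)$, for every $w$ with $|\arg w| \le \pi$. When
  $\arg w = \pi$ this integral can be rotated to the vertical line through $c$, where it is itself
  $O(|w|^c)$; the terms with $c < k < 0$ are the algebraic expansion $H_K$.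

  To extract the exponential part, put $a = \alpha m$ and $b = m\beta - (m-1)/2$. By Stirling's formula
  $g(s) = m^{as}(A_0/\Gamma(as+b) + A_1/\Gamma(as+b+1))$ up to a relative error $O(s^{-2})$. The integral of the
  bracket is evaluated exactly: after substituting $z = as + b - 1$ it is, by the Abel-Plana formula used
  backwards, the exponential series $\sum_k W^k/k! = e^W$ with $W = m w^{1/a}$, so no saddle point analysis is
  needed. The remainder integral is bounded on the ray through the saddle point (or on the vertical
  line, when that ray is vertical).

  For $\alpha m \ge 2$, the sum $F_\alpha(-t)$ is the average of $F_{\alpha/(2M)}$ over the $2M$-th roots of $-t$. The
  two roots closest to the positive axis produce $G$ and the others are negligible.
\<close>

section \<open>Stirling's formula in a sector\<close>

text \<open>The restriction \<alpha> m < 2 comes from vertical growth: up to powers, |g(s)| grows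
  like exp(a pi |Im s| / 2) with a = \<alpha> m, |exp(l s)| at most like exp(pi |Im s|), and the
  Abel-Plana kernel decays like exp(-2 pi |Im s|). Dividing \<alpha> by 2M brings every \<alpha>
  into this range. Two Stirling terms are kept because the integral along the ray is estimated by
  length times maximum. With x the distance of the saddle point this loses a factor sqrt x: one term
  would leave a remainder of order x^(1/2 - b), times the exponential, while the claimed error
  allows x^(-b); two terms leave x^(-b - 1/2). The coefficient A_1 only enters the error, so only
  its existence matters. No improper integral is formed. Integrals end at a finite X, and the
  resulting bounds hold for all large X with constants independent of X and l. Estimates whose
  constant depends on l serve only for pieces of contour that vanish as X grows; there the rate of
  decay in Re s is chosen after l, which absorbs exp(Re l Re s).\<close>

lemma norm_Ln_taylor_le:
  fixes u :: complex
  assumes "norm u \<le> 1/2" "n > 0"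
  shows "norm (Ln (1 + u) - (\<Sum>k=1..<n. - ((-u)^k) / of_nat k)) \<le> 2 * norm u ^ n"
proof -
  define f where "f = (\<lambda>k. - ((-u)^k) / (of_nat k :: complex))"
  have s: "f sums Ln (1 + u)"
    unfolding f_def by (rule Ln_series') (use assms in auto)
  have s2: "(\<lambda>k. f (k + n)) sums (Ln (1 + u) - (\<Sum>k<n. f k))"
    using s by (simp add: sums_iff_shift)
  have e: "(\<Sum>k<n. f k) = (\<Sum>k=1..<n. f k)"
  proof -
    have "{..<n} = insert 0 {1..<n}" using assms by auto
    then show ?thesis by (simp add: f_def)
  qed
  \<comment> \<open>From index \<open>n\<close> on the series is dominated by |u|^n times the
    geometric series of ratio 1/2; its sum 2 is the constant in the claim.\<close>
  have g: "(\<lambda>k. norm u ^ n * (1/2)^k) sums (norm u ^ n * 2)"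
    using sums_mult[OF geometric_sums[of "1/2::real"], of "norm u ^ n"] by simp
  have b: "norm (f (k + n)) \<le> norm u ^ n * (1/2)^k" for k
  proof -
    have "norm (f (k + n)) = norm u ^ n * norm u ^ k / (real k + real n)"
      unfolding f_def by (simp add: norm_divide norm_power norm_mult power_add flip: of_nat_add)
    also have "\<dots> \<le> norm u ^ n * norm u ^ k / 1"
      using assms by (intro divide_left_mono) auto
    also have "\<dots> \<le> norm u ^ n * (1/2)^k"
      using assms by (simp add: mult_left_mono power_mono)
    finally show ?thesis .
  qed
  have "norm (\<Sum>k. f (k + n)) \<le> (\<Sum>k. norm u ^ n * (1/2)^k)"
    by (rule norm_suminf_le[OF b sums_summable[OF g]])
  then show ?thesis using s2 g e
    by (simp add: sums_iff f_def mult.commute)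
qed

text \<open>This is half the Bernoulli polynomial B_2(b), the coefficient of 1/z in the asymptotic
  expansion of log Gamma(z + b).\<close>

definition stirling_coeff :: "real \<Rightarrow> real" where
  "stirling_coeff b = (b\<^sup>2 - b + 1/6) / 2"

text \<open>With $u = 1/z$, this is the logarithm of $T(z+1)/T(z)$ for
  $T(z) = \Gamma(z+b)^{-1} e^{(z+b-1/2)\log z - z} e^{q/z}$; the value of $q$ is the one that makes it $O(u^3)$.\<close>

definition stirling_defect :: "real \<Rightarrow> complex \<Rightarrow> complex" where
  "stirling_defect b u = (1/u + of_real b + 1/2) * Ln (1 + u) - 1 - Ln (1 + of_real b * u)
      - of_real (stirling_coeff b) * u\<^sup>2 / (1 + u)"

text \<open>With \<open>Ln (1 + u)\<close> expanded to third and \<open>Ln (1 + b * u)\<close> to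
  second order, all terms up to u^2 cancel, the quadratic ones by the choice of
  \<open>stirling_coeff b\<close>. The radius keeps both |u| and |b u| below 1/2, where the Taylor
  bounds apply.\<close>

lemma stirling_defect_bound:
  fixes b :: real
  obtains C where "C \<ge> 0"
    "\<And>u. u \<noteq> 0 \<Longrightarrow> norm u \<le> 1 / (2 * (1 + \<bar>b\<bar>)) \<Longrightarrow> norm (stirling_defect b u) \<le> C * norm u ^ 3"
proof -
  define q where "q = stirling_coeff b"
  define C where "C = 2 + (\<bar>b\<bar> + 1/2) * (4/3) + 2 * \<bar>b\<bar>^3 + 2 * \<bar>q\<bar>"
  have "norm (stirling_defect b u) \<le> C * norm u ^ 3" if u0: "u \<noteq> 0" and u: "norm u \<le> 1 / (2 * (1 + \<bar>b\<bar>))" for u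
  proof -
    have "1 / (2 * (1 + \<bar>b\<bar>)) \<le> 1/2" by (simp add: field_simps)
    then have u2: "norm u \<le> 1/2" using u by linarith
    have "norm (of_real b * u) = \<bar>b\<bar> * norm u" by (simp add: norm_mult)
    also have "\<dots> \<le> \<bar>b\<bar> * (1 / (2 * (1 + \<bar>b\<bar>)))" using u by (intro mult_left_mono) auto
    also have "\<dots> \<le> 1/2" by (simp add: field_simps)
    finally have bu: "norm (of_real b * u) \<le> 1/2" .
    define A where "A = Ln (1 + u) - (u - u\<^sup>2/2 + u^3/3)"
    define B where "B = Ln (1 + of_real b * u) - (of_real b * u - (of_real b * u)\<^sup>2/2)"
    have A: "norm A \<le> 2 * norm u ^ 4"
    proof -
      have "{1..<4} = {1,2,3::nat}" by auto
      then show ?thesis using norm_Ln_taylor_le[OF u2, of 4] by (simp add: A_def algebra_simps)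
    qed
    have B: "norm B \<le> 2 * \<bar>b\<bar>^3 * norm u ^ 3"
    proof -
      have "{1..<3} = {1,2::nat}" by auto
      then show ?thesis using norm_Ln_taylor_le[OF bu, of 3]
        by (simp add: B_def algebra_simps norm_mult power_mult_distrib)
    qed
    have u1: "1 + u \<noteq> 0"
    proof
      assume "1 + u = 0"
      then have "u = -1" by (simp add: eq_neg_iff_add_eq_0 add.commute)
      then show False using u2 by simp
    qed
    have e1: "Ln (1 + u) = u - u\<^sup>2/2 + u^3/3 + A" by (simp add: A_def)
    have e2: "Ln (1 + of_real b * u) = of_real b * u - (of_real b * u)\<^sup>2/2 + B" by (simp add: B_def)
    have e3: "u\<^sup>2 / (1 + u) = u\<^sup>2 - u^3 / (1 + u)"
      using u1 by (simp add: field_simps power2_eq_square power3_eq_cube)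
    have qq: "of_real q = ((of_real b)\<^sup>2 - of_real b + 1/6) / (2::complex)"
      by (simp add: q_def stirling_coeff_def)
    have "stirling_defect b u = (1/u + of_real b + 1/2) * Ln (1 + u) - 1 - Ln (1 + of_real b * u)
      - of_real q * (u\<^sup>2 / (1 + u))"
      by (simp add: stirling_defect_def q_def)
    \<comment> \<open>What survives the cancellation. Each of the four summands is O(u^3);
      \<open>A\<close> had to be of order 4 because it is divided by u.\<close>
    also have "\<dots> = A / u + (of_real b + 1/2) * (u^3/3 + A) - B + of_real q * (u^3 / (1 + u))"
    proof -
      define Y where "Y = u^3 / (1 + u)"
      show ?thesis unfolding e1 e2 e3 Y_def[symmetric] using u0
        by (simp add: field_simps power2_eq_square power3_eq_cube qq)
    qed
    also have "norm \<dots> \<le> norm (A / u) + norm ((of_real b + 1/2) * (u^3/3 + A)) + norm B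
                + norm (of_real q * (u^3 / (1 + u)))"
      by (intro order_trans[OF norm_triangle_ineq] order_trans[OF norm_triangle_ineq4] add_mono order_refl)
    also have "\<dots> \<le> 2 * norm u ^ 3 + (\<bar>b\<bar> + 1/2) * (4/3) * norm u ^ 3 + 2 * \<bar>b\<bar>^3 * norm u ^ 3
                + 2 * \<bar>q\<bar> * norm u ^ 3"
    proof (intro add_mono B)
      have "norm (A / u) \<le> 2 * norm u ^ 4 / norm u"
        using A by (simp add: norm_divide divide_right_mono)
      also have "\<dots> = 2 * norm u ^ 3" using u0 by (simp add: power_numeral_reduce)
      finally show "norm (A / u) \<le> 2 * norm u ^ 3" .
      have n1: "norm (of_real b + 1/2 :: complex) \<le> \<bar>b\<bar> + 1/2"
        by (rule order_trans[OF norm_triangle_ineq]) simp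
      have "norm A \<le> 2 * (norm u ^ 3 * norm u)" using A by (simp add: power_numeral_reduce mult_ac)
      also have "\<dots> \<le> 2 * (norm u ^ 3 * (1/2))" using u2 by (intro mult_left_mono) auto
      finally have "norm A \<le> norm u ^ 3" by simp
      then have n2: "norm (u^3/3 + A) \<le> (4/3) * norm u ^ 3"
        by (intro order_trans[OF norm_triangle_ineq]) (simp add: norm_power norm_divide)
      show "norm ((of_real b + 1/2) * (u^3/3 + A)) \<le> (\<bar>b\<bar> + 1/2) * (4/3) * norm u ^ 3"
        unfolding norm_mult mult.assoc[of _ "4/3"] by (rule mult_mono[OF n1 n2]) auto      have "1/2 \<le> norm (1 + u)"
        using norm_triangle_ineq2[of 1 "-u"] u2 by simp
      then have "norm u ^ 3 / norm (1 + u) \<le> norm u ^ 3 / (1/2)"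
        by (intro divide_left_mono) auto
      then have "\<bar>q\<bar> * (norm u ^ 3 / norm (1 + u)) \<le> \<bar>q\<bar> * (norm u ^ 3 / (1/2))"
        by (intro mult_left_mono) auto
      then show "norm (of_real q * (u^3 / (1 + u))) \<le> 2 * \<bar>q\<bar> * norm u ^ 3"
        by (simp add: norm_mult norm_divide norm_power mult_ac)
    qed
    also have "\<dots> = C * norm u ^ 3" by (simp add: C_def algebra_simps)
    finally show ?thesis .
  qed
  moreover have "C \<ge> 0" by (simp add: C_def)
  ultimately show ?thesis using that by blast
qed

text \<open>The reciprocal Gamma function divided by its Stirling approximation without the
  constant, so that the limit in the sector is \<open>1 / sqrt (2 * pi)\<close>. Working with the
  reciprocal avoids all poles.\<close>

definition stirling_quot :: "real \<Rightarrow> complex \<Rightarrow> complex" where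
  "stirling_quot b z = rGamma (z + of_real b) * exp ((z + of_real b - 1/2) * Ln z - z)"

text \<open>The imaginary parts of z and 1 + 1/z have opposite signs or both vanish, so the two
  arguments partly cancel and their sum stays in the principal range.\<close>

lemma Ln_plus1:
  assumes "z \<notin> \<real>\<^sub>\<le>\<^sub>0"
  shows "Ln (z + 1) = Ln z + Ln (1 + 1/z)"
proof -
  have z0: "z \<noteq> 0" using assms by auto
  have z1: "1 + 1/z \<noteq> 0"
  proof
    assume "1 + 1/z = 0"
    then have "z + 1 = 0" using z0 by (simp add: field_simps)
    then have "z = -1" by (simp add: eq_neg_iff_add_eq_0)
    then show False using assms by auto
  qed
  have e: "z + 1 = z * (1 + 1/z)" using z0 by (simp add: field_simps)
  have n2: "Im z \<noteq> 0 \<or> Re z > 0" using assms by (auto simp: complex_nonpos_Reals_iff)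
  have im: "Im (1 + 1/z) = - Im z / ((Re z)\<^sup>2 + (Im z)\<^sup>2)" by (simp add: Im_divide)
  have re: "Re (1 + 1/z) = 1 + Re z / ((Re z)\<^sup>2 + (Im z)\<^sup>2)" by (simp add: Re_divide)
  have pos: "(Re z)\<^sup>2 + (Im z)\<^sup>2 > 0"
    using z0 complex_eq_iff by (simp add: sum_power2_gt_zero_iff)
  have "- pi < Im (Ln z) + Im (Ln (1 + 1/z)) \<and> Im (Ln z) + Im (Ln (1 + 1/z)) \<le> pi"
  proof (cases "Im z > 0")
    case True
    have i: "Im (1 + 1/z) < 0" unfolding im using True pos by (simp add: divide_neg_pos)
    have "0 < Im (Ln z) \<and> Im (Ln z) < pi" using Im_Ln_pos_lt_imp[OF True] .
    moreover have "\<not> (0 \<le> Im (Ln (1 + 1/z)))" using i z1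
      by (meson Im_Ln_pos_le less_le_not_le linorder_not_le Im_Ln_le_pi)
    ultimately show ?thesis using mpi_less_Im_Ln[OF z1] by auto
  next
    case False
    show ?thesis
    proof (cases "Im z = 0")
      case True
      then have "Re z > 0" using n2 by auto
      then have "Im (Ln z) = 0" using Im_Ln_eq_0[OF z0] True by auto
      then show ?thesis using mpi_less_Im_Ln[OF z1] Im_Ln_le_pi[OF z1] by auto
    next
      case f: False
      then have n: "Im z < 0" using False by auto
      have i: "Im (1 + 1/z) > 0" unfolding im using divide_neg_pos[OF n pos] by simp
      have "\<not> (0 \<le> Im (Ln z))" using n z0
        by (meson Im_Ln_pos_le less_le_not_le linorder_not_le Im_Ln_le_pi)
      then show ?thesis using Im_Ln_pos_lt_imp[OF i] mpi_less_Im_Ln[OF z0] by auto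
    qed
  qed
  then show ?thesis unfolding e using Ln_times_simple[OF z0 z1] by auto
qed

text \<open>The recurrence of \<open>rGamma\<close> contributes the factor z + b = z (1 + b/z), the
  source of \<open>Ln (1 + b * u)\<close> in the defect; it must be nonzero to be written as an
  exponential. The last term of the defect is q/z - q/(z + 1) expressed in u = 1/z.\<close>

lemma stirling_quot_step:
  fixes b :: real
  assumes z: "z \<notin> \<real>\<^sub>\<le>\<^sub>0" and zb: "z + of_real b \<noteq> 0"
  defines "q \<equiv> complex_of_real (stirling_coeff b)"
  shows "stirling_quot b (z + 1) * exp (q / (z + 1)) = stirling_quot b z * exp (q / z) * exp (stirling_defect b (1/z))"
proof -
  have z0: "z \<noteq> 0" using z by auto
  have z1: "z + 1 \<noteq> 0"
  proof
    assume "z + 1 = 0"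
    then have "z = -1" by (simp add: eq_neg_iff_add_eq_0)
    then show False using z by auto
  qed
  have zb': "1 + of_real b * (1/z) \<noteq> 0" using zb z0 by (simp add: field_simps)
  have rg: "rGamma (z + of_real b) = (z + of_real b) * rGamma (z + 1 + of_real b)"
    using rGamma_plus1[of "z + of_real b"] by (simp add: add_ac)
  have dec: "stirling_defect b (1/z) = ((z + of_real b + 1/2) * Ln (1 + 1/z) - 1 - q / z + q / (z + 1)) - Ln (1 + of_real b * (1/z))"
  proof -
    have "q * (1/z)\<^sup>2 / (1 + 1/z) = q/z - q/(z+1)"
      using z0 z1 by (simp add: field_simps power2_eq_square)
    then show ?thesis by (simp add: stirling_defect_def q_def)
  qed
  have "exp (stirling_defect b (1/z)) = exp ((z + of_real b + 1/2) * Ln (1 + 1/z) - 1 - q / z + q / (z + 1)) / (1 + of_real b * (1/z))"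
    unfolding dec exp_diff[of _ "Ln (1 + of_real b * (1/z))"] using exp_Ln[OF zb'] by simp
  also have "1 + of_real b * (1/z) = (z + of_real b) / z" using z0 by (simp add: field_simps)
  finally have ed: "exp (stirling_defect b (1/z)) = exp ((z + of_real b + 1/2) * Ln (1 + 1/z) - 1 - q / z + q / (z + 1)) * z / (z + of_real b)"
    by simp
  have "exp (Ln z) = z" using z0 by simp
  then have ez: "z = exp (Ln z)" by simp
  have l: "Ln (z + 1) = Ln z + Ln (1 + 1/z)" by (rule Ln_plus1[OF z])
  have "stirling_quot b z * exp (q / z) * exp (stirling_defect b (1/z))
     = rGamma (z + 1 + of_real b) * (exp ((z + of_real b - 1/2) * Ln z - z) * exp (q / z) *
        exp ((z + of_real b + 1/2) * Ln (1 + 1/z) - 1 - q / z + q / (z + 1)) * exp (Ln z))"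
    unfolding ed stirling_quot_def rg using zb z0 by simp
  also have "exp ((z + of_real b - 1/2) * Ln z - z) * exp (q / z) *
        exp ((z + of_real b + 1/2) * Ln (1 + 1/z) - 1 - q / z + q / (z + 1)) * exp (Ln z)
      = exp ((z + of_real b - 1/2) * Ln z - z + q / z +
        ((z + of_real b + 1/2) * Ln (1 + 1/z) - 1 - q / z + q / (z + 1)) + Ln z)"
    by (simp only: exp_add)
  also have "\<dots> = exp (((z + 1) + of_real b - 1/2) * Ln (z+1) - (z+1) + q / (z + 1))"
    unfolding l by (simp add: algebra_simps)
  also have "rGamma (z + 1 + of_real b) * \<dots> = stirling_quot b (z + 1) * exp (q / (z + 1))"
    unfolding exp_add stirling_quot_def by (simp add: mult_ac)
  finally show ?thesis by simp
qed

text \<open>The sector |arg z| <= 2 pi / 3 outside a disc. Being wider than the right half-plane, it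
  contains all points of a half-plane Re s >= c, even with c < 0, that are far enough from the
  origin.\<close>

definition stirling_dom :: "real \<Rightarrow> complex set" where
  "stirling_dom R = {z. R \<le> norm z \<and> - norm z / 2 \<le> Re z}"

text \<open>Law of cosines with an angle of at most 2 pi / 3: |z + n|^2 >= |z|^2 - |z| n + n^2, and
  the right-hand side is ((|z| + n)/2)^2 + 3 ((|z| - n)/2)^2.\<close>

lemma stirling_dom_norm_add:
  assumes "z \<in> stirling_dom R"
  shows "(norm z + real n) / 2 \<le> norm (z + of_nat n)" "norm z / 2 \<le> norm (z + of_nat n)"
proof -
  have "(norm (z + of_nat n))\<^sup>2 = (norm z)\<^sup>2 + 2 * real n * Re z + (real n)\<^sup>2"
    unfolding cmod_power2 by (simp add: power2_eq_square algebra_simps)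
  moreover have "2 * real n * Re z \<ge> 2 * real n * (- norm z / 2)"
    using assms by (intro mult_left_mono) (auto simp: stirling_dom_def)
  ultimately have "((norm z + real n) / 2)\<^sup>2 + 3 * ((norm z - real n) / 2)\<^sup>2 \<le> (norm (z + of_nat n))\<^sup>2"
    by (simp add: power2_eq_square field_simps)
  then have "((norm z + real n) / 2)\<^sup>2 \<le> (norm (z + of_nat n))\<^sup>2"
    using zero_le_power2[of "(norm z - real n) / 2"] by linarith
  then show *: "(norm z + real n) / 2 \<le> norm (z + of_nat n)" by (rule power2_le_imp_le) simp
  have "norm z / 2 \<le> (norm z + real n) / 2" by simp
  with * show "norm z / 2 \<le> norm (z + of_nat n)" by linarith
qed

text \<open>Explains the threshold 4 (1 + |b|): a shift by n can halve the modulus, and what remains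
  must put 1/(z + n) into the disc of \<open>stirling_defect_bound\<close>.\<close>

lemma stirling_dom_norm_add_ge:
  assumes "z \<in> stirling_dom R" "R \<ge> 4 * (1 + \<bar>b\<bar>)"
  shows "norm (z + of_nat n) \<ge> 2 * (1 + \<bar>b\<bar>)"
proof -
  have "norm z \<ge> R" using assms by (simp add: stirling_dom_def)
  then show ?thesis using stirling_dom_norm_add(2)[OF assms(1), of n] assms(2) by linarith
qed

lemma stirling_dom_add_not_nonpos:
  assumes "z \<in> stirling_dom R" "R > 0"
  shows "z + of_nat n \<notin> \<real>\<^sub>\<le>\<^sub>0"
proof
  assume "z + of_nat n \<in> \<real>\<^sub>\<le>\<^sub>0"
  then have i: "Im z = 0" and r: "Re z + real n \<le> 0" by (auto simp: complex_nonpos_Reals_iff)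
  have "norm z = \<bar>Re z\<bar>" using i by (simp add: cmod_def)
  then show False using assms r by (auto simp: stirling_dom_def)
qed

lemma sum_inverse_cube_le:
  fixes x :: real
  assumes "x \<ge> 1"
  shows "(\<Sum>k<n. 1 / (x + real k) ^ 3) \<le> 2 / x\<^sup>2"
proof -
  \<comment> \<open>With y = x + k, one factor y of the cube is weakened to x and the rest to y (y +
    1) / 2, which leaves a telescoping difference.\<close>
  have t: "1 / (x + real k) ^ 3 \<le> (2 / x) * (1 / (x + real k) - 1 / (x + real (Suc k)))" for k
  proof -
    define y where "y = x + real k"
    have y: "x \<le> y" "1 \<le> y" using assms by (auto simp: y_def)
    have "(2 / x) * (1 / y - 1 / (y + 1)) = 2 / (x * (y * (y + 1)))"
      using assms y by (simp add: field_simps)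
    moreover have "x * (y * (y + 1)) \<le> y * (y * (y + y))"
      using assms y by (intro mult_mono) auto
    then have "2 / (y * (y * (y + y))) \<le> 2 / (x * (y * (y + 1)))"
      using assms y by (intro divide_left_mono) auto
    moreover have "2 / (y * (y * (y + y))) = 1 / y ^ 3"
      using y by (simp add: field_simps power3_eq_cube)
    ultimately show ?thesis by (simp add: y_def add_ac)
  qed
  have "(\<Sum>k<n. 1 / (x + real k) ^ 3) \<le> (\<Sum>k<n. (2 / x) * (1 / (x + real k) - 1 / (x + real (Suc k))))"
    by (intro sum_mono t)
  also have "\<dots> = (2 / x) * (1 / x - 1 / (x + real n))"
    by (simp only: sum_distrib_left[symmetric] sum_lessThan_telescope'[of "\<lambda>k. 1 / (x + real k)"]) simp
  also have "\<dots> \<le> (2 / x) * (1 / x)"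
    using assms by (intro mult_left_mono) auto
  finally show ?thesis by (simp add: power2_eq_square)
qed

lemma stirling_quot_iterate:
  fixes b :: real
  defines "q \<equiv> complex_of_real (stirling_coeff b)"
  assumes z: "z \<in> stirling_dom R" and R: "R \<ge> 4 * (1 + \<bar>b\<bar>)"
  shows "stirling_quot b (z + of_nat n) * exp (q / (z + of_nat n))
       = stirling_quot b z * exp (q / z) * exp (\<Sum>k<n. stirling_defect b (1 / (z + of_nat k)))"
proof (induction n)
  case (Suc n)
  have "\<bar>b\<bar> < 2 * (1 + \<bar>b\<bar>)" by simp
  also have "\<dots> \<le> norm (z + of_nat n)" by (rule stirling_dom_norm_add_ge[OF z R])
  finally have "norm (z + of_nat n) > \<bar>b\<bar>" .
  then have nb: "z + of_nat n + of_real b \<noteq> 0"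
    by (metis add_eq_0_iff norm_minus_cancel norm_of_real order_less_irrefl)
  have "stirling_quot b (z + of_nat n + 1) * exp (q / (z + of_nat n + 1))
      = stirling_quot b (z + of_nat n) * exp (q / (z + of_nat n)) * exp (stirling_defect b (1 / (z + of_nat n)))"
    unfolding q_def using R
    by (intro stirling_quot_step nb stirling_dom_add_not_nonpos[OF z]) simp
  then show ?case by (simp add: Suc exp_add mult.assoc add_ac)
qed simp

lemma stirling_defect_sum_bound:
  fixes b :: real
  obtains C where "C \<ge> 0"
    "\<And>R z k. R \<ge> 4 * (1 + \<bar>b\<bar>) \<Longrightarrow> z \<in> stirling_dom R \<Longrightarrow>
        norm (stirling_defect b (1 / (z + of_nat k))) \<le> C / (norm z + real k) ^ 3"
    "\<And>R z n. R \<ge> 4 * (1 + \<bar>b\<bar>) \<Longrightarrow> z \<in> stirling_dom R \<Longrightarrow>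
        norm (\<Sum>k<n. stirling_defect b (1 / (z + of_nat k))) \<le> 2 * C / (norm z)\<^sup>2"
proof -
  obtain C where C: "C \<ge> 0"
    "\<And>u. u \<noteq> 0 \<Longrightarrow> norm u \<le> 1 / (2 * (1 + \<bar>b\<bar>)) \<Longrightarrow> norm (stirling_defect b u) \<le> C * norm u ^ 3"
    using stirling_defect_bound[of b] by metis
  \<comment> \<open>The defect is cubic in 1/|z + k| and |z + k| is at least half of |z| + k, hence
    the factor 8.\<close>
  have 1: "norm (stirling_defect b (1 / (z + of_nat k))) \<le> (8 * C) / (norm z + real k) ^ 3"
    if R: "R \<ge> 4 * (1 + \<bar>b\<bar>)" and z: "z \<in> stirling_dom R" for R z k
  proof -
    have zn: "norm z \<ge> R" using z by (auto simp: stirling_dom_def)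
    have n: "norm (z + of_nat k) \<ge> (norm z + real k) / 2" by (rule stirling_dom_norm_add[OF z])
    have n2: "norm (z + of_nat k) \<ge> 2 * (1 + \<bar>b\<bar>)" by (rule stirling_dom_norm_add_ge[OF z R])
    have n0: "norm (z + of_nat k) > 0" by (rule less_le_trans[OF _ n2]) simp
    have "norm (1 / (z + of_nat k)) \<le> 1 / (2 * (1 + \<bar>b\<bar>))"
      unfolding norm_divide norm_one using n2 n0 by (intro divide_left_mono mult_pos_pos) auto
    then have "norm (stirling_defect b (1 / (z + of_nat k))) \<le> C * norm (1 / (z + of_nat k)) ^ 3"
      using n0 by (intro C) auto
    also have "\<dots> \<le> C * (1 / ((norm z + real k) / 2)) ^ 3"
      unfolding norm_divide norm_one using C(1) n n0 R zn
      by (intro mult_left_mono power_mono divide_left_mono) auto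
    finally show ?thesis by (simp add: power_divide mult_ac)
  qed
  have 2: "norm (\<Sum>k<n. stirling_defect b (1 / (z + of_nat k))) \<le> 2 * (8 * C) / (norm z)\<^sup>2"
    if R: "R \<ge> 4 * (1 + \<bar>b\<bar>)" and z: "z \<in> stirling_dom R" for R z n
  proof -
    have zn: "norm z \<ge> 1" using z R by (auto simp: stirling_dom_def)
    have "norm (\<Sum>k<n. stirling_defect b (1 / (z + of_nat k))) \<le> (\<Sum>k<n. (8 * C) / (norm z + real k) ^ 3)"
      by (intro sum_norm_le 1[OF R z])
    also have "\<dots> = (8 * C) * (\<Sum>k<n. 1 / (norm z + real k) ^ 3)"
      by (simp add: sum_distrib_left)
    also have "\<dots> \<le> (8 * C) * (2 / (norm z)\<^sup>2)"
      using C(1) by (intro mult_left_mono sum_inverse_cube_le zn) auto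
    finally show ?thesis by (simp add: mult_ac)
  qed
  show ?thesis by (rule that[OF _ 1 2]) (use C(1) in auto)
qed

section \<open>The constant in Stirling's formula\<close>

lemma tendsto_of_nat_Ln:
  fixes z c :: complex
  shows "(\<lambda>n. (z + of_nat n + c) * Ln (1 + z / of_nat n) - z) \<longlonglongrightarrow> 0"
proof -
  have le: "eventually (\<lambda>n. norm (of_nat n * Ln (1 + z / of_nat n) - z) \<le> 2 * (norm z)\<^sup>2 / real n) sequentially"
  proof -
    have "eventually (\<lambda>n. real n \<ge> 2 * norm z + 1) sequentially" by real_asymp
    then show ?thesis
    proof eventually_elim
      case (elim n)
      then have n0: "real n > 0" "n > 0" using norm_ge_zero[of z] by linarith+
      have u: "norm (z / of_nat n) \<le> 1/2"
        using elim n0 by (simp add: norm_divide field_simps)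
      have "{1..<2} = {1::nat}" by auto
      then have "norm (Ln (1 + z / of_nat n) - z / of_nat n) \<le> 2 * (norm (z / of_nat n))\<^sup>2"
        using norm_Ln_taylor_le[OF u, of 2] by simp
      then have "real n * norm (Ln (1 + z / of_nat n) - z / of_nat n) \<le> real n * (2 * (norm (z / of_nat n))\<^sup>2)"
        using n0 by (intro mult_left_mono) auto
      also have "\<dots> = 2 * (norm z)\<^sup>2 / real n"
        using n0 by (simp add: norm_divide field_simps power2_eq_square)
      also have "real n * norm (Ln (1 + z / of_nat n) - z / of_nat n) = norm (of_nat n * (Ln (1 + z / of_nat n) - z / of_nat n))"
        by (simp add: norm_mult)
      also have "of_nat n * (Ln (1 + z / of_nat n) - z / of_nat n) = of_nat n * Ln (1 + z / of_nat n) - z"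
        using n0 by (simp add: algebra_simps)
      finally show ?case .
    qed
  qed
  have l: "(\<lambda>n. 2 * (norm z)\<^sup>2 / real n) \<longlonglongrightarrow> 0" by real_asymp
  have a: "(\<lambda>n. of_nat n * Ln (1 + z / of_nat n) - z) \<longlonglongrightarrow> 0"
    by (rule Lim_null_comparison[OF le l])
  have u: "(\<lambda>n. z / of_nat n) \<longlonglongrightarrow> 0"
    by (intro tendsto_divide_0[OF tendsto_const] tendsto_of_nat)
  have b: "(\<lambda>n. Ln (1 + z / of_nat n)) \<longlonglongrightarrow> Ln (1 + 0)"
    by (intro tendsto_intros u) auto
  have "(\<lambda>n. (of_nat n * Ln (1 + z / of_nat n) - z) + (z + c) * Ln (1 + z / of_nat n)) \<longlonglongrightarrow> 0 + (z + c) * Ln (1 + 0)"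
    by (intro tendsto_add a tendsto_mult tendsto_const b)
  then show ?thesis by (simp add: algebra_simps)
qed

text \<open>Gauss's product: \<open>rGamma_series s n\<close> tends to \<open>rGamma s\<close>,
  which says that Gamma(n + s) / Gamma(n) behaves like n^s. The Stirling factors that remain after
  dividing tend to 1 by \<open>tendsto_of_nat_Ln\<close>. This compares every z and b with the
  integers and b = 0, without giving the constant itself.\<close>

lemma stirling_quot_ratio:
  fixes b :: real
  assumes nz: "z + of_real b \<notin> \<int>\<^sub>\<le>\<^sub>0"
  shows "(\<lambda>n. stirling_quot b (z + of_nat n) / stirling_quot 0 (of_nat n)) \<longlonglongrightarrow> 1"
proof -
  define s where "s = z + of_real b"
  have rs: "rGamma s \<noteq> 0" using nz by (simp add: s_def rGamma_eq_zero_iff)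
  have u: "(\<lambda>n. z / of_nat n) \<longlonglongrightarrow> 0" for z :: complex
    by (intro tendsto_divide_0[OF tendsto_const] tendsto_of_nat)
  have l1: "(\<lambda>n. (rGamma s / rGamma_series s n) * (1 + s / of_nat n)
      * exp ((z + of_nat n + (of_real b - 1/2)) * Ln (1 + z / of_nat n) - z)) \<longlonglongrightarrow> (rGamma s / rGamma s) * (1 + 0) * exp 0"
    by (intro tendsto_intros tendsto_of_nat_Ln u rs)
  have "eventually (\<lambda>n. 1 + z / of_nat n \<noteq> 0) sequentially"
    by (rule tendsto_imp_eventually_ne[OF tendsto_add[OF tendsto_const u]]) simp
  moreover have "eventually (\<lambda>n. n > (0::nat)) sequentially" by (rule eventually_gt_at_top)
  moreover have "eventually (\<lambda>n. rGamma_series s n \<noteq> 0) sequentially"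
    using rGamma_series_LIMSEQ rs by (rule tendsto_imp_eventually_ne)
  ultimately have "eventually (\<lambda>n. (rGamma s / rGamma_series s n) * (1 + s / of_nat n)
      * exp ((z + of_nat n + (of_real b - 1/2)) * Ln (1 + z / of_nat n) - z)
      = stirling_quot b (z + of_nat n) / stirling_quot 0 (of_nat n)) sequentially"
  proof eventually_elim
    case (elim n)
    have n: "n > 0" by fact
    have "rGamma (of_nat n :: complex) = inverse (fact (n - 1))"
      using rGamma_of_int[of "int n", where 'a = complex] n by (simp add: nat_diff_distrib)
    then have rn: "rGamma (of_nat n :: complex) = of_nat n / fact n"
      using n by (cases n) (auto simp: field_simps simp del: of_nat_Suc)
    have lz: "Ln (z + of_nat n) = of_real (ln (real n)) + Ln (1 + z / of_nat n)"
    proof -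
      have "z + of_nat n = of_real (real n) * (1 + z / of_nat n)" using n by (simp add: field_simps)
      then show ?thesis using Ln_times_of_real[of "real n" "1 + z / of_nat n"] n elim(1) by simp
    qed
    have ln: "Ln (of_nat n) = of_real (ln (real n))"
      using n Ln_of_real[of "real n"] by simp
    define L where "L = complex_of_real (ln (real n))"
    have p: "pochhammer s n \<noteq> 0" "s + of_nat n \<noteq> 0" using elim(3)
      by (auto simp: rGamma_series_def pochhammer_Suc)
    have rsn: "rGamma s = pochhammer s n * rGamma (s + of_nat n)" by (rule pochhammer_rGamma)
    have A: "(rGamma s / rGamma_series s n) * (1 + s / of_nat n) = rGamma (s + of_nat n) * exp (s * L) / rGamma (of_nat n)"
    proof -
      have "1 + s / of_nat n = (s + of_nat n) / of_nat n" using n by (simp add: field_simps)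
      then show ?thesis
        unfolding rsn rGamma_series_def rn L_def using n p by (simp add: pochhammer_Suc)
    qed
    let ?A = "(z + of_nat n + of_real b - 1/2) * Ln (z + of_nat n) - (z + of_nat n)"
    let ?B = "(of_nat n - 1/2) * L - of_nat n"
    have "stirling_quot b (z + of_nat n) / stirling_quot 0 (of_nat n) =
       rGamma (s + of_nat n) / rGamma (of_nat n) * (exp ?A / exp ?B)"
      by (simp add: stirling_quot_def ln L_def s_def add_ac)
    also have "exp ?A / exp ?B = exp (?A - ?B)" by (rule exp_diff[symmetric])
    also have "((z + of_nat n + of_real b - 1/2) * Ln (z + of_nat n) - (z + of_nat n)) - ((of_nat n - 1/2) * L - of_nat n)
       = s * L + ((z + of_nat n + (of_real b - 1/2)) * Ln (1 + z / of_nat n) - z)"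
      unfolding lz L_def s_def by (simp add: algebra_simps)
    finally show ?case unfolding A by (simp add: exp_add)
  qed
  from Lim_transform_eventually[OF l1 this] show ?thesis using rs by simp
qed

text \<open>Legendre's duplication formula in terms of the quotients. The exponents agree exactly
  except for -(ln 2)/2, which turns sqrt pi into sqrt (2 pi).\<close>

lemma stirling_quot_0_duplication:
  assumes n: "n > 0"
  shows "stirling_quot 0 (of_nat n) * stirling_quot (1/2) (of_nat n) = stirling_quot 0 (of_nat (2 * n)) / of_real (sqrt (2 * pi))"
proof -
  define x :: complex where "x = of_nat n"
  define L where "L = complex_of_real (ln (real n))"
  have "x \<notin> \<int>\<^sub>\<le>\<^sub>0"
  proof
    assume "x \<in> \<int>\<^sub>\<le>\<^sub>0"
    then obtain k where "x = - of_nat k" by (auto elim: nonpos_Ints_cases')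
    then have "of_nat (n + k) = (0::complex)" by (simp add: x_def)
    then show False using n by (metis of_nat_eq_0_iff add_is_0 less_irrefl)
  qed
  moreover have "x + 1/2 \<notin> \<int>\<^sub>\<le>\<^sub>0"
  proof
    assume "x + 1/2 \<in> \<int>\<^sub>\<le>\<^sub>0"
    then have "x + 1/2 \<in> \<real>\<^sub>\<le>\<^sub>0" using nonpos_Ints_subset_nonpos_Reals by blast
    then show False by (simp add: x_def complex_nonpos_Reals_iff)
  qed
  ultimately have "Gamma x * Gamma (x + 1/2) = exp ((1 - 2*x) * of_real (ln 2)) * of_real (sqrt pi) * Gamma (2*x)"
    by (rule Gamma_legendre_duplication)
  then have g: "rGamma x * rGamma (x + 1/2) = exp (- ((1 - 2*x) * of_real (ln 2))) / of_real (sqrt pi) * rGamma (2*x)"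
    unfolding exp_minus rGamma_inverse_Gamma inverse_mult_distrib[symmetric] divide_inverse
    by (simp only: inverse_mult_distrib)
  have ln: "Ln x = L" using n Ln_of_real[of "real n"] by (simp add: x_def L_def)
  have ln2: "Ln (2 * x) = of_real (ln 2) + L"
    using n Ln_of_real[of "2 * real n"] by (simp add: x_def L_def ln_mult)
  have "exp (of_real (ln 2 / 2)) = complex_of_real (sqrt 2)"
  proof -
    have "exp (ln 2 / 2 :: real) = sqrt 2"
      using powr_half_sqrt[of 2] by (simp add: powr_def)
    then show ?thesis by (metis exp_of_real)
  qed
  then have e2: "exp (- (of_real (ln 2 / 2))) = 1 / complex_of_real (sqrt 2)"
    by (simp add: exp_minus inverse_eq_divide)
  have "stirling_quot 0 x * stirling_quot (1/2) x = rGamma x * rGamma (x + 1/2) * exp (((x - 1/2) * L - x) + (x * L - x))"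
    unfolding stirling_quot_def ln exp_add by (simp add: mult_ac)
  also have "\<dots> = rGamma (2*x) / of_real (sqrt pi) * exp (- ((1 - 2*x) * of_real (ln 2)) + (((x - 1/2) * L - x) + (x * L - x)))"
    unfolding g exp_add by simp
  also have "- ((1 - 2*x) * of_real (ln 2)) + (((x - 1/2) * L - x) + (x * L - x))
      = ((2*x - 1/2) * (of_real (ln 2) + L) - 2*x) + - (of_real (ln 2 / 2))"
    by (simp add: algebra_simps)
  also have "rGamma (2*x) / of_real (sqrt pi) * exp \<dots> = stirling_quot 0 (2*x) / of_real (sqrt (2 * pi))"
    unfolding exp_add e2 stirling_quot_def ln2 by (simp add: real_sqrt_mult)
  finally show ?thesis by (simp add: x_def)
qed

text \<open>The limit $v$ exists and is nonzero because the defects are summable; the duplication formula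
  gives $v^2 = v/\sqrt{2\pi}$.\<close>

lemma stirling_quot_0_limit: "(\<lambda>n. stirling_quot 0 (of_nat n)) \<longlonglongrightarrow> 1 / of_real (sqrt (2 * pi))"
proof -
  define q where "q = complex_of_real (stirling_coeff 0)"
  obtain C where C: "C \<ge> 0"
    "\<And>R z k. R \<ge> 4 * (1 + \<bar>0\<bar>) \<Longrightarrow> z \<in> stirling_dom R \<Longrightarrow>
        norm (stirling_defect 0 (1 / (z + of_nat k))) \<le> C / (norm z + real k) ^ 3"
    using stirling_defect_sum_bound[of 0] by metis
  \<comment> \<open>The iteration starts at 4 because this is the least radius the sector lemmas
    admit for b = 0.\<close>
  have d: "(4::complex) \<in> stirling_dom 4" by (simp add: stirling_dom_def)
  define S where "S = (\<lambda>k. stirling_defect 0 (1 / (4 + of_nat k)))"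
  have "summable S"
  proof (rule summable_comparison_test')
    show "summable (\<lambda>k. C * (1 / real k ^ 2))"
      by (intro summable_mult) (use inverse_power_summable[of 2, where 'a = real] in \<open>simp add: field_simps\<close>)
    fix k :: nat assume k: "k \<ge> 1"
    have "norm (S k) \<le> C / (4 + real k) ^ 3" using C(2)[OF _ d, of k] by (simp add: S_def)
    also have "\<dots> \<le> C / real k ^ 2"
    proof (intro divide_left_mono C)
      have "real k ^ 2 \<le> (4 + real k) ^ 2" by (intro power_mono) auto
      also have "\<dots> \<le> (4 + real k) ^ 3" by (intro power_increasing) auto
      finally show "real k ^ 2 \<le> (4 + real k) ^ 3" .
    qed (use k in auto)
    finally show "norm (S k) \<le> C * (1 / real k ^ 2)" by simp
  qed
  then have s: "(\<lambda>n. \<Sum>k<n. S k) \<longlonglongrightarrow> suminf S" by (rule summable_LIMSEQ)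
  define V where "V = (\<lambda>n. stirling_quot 0 (of_nat n))"
  define v where "v = V 4 * exp (q / 4) * exp (suminf S)"
  have it: "V (n + 4) = V 4 * exp (q / 4) * exp (\<Sum>k<n. S k) * exp (- (q / (4 + of_nat n)))" for n
    using stirling_quot_iterate[OF d, of 0 n] unfolding S_def V_def q_def
    by (simp add: exp_minus field_simps)
  have qn: "(\<lambda>n. q / (4 + of_nat n)) \<longlonglongrightarrow> 0"
    by (intro tendsto_divide_0[OF tendsto_const] tendsto_add_filterlim_at_infinity[OF tendsto_const] tendsto_of_nat)
  have "(\<lambda>n. V (n + 4)) \<longlonglongrightarrow> V 4 * exp (q / 4) * exp (suminf S) * exp (- 0)"
    unfolding it by (intro tendsto_intros s qn)
  then have "(\<lambda>n. V (n + 4)) \<longlonglongrightarrow> v" by (simp add: v_def)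
  then have V: "V \<longlonglongrightarrow> v" by (rule LIMSEQ_offset)
  \<comment> \<open>All factors of \<open>v\<close> are nonzero; this excludes the root 0 of the
    quadratic equation that \<open>v\<close> will satisfy.\<close>
  have "rGamma (4::complex) \<noteq> 0"
    using rGamma_of_int[of 4, where 'a = complex] by simp
  then have v0: "v \<noteq> 0" by (simp add: v_def V_def stirling_quot_def)
  have h: "(0::complex) + of_real (1/2) \<notin> \<int>\<^sub>\<le>\<^sub>0"
  proof
    assume "(0::complex) + of_real (1/2) \<in> \<int>\<^sub>\<le>\<^sub>0"
    then have "(0::complex) + of_real (1/2) \<in> \<real>\<^sub>\<le>\<^sub>0" using nonpos_Ints_subset_nonpos_Reals by blast
    then show False by (simp add: complex_nonpos_Reals_iff)
  qed
  have r: "(\<lambda>n. stirling_quot (1/2) (of_nat n) / V n) \<longlonglongrightarrow> 1"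
    using stirling_quot_ratio[OF h] by (simp add: V_def)
  have l1: "(\<lambda>n. V n * (stirling_quot (1/2) (of_nat n) / V n * V n)) \<longlonglongrightarrow> v * (1 * v)"
    by (intro tendsto_intros r V)
  have "eventually (\<lambda>n. V n \<noteq> 0) sequentially" using V v0 by (rule tendsto_imp_eventually_ne)
  moreover have "eventually (\<lambda>n. n > (0::nat)) sequentially" by (rule eventually_gt_at_top)
  ultimately have "eventually (\<lambda>n. V n * (stirling_quot (1/2) (of_nat n) / V n * V n) = V (2 * n) / of_real (sqrt (2 * pi))) sequentially"
    by eventually_elim (use stirling_quot_0_duplication in \<open>simp add: V_def\<close>)
  from Lim_transform_eventually[OF l1 this] have "(\<lambda>n. V (2 * n) / of_real (sqrt (2 * pi))) \<longlonglongrightarrow> v * v" by simp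
  moreover have "(\<lambda>n. V (2 * n) / of_real (sqrt (2 * pi))) \<longlonglongrightarrow> v / of_real (sqrt (2 * pi))"
  proof (intro tendsto_divide tendsto_const)
    have "strict_mono ((*) (2::nat))" by (simp add: strict_mono_def)
    from LIMSEQ_subseq_LIMSEQ[OF V this] show "(\<lambda>n. V (2 * n)) \<longlonglongrightarrow> v" by (simp add: o_def)
  qed auto
  ultimately have "v * v = v / of_real (sqrt (2 * pi))" by (rule LIMSEQ_unique)
  then have "v = 1 / of_real (sqrt (2 * pi))" using v0 by (simp add: field_simps)
  then show ?thesis using V by (simp add: V_def)
qed

text \<open>Iterating \<open>stirling_quot_step\<close> from z to z + n and letting n grow
  identifies the value at z: the far end tends to 1 / sqrt (2 pi) by comparison with the integers,
  and all defects together are O(|z|^(-2)). Expanding exp(-q/z) to first order produces the 1/z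
  term.\<close>

theorem stirling_quot_asymp:
  fixes b :: real
  obtains R C where "R \<ge> 1" "C \<ge> 0"
    "\<And>z. z \<in> stirling_dom R \<Longrightarrow>
      norm (of_real (sqrt (2 * pi)) * stirling_quot b z - (1 - of_real (stirling_coeff b) / z)) \<le> C / (norm z)\<^sup>2"
proof -
  define q where "q = complex_of_real (stirling_coeff b)"
  define S2 where "S2 = complex_of_real (sqrt (2 * pi))"
  have S2: "S2 \<noteq> 0" by (simp add: S2_def)
  obtain D where D: "D \<ge> 0"
    "\<And>R z n. R \<ge> 4 * (1 + \<bar>b\<bar>) \<Longrightarrow> z \<in> stirling_dom R \<Longrightarrow>
        norm (\<Sum>k<n. stirling_defect b (1 / (z + of_nat k))) \<le> 2 * D / (norm z)\<^sup>2"
    using stirling_defect_sum_bound[of b] by metis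
  \<comment> \<open>The three lower bounds serve, in this order, to apply the defect bounds, to make
    the total defect at most 1, and to make |q/z| at most 1.\<close>
  define R where "R = max (4 * (1 + \<bar>b\<bar>)) (max (2 * D + 1) (norm q + 1))"
  have R: "R \<ge> 4 * (1 + \<bar>b\<bar>)" "R \<ge> 2 * D + 1" "R \<ge> norm q + 1" "R \<ge> 1" by (auto simp: R_def)
  define C where "C = exp 1 * (2 * D * exp 1 + (norm q)\<^sup>2)"
  have "norm (S2 * stirling_quot b z - (1 - q / z)) \<le> C / (norm z)\<^sup>2" if z: "z \<in> stirling_dom R" for z
  proof -
    have zn: "norm z \<ge> R" using z by (auto simp: stirling_dom_def)
    then have z1: "norm z \<ge> 1" using R by linarith
    define T where "T = stirling_quot b z * exp (q / z)"
    define E where "E = (\<lambda>n. \<Sum>k<n. stirling_defect b (1 / (z + of_nat k)))"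
    have zb: "z + of_real b \<notin> \<int>\<^sub>\<le>\<^sub>0"
    proof
      assume "z + of_real b \<in> \<int>\<^sub>\<le>\<^sub>0"
      then have "z + of_real b \<in> \<real>\<^sub>\<le>\<^sub>0" using nonpos_Ints_subset_nonpos_Reals by blast
      then have i: "Im z = 0" "Re z + b \<le> 0" by (auto simp: complex_nonpos_Reals_iff)
      have "norm z = \<bar>Re z\<bar>" using i by (simp add: cmod_def)
      then show False using z R i by (auto simp: stirling_dom_def)
    qed
    have E: "norm (E n) \<le> 2 * D / (norm z)\<^sup>2" for n
      unfolding E_def by (rule D(2)[OF R(1) z])
    have "2 * D / (norm z)\<^sup>2 \<le> 1"
    proof -
      have "2 * D \<le> norm z * 1" using zn R by simp
      also have "\<dots> \<le> norm z * norm z" using z1 by (intro mult_left_mono) auto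
      moreover have "(norm z)\<^sup>2 > 0" using z1 by (intro zero_less_power) linarith
      ultimately show ?thesis by (simp add: divide_le_eq_1_pos power2_eq_square)
    qed
    then have E1: "norm (E n) \<le> 1" for n using E[of n] by linarith
    define X where "X = (\<lambda>n. stirling_quot b (z + of_nat n) * exp (q / (z + of_nat n)))"
    have X: "X n = T * exp (E n)" for n
      unfolding X_def T_def E_def q_def by (rule stirling_quot_iterate[OF z R(1)])
    have "(\<lambda>n. stirling_quot b (z + of_nat n) / stirling_quot 0 (of_nat n) * stirling_quot 0 (of_nat n) * exp (q / (z + of_nat n)))
         \<longlonglongrightarrow> 1 * (1 / S2) * exp 0"
      unfolding S2_def
      by (intro tendsto_intros stirling_quot_ratio[OF zb] stirling_quot_0_limit tendsto_divide_0[OF tendsto_const]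
             tendsto_add_filterlim_at_infinity[OF tendsto_const] tendsto_of_nat)
    moreover have "eventually (\<lambda>n. stirling_quot 0 (of_nat n) \<noteq> 0) sequentially"
      using stirling_quot_0_limit by (rule tendsto_imp_eventually_ne) (use S2 in \<open>auto simp: S2_def\<close>)
    then have "eventually (\<lambda>n. stirling_quot b (z + of_nat n) / stirling_quot 0 (of_nat n) * stirling_quot 0 (of_nat n) * exp (q / (z + of_nat n)) = X n) sequentially"
      by eventually_elim (simp add: X_def)
    ultimately have XL: "X \<longlonglongrightarrow> 1 / S2" using Lim_transform_eventually by fastforce
    \<comment> \<open>The error is measured relative to \<open>X n\<close> and not to
      \<open>T\<close>, because the limit of \<open>X n\<close> is the known quantity and the
      inequality can then be passed to the limit.\<close>
    have "norm (T - X n) \<le> norm (X n) * (2 * D * exp 1 / (norm z)\<^sup>2)" for n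
    proof -
      have eq: "T - X n = X n * (exp (- E n) - 1)" unfolding X by (simp add: algebra_simps flip: exp_add)
      have "norm (exp (- E n) - 1) \<le> exp (norm (E n)) * norm (E n)"
        using Taylor_exp_field[of "- E n" 0] by simp
      also have "\<dots> \<le> exp 1 * (2 * D / (norm z)\<^sup>2)"
        using E[of n] E1[of n] by (intro mult_mono) auto
      also have "\<dots> = 2 * D * exp 1 / (norm z)\<^sup>2" by simp
      finally show ?thesis unfolding eq norm_mult by (rule mult_left_mono) simp
    qed
    then have "norm (T - 1 / S2) \<le> norm (1 / S2) * (2 * D * exp 1 / (norm z)\<^sup>2)"
      by (intro tendsto_le[OF sequentially_bot tendsto_mult[OF tendsto_norm[OF XL] tendsto_const]
           tendsto_norm[OF tendsto_diff[OF tendsto_const XL]]] always_eventually allI)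
    then have "norm S2 * norm (T - 1 / S2) \<le> norm S2 * (norm (1 / S2) * (2 * D * exp 1 / (norm z)\<^sup>2))"
      by (intro mult_left_mono) auto
    then have T: "norm (S2 * T - 1) \<le> 2 * D * exp 1 / (norm z)\<^sup>2"
      using S2 by (simp add: norm_divide algebra_simps flip: norm_mult)
    have "norm q \<le> norm z" "norm z > 0" using zn R(3) z1 by linarith+
    then have qz: "norm (q / z) \<le> 1" by (simp add: norm_divide divide_le_eq_1_pos)
    have "stirling_quot b z = T * exp (- (q / z))" by (simp add: T_def exp_minus)
    then have "S2 * stirling_quot b z - (1 - q / z) = (S2 * T - 1) * exp (- (q / z)) + (exp (- (q / z)) - (1 + - (q / z)))"
      by (simp add: algebra_simps)
    also have "norm \<dots> \<le> norm (S2 * T - 1) * norm (exp (- (q / z))) + norm (exp (- (q / z)) - (1 + - (q / z)))"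
      by (rule order_trans[OF norm_triangle_ineq]) (simp add: norm_mult)
    also have "\<dots> \<le> (2 * D * exp 1 / (norm z)\<^sup>2) * exp 1 + exp 1 * (norm q)\<^sup>2 / (norm z)\<^sup>2"
    proof (intro add_mono mult_mono T)
      have "norm (exp (- (q / z))) \<le> exp (norm (- (q / z)))" by (rule norm_exp)
      also have "\<dots> \<le> exp 1" using qz by simp
      finally show "norm (exp (- (q / z))) \<le> exp 1" .
      have "norm (exp (- (q / z)) - (1 + - (q / z))) \<le> exp (norm (- (q / z))) * (norm (- (q / z)))\<^sup>2"
        using Taylor_exp_field[of "- (q / z)" 1] by (simp add: numeral_2_eq_2)
      also have "\<dots> \<le> exp 1 * (norm (- (q / z)))\<^sup>2" using qz by (intro mult_right_mono) auto
      also have "\<dots> = exp 1 * (norm q)\<^sup>2 / (norm z)\<^sup>2" by (simp add: norm_divide power_divide)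
      finally show "norm (exp (- (q / z)) - (1 + - (q / z))) \<le> exp 1 * (norm q)\<^sup>2 / (norm z)\<^sup>2" .
    qed (use D in auto)
    also have "\<dots> = C / (norm z)\<^sup>2" by (simp add: C_def algebra_simps add_divide_distrib)
    finally show ?thesis .
  qed
  moreover have "C \<ge> 0" using D by (simp add: C_def)
  ultimately show ?thesis using that[of R C] R(4) by (simp add: q_def S2_def)
qed

section \<open>The Abel-Plana formula\<close>

text \<open>An entire function has a primitive, so the three points may be in any position. This
  replaces Cauchy's theorem wherever a contour is deformed below.\<close>

lemma contour_integral_entire_linepath_split:
  assumes "f holomorphic_on UNIV"
  shows "contour_integral (linepath a c) f = contour_integral (linepath a b) f + contour_integral (linepath b c) f"
proof -
  obtain F where F: "\<And>z. (F has_field_derivative f z) (at z)"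
    using holomorphic_convex_primitive'[OF convex_UNIV open_UNIV assms] by auto
  have "contour_integral (linepath p q) f = F q - F p" for p q
    using contour_integral_primitive[of UNIV F f "linepath p q"] F
    by (auto intro!: contour_integral_unique)
  then show ?thesis by simp
qed

text \<open>Majorizing by a function with an explicit primitive gives estimates that do not grow
  with the length \<open>Y\<close>; exponential and power majorants are the two uses.\<close>

lemma contour_integral_segment_bound:
  assumes cont: "continuous_on (closed_segment p (p + of_real Y * v)) h"
    and Y: "Y \<ge> 0" and v: "norm v = 1"
    and le: "\<And>u. 0 \<le> u \<Longrightarrow> u \<le> Y \<Longrightarrow> norm (h (p + of_real u * v)) \<le> g u"
    and deriv: "\<And>u. 0 \<le> u \<Longrightarrow> u \<le> Y \<Longrightarrow> (G has_real_derivative g u) (at u)"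
  shows "norm (contour_integral (linepath p (p + of_real Y * v)) h) \<le> G Y - G 0"
proof -
  have lp: "linepath p (p + of_real Y * v) t = p + of_real (t * Y) * v" for t
    by (simp add: linepath_def scaleR_conv_of_real algebra_simps)
  have ci: "h contour_integrable_on linepath p (p + of_real Y * v)"
    by (rule contour_integrable_continuous_linepath[OF cont])
  have hi: "((\<lambda>t. h (p + of_real (t * Y) * v) * (of_real Y * v)) has_integral
        contour_integral (linepath p (p + of_real Y * v)) h) {0..1}"
    using has_contour_integral_integral[OF ci]
    unfolding has_contour_integral_linepath lp by simp
  have gi: "((\<lambda>t. g (t * Y) * Y) has_integral (G (1 * Y) - G (0 * Y))) {0..1}"
  proof (rule fundamental_theorem_of_calculus)
    fix t :: real assume t: "t \<in> {0..1}"
    have "0 \<le> t * Y" "t * Y \<le> Y" using t Y by (auto simp: mult_left_le_one_le)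
    then have "(G has_real_derivative g (t * Y)) (at (t * Y))" by (rule deriv)
    then have "((\<lambda>t. G (t * Y)) has_real_derivative g (t * Y) * Y) (at t)"
      by (rule DERIV_chain2) (auto intro!: derivative_eq_intros)
    then show "((\<lambda>t. G (t * Y)) has_vector_derivative g (t * Y) * Y) (at t within {0..1})"
      by (simp add: has_real_derivative_iff_has_vector_derivative has_vector_derivative_at_within)
  qed simp
  have "norm (contour_integral (linepath p (p + of_real Y * v)) h) \<le> (G (1 * Y) - G (0 * Y)) \<bullet> (1::real)"
  proof (rule has_integral_norm_bound_integral_component[OF hi gi])
    fix t :: real assume t: "t \<in> {0..1}"
    have "0 \<le> t * Y" "t * Y \<le> Y" using t Y by (auto simp: mult_left_le_one_le)
    then have "norm (h (p + of_real (t * Y) * v)) * Y \<le> g (t * Y) * Y"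
      using Y by (intro mult_right_mono le)
    then show "norm (h (p + of_real (t * Y) * v) * (of_real Y * v)) \<le> (g (t * Y) * Y) \<bullet> 1"
      using Y v by (simp add: norm_mult)
  qed
  then show ?thesis by simp
qed

section \<open>Summation by residues at the integers\<close>

definition cexp1 :: "complex \<Rightarrow> complex" where
  "cexp1 s = exp (2 * of_real pi * \<i> * s)"

lemma cexp1_eq_1_iff: "cexp1 s = 1 \<longleftrightarrow> s \<in> \<int>"
proof
  assume "cexp1 s = 1"
  then obtain n :: int where n: "Re (2 * of_real pi * \<i> * s) = 0" "Im (2 * of_real pi * \<i> * s) = of_int (2 * n) * pi"
    unfolding cexp1_def exp_eq_1 by auto
  then have "Im s = 0" "Re s = of_int n" by auto
  then have "s = of_int n" by (simp add: complex_eq_iff)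
  then show "s \<in> \<int>" by simp
next
  assume "s \<in> \<int>"
  then obtain n where "s = of_int n" by (auto elim: Ints_cases)
  then show "cexp1 s = 1" unfolding cexp1_def exp_eq_1 by auto
qed

lemma holomorphic_on_cexp1 [holomorphic_intros]: "cexp1 holomorphic_on A"
  unfolding cexp1_def by (intro holomorphic_intros)

lemma norm_cexp1: "norm (cexp1 s) = exp (- 2 * pi * Im s)"
  by (simp add: cexp1_def)

lemma residue_cexp1:
  assumes f: "f holomorphic_on UNIV"
  shows "residue (\<lambda>s. f s / (cexp1 s - 1)) (of_int k) = f (of_int k) / (2 * of_real pi * \<i>)"
proof (rule residue_simple'[where s = "ball (of_int k) 1"])
  have nI: "s \<notin> \<int>" if "s \<in> ball (of_int k) 1 - {of_int k}" for s :: complex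
  proof
    assume "s \<in> \<int>"
    then obtain n where n: "s = of_int n" by (auto elim: Ints_cases)
    have "norm (of_int (k - n) :: complex) < 1" using that n by (simp add: dist_norm)
    then have "k = n" by (simp only: norm_of_int)
    then show False using that n by simp
  qed
  show "(\<lambda>s. f s / (cexp1 s - 1)) holomorphic_on ball (of_int k) 1 - {of_int k}"
    using nI by (intro holomorphic_intros holomorphic_on_subset[OF f]) (auto simp: cexp1_eq_1_iff)
  have "(cexp1 has_field_derivative 2 * of_real pi * \<i> * cexp1 (of_int k)) (at (of_int k))"
    unfolding cexp1_def by (auto intro!: derivative_eq_intros)
  moreover have c1: "cexp1 (of_int k) = 1" by (simp add: cexp1_eq_1_iff)
  ultimately have "((\<lambda>w. (cexp1 w - 1) / (w - of_int k)) \<longlongrightarrow> 2 * of_real pi * \<i>) (at (of_int k))"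
    by (simp add: has_field_derivative_iff)
  moreover have "isCont f (of_int k)"
    using f holomorphic_on_imp_continuous_on[OF f] by (simp add: continuous_on_eq_continuous_at)
  then have "(f \<longlongrightarrow> f (of_int k)) (at (of_int k))" by (simp add: isCont_def)
  ultimately have "((\<lambda>w. f w / ((cexp1 w - 1) / (w - of_int k))) \<longlongrightarrow> f (of_int k) / (2 * of_real pi * \<i>)) (at (of_int k))"
    by (intro tendsto_divide) auto
  then show "((\<lambda>w. f w / (cexp1 w - 1) * (w - of_int k)) \<longlongrightarrow> f (of_int k) / (2 * of_real pi * \<i>)) (at (of_int k))"
    by (simp add: field_simps)
qed auto

text \<open>On the upper half of the rectangle $1/(e^{2\pi i s} - 1)$ is replaced by
  $-1 - e^{2\pi i s}/(1 - e^{2\pi i s})$, and the $-1$ contributes the integral of $f$ along the real axis.\<close>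

lemma abel_plana_rectangle:
  fixes c X Y :: real
  assumes f: "f holomorphic_on UNIV" and c: "c \<notin> \<int>" and X: "X \<notin> \<int>" and cX: "c < X" and Y: "Y > 0"
  defines "K \<equiv> \<lambda>s. f s / (cexp1 s - 1)"
    and "U \<equiv> \<lambda>s. f s * cexp1 s / (1 - cexp1 s)"
  shows "(\<Sum>k\<in>{k::int. c < k \<and> k < X}. f (of_int k)) - contour_integral (linepath (of_real c) (of_real X)) f =
      contour_integral (linepath c (c - \<i> * Y)) K + contour_integral (linepath (c - \<i> * Y) (X - \<i> * Y)) K
      - contour_integral (linepath X (X - \<i> * Y)) K
      + (contour_integral (linepath c (c + \<i> * Y)) U + contour_integral (linepath (c + \<i> * Y) (X + \<i> * Y)) U
      - contour_integral (linepath X (X + \<i> * Y)) U)"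
proof -
  let ?J = "\<lambda>a b. contour_integral (linepath a b)"
  define P where "P = {k::int. c < k \<and> k < X}"
  have finP: "finite P"
    by (rule finite_subset[of _ "{\<lfloor>c\<rfloor>..\<lceil>X\<rceil>}"]) (auto simp: P_def, linarith+)
  \<comment> \<open>The open strip between the neighbouring integers outside \<open>c\<close> and
    \<open>X\<close>: it contains the closed rectangle, and its only integers are those to be summed
    over.\<close>
  define S where "S = {s::complex. \<lfloor>c\<rfloor> < Re s \<and> Re s < \<lceil>X\<rceil>}"
  have fc: "\<lfloor>c\<rfloor> < c" using c by (metis Ints_of_int floor_correct less_le)
  have cX': "X < \<lceil>X\<rceil>" using X by (metis Ints_of_int le_of_int_ceiling less_le)
  have Seq: "S = {s. \<lfloor>c\<rfloor> < Re s} \<inter> {s. Re s < \<lceil>X\<rceil>}" by (auto simp: S_def)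
  have "open S" unfolding Seq by (intro open_Int open_halfspace_Re_gt open_halfspace_Re_lt)
  have convS: "convex S" unfolding Seq by (intro convex_Int convex_halfspace_Re_gt convex_halfspace_Re_lt)
  define pts :: "complex set" where "pts = of_int ` P"
  have ptsI: "s \<in> pts" if "s \<in> S" "s \<in> \<int>" for s
  proof -
    obtain k where k: "s = of_int k" using \<open>s \<in> \<int>\<close> by (auto elim: Ints_cases)
    then have "\<lfloor>c\<rfloor> < k" "k < \<lceil>X\<rceil>" using \<open>s \<in> S\<close> by (auto simp: S_def)
    then have "c < k" "k < X" by linarith+
    then show ?thesis using k by (auto simp: pts_def P_def)
  qed
  have holK: "K holomorphic_on S - pts"
    unfolding K_def using ptsI
    by (intro holomorphic_intros holomorphic_on_subset[OF f]) (auto simp: cexp1_eq_1_iff)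
  have contK: "continuous_on A K" if "\<And>s. s \<in> A \<Longrightarrow> Im s = 0 \<Longrightarrow> Re s \<notin> \<int>" for A
  proof -
    have "s \<notin> \<int>" if "s \<in> A" for s using \<open>\<And>s. s \<in> A \<Longrightarrow> Im s = 0 \<Longrightarrow> Re s \<notin> \<int>\<close>[OF that]
      by (auto elim!: Ints_cases)
    then show ?thesis unfolding K_def
      by (intro holomorphic_on_imp_continuous_on holomorphic_intros holomorphic_on_subset[OF f]) (auto simp: cexp1_eq_1_iff)
  qed
  have contU: "continuous_on A U" if "\<And>s. s \<in> A \<Longrightarrow> Im s = 0 \<Longrightarrow> Re s \<notin> \<int>" for A
  proof -
    have "s \<notin> \<int>" if "s \<in> A" for s using \<open>\<And>s. s \<in> A \<Longrightarrow> Im s = 0 \<Longrightarrow> Re s \<notin> \<int>\<close>[OF that]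
      by (auto elim!: Ints_cases)
    then have "1 - cexp1 s \<noteq> 0" if "s \<in> A" for s using that cexp1_eq_1_iff[of s] by auto
    then show ?thesis unfolding U_def
      by (intro holomorphic_on_imp_continuous_on holomorphic_intros holomorphic_on_subset[OF f]) auto
  qed
  define a1 a2 a3 a4 where "a1 = c - \<i> * Y" and "a2 = X - \<i> * Y" and "a3 = X + \<i> * Y" and "a4 = c + \<i> * Y"
  note adefs = a1_def a2_def a3_def a4_def
  have seg: "Re s = Re p" if m: "s \<in> closed_segment p q" and e: "Re p = Re q" for s p q :: complex
  proof -
    obtain u where "s = (1 - u) *\<^sub>R p + u *\<^sub>R q" using m by (auto simp: closed_segment_def)
    then have "Re s = (1 - u) * Re p + u * Re q" by simp
    also have "\<dots> = Re p" unfolding e by (simp add: left_diff_distrib)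
    finally show ?thesis .
  qed
  have segI: "Im s = Im p" if m: "s \<in> closed_segment p q" and e: "Im p = Im q" for s p q :: complex
  proof -
    obtain u where "s = (1 - u) *\<^sub>R p + u *\<^sub>R q" using m by (auto simp: closed_segment_def)
    then have "Im s = (1 - u) * Im p + u * Im q" by simp
    also have "\<dots> = Im p" unfolding e by (simp add: left_diff_distrib)
    finally show ?thesis .
  qed
  have rect: "rectpath a1 a3 = linepath a1 a2 +++ linepath a2 a3 +++ linepath a3 a4 +++ linepath a4 a1"
    by (simp add: rectpath_def adefs Let_def complex_eq_iff Complex_eq)
  have box: "Re a1 \<le> Re a3" "Im a1 \<le> Im a3" using cX Y by (auto simp: adefs)
  have img: "path_image (rectpath a1 a3) \<subseteq> S - pts"
  proof
    fix s assume s: "s \<in> path_image (rectpath a1 a3)"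
    then have s': "s \<in> cbox a1 a3" "s \<notin> box a1 a3"
      using path_image_rectpath_cbox_minus_box[OF box] by auto
    have "s \<in> S" using s'(1) fc cX' by (auto simp: S_def in_cbox_complex_iff adefs)
    moreover have "s \<notin> pts"
      using s'(2) Y by (auto simp: pts_def P_def in_box_complex_iff adefs)
    ultimately show "s \<in> S - pts" by simp
  qed
  have "contour_integral (rectpath a1 a3) K = 2 * pi * \<i> * (\<Sum>p\<in>pts. winding_number (rectpath a1 a3) p * residue K p)"
  proof (rule Residue_theorem[OF \<open>open S\<close> convex_connected[OF convS] _ holK])
    show "\<forall>z. z \<notin> S \<longrightarrow> winding_number (rectpath a1 a3) z = 0"
      using fc cX' cX Y by (auto intro!: winding_number_rectpath_outside box simp: S_def in_cbox_complex_iff adefs)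
  qed (use img finP in \<open>auto simp: pts_def\<close>)
  also have "(\<Sum>p\<in>pts. winding_number (rectpath a1 a3) p * residue K p) = (\<Sum>p\<in>pts. f p / (2 * of_real pi * \<i>))"
  proof (rule sum.cong[OF refl])
    fix p assume "p \<in> pts"
    then obtain k where k: "p = of_int k" "c < k" "k < X" by (auto simp: pts_def P_def)
    have "winding_number (rectpath a1 a3) p = 1"
      using k Y by (intro winding_number_rectpath) (auto simp: in_box_complex_iff adefs)
    then show "winding_number (rectpath a1 a3) p * residue K p = f p / (2 * of_real pi * \<i>)"
      using residue_cexp1[OF f, of k] k by (simp add: K_def)
  qed
  also have "2 * pi * \<i> * (\<Sum>p\<in>pts. f p / (2 * of_real pi * \<i>)) = (\<Sum>p\<in>pts. f p)"
    by (simp add: sum_distrib_left)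
  also have "\<dots> = (\<Sum>k\<in>P. f (of_int k))"
    unfolding pts_def by (subst sum.reindex) (auto simp: inj_on_def)
  finally have res: "contour_integral (rectpath a1 a3) K = (\<Sum>k\<in>P. f (of_int k))" .
  have cR: "continuous_on (closed_segment p q) K" "continuous_on (closed_segment p q) U"
    if "Re p = Re q" "Re q \<notin> \<int>" for p q
  proof -
    have "Re s \<notin> \<int>" if s: "s \<in> closed_segment p q" for s
      using seg[OF s \<open>Re p = Re q\<close>] \<open>Re p = Re q\<close> \<open>Re q \<notin> \<int>\<close> by simp
    then show "continuous_on (closed_segment p q) K" "continuous_on (closed_segment p q) U"
      by (intro contK contU; blast)+
  qed
  have cI: "continuous_on (closed_segment p q) K" "continuous_on (closed_segment p q) U"
    if "Im p = Im q" "Im q \<noteq> 0" for p q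
  proof -
    have "Im s \<noteq> 0" if s: "s \<in> closed_segment p q" for s
      using segI[OF s \<open>Im p = Im q\<close>] \<open>Im p = Im q\<close> \<open>Im q \<noteq> 0\<close> by simp
    then show "continuous_on (closed_segment p q) K" "continuous_on (closed_segment p q) U"
      by (intro contK contU; blast)+
  qed
  have ci1: "K contour_integrable_on linepath a1 a2" "K contour_integrable_on linepath a3 a4"
    by (rule contour_integrable_continuous_linepath, rule cI; use Y in \<open>simp add: adefs\<close>)+
  have ci2: "K contour_integrable_on linepath a2 a3" "K contour_integrable_on linepath a4 a1"
    by (rule contour_integrable_continuous_linepath, rule cR; use c X in \<open>simp add: adefs\<close>)+
  have "contour_integral (rectpath a1 a3) K = ?J a1 a2 K + ?J a2 a3 K + ?J a3 a4 K + ?J a4 a1 K"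
    unfolding rect using ci1 ci2 by (simp add: contour_integrable_joinI valid_path_join)
  also have "?J a2 a3 K = ?J a2 X K + ?J X a3 K"
  proof (rule contour_integral_split_linepath)
    show "continuous_on (closed_segment a2 a3) K" using X by (intro cR) (auto simp: adefs)
    show "complex_of_real X \<in> closed_segment a2 a3"
      by (auto simp: adefs closed_segment_def complex_eq_iff intro!: exI[of _ "1/2"])
  qed
  also have "?J a4 a1 K = ?J a4 c K + ?J c a1 K"
  proof (rule contour_integral_split_linepath)
    show "continuous_on (closed_segment a4 a1) K" using c by (intro cR) (auto simp: adefs)
    show "complex_of_real c \<in> closed_segment a4 a1"
      by (auto simp: adefs closed_segment_def complex_eq_iff intro!: exI[of _ "1/2"])
  qed
  finally have K: "(\<Sum>k\<in>P. f (of_int k)) = ?J a1 a2 K + (?J a2 X K + ?J X a3 K) + ?J a3 a4 K + (?J a4 c K + ?J c a1 K)"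
    using res by simp
  have KU: "?J p q K = - ?J p q f - ?J p q U"
    if pq: "(Re p = Re q \<and> Re q \<notin> \<int>) \<or> (Im p = Im q \<and> Im q \<noteq> 0)" for p q
  proof -
    have nz: "cexp1 s \<noteq> 1" if s: "s \<in> closed_segment p q" for s
    proof
      assume "cexp1 s = 1"
      then have "s \<in> \<int>" by (simp add: cexp1_eq_1_iff)
      then have "Im s = 0" "Re s \<in> \<int>" by (auto elim!: Ints_cases)
      then show False using pq seg[OF s] segI[OF s] by metis
    qed
    have "?J p q K = ?J p q (\<lambda>s. - f s - U s)"
    proof (rule contour_integral_cong[OF refl])
      fix s assume "s \<in> path_image (linepath p q)"
      then show "K s = - f s - U s" using nz[of s] by (simp add: K_def U_def field_simps)
    qed
    also have "\<dots> = ?J p q (\<lambda>s. - f s) - ?J p q U"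
    proof (intro contour_integral_diff contour_integrable_continuous_linepath)
      show "continuous_on (closed_segment p q) U" using pq cR(2) cI(2) by blast
      show "continuous_on (closed_segment p q) (\<lambda>s. - f s)"
        by (intro continuous_intros continuous_on_subset[OF holomorphic_on_imp_continuous_on[OF f]]) simp
    qed
    also have "?J p q (\<lambda>s. - f s) = - ?J p q f"
      by (rule contour_integral_neg)
    finally show ?thesis .
  qed
  have k1: "?J X a3 K = - ?J X a3 f - ?J X a3 U" "?J a3 a4 K = - ?J a3 a4 f - ?J a3 a4 U" "?J a4 c K = - ?J a4 c f - ?J a4 c U"
    using X c Y by (intro KU; simp add: adefs)+
  have k2: "?J a4 c U = - ?J c a4 U" "?J a3 a4 U = - ?J a4 a3 U" "?J a2 X K = - ?J X a2 K"
  proof -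
    show "?J a4 c U = - ?J c a4 U"
      by (rule contour_integral_reverse_linepath, rule cR; use c in \<open>simp add: adefs\<close>)
    show "?J a3 a4 U = - ?J a4 a3 U"
      by (rule contour_integral_reverse_linepath, rule cI; use Y in \<open>simp add: adefs\<close>)
    show "?J a2 X K = - ?J X a2 K"
      by (rule contour_integral_reverse_linepath, rule cR; use X in \<open>simp add: adefs\<close>)
  qed
  \<comment> \<open>The copies of f split off on the three upper sides add up to the integral along
    the real segment from X back to c, since f is entire.\<close>
  have k3: "?J X c f = ?J X a3 f + ?J a3 a4 f + ?J a4 c f"
    using contour_integral_entire_linepath_split[OF f, of X c a3] contour_integral_entire_linepath_split[OF f, of a3 c a4] by simp
  have "?J c X f = - ?J X c f"
    by (rule contour_integral_reverse_linepath) (rule continuous_on_subset[OF holomorphic_on_imp_continuous_on[OF f]], simp)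
  then show ?thesis
    unfolding P_def[symmetric] adefs[symmetric] K k1 k2 k3 by (simp add: algebra_simps)
qed

lemma contour_integral_segment_exp_bound:
  assumes cont: "continuous_on (closed_segment p (p + of_real Y * v)) h"
    and Y: "Y \<ge> 0" and v: "norm v = 1" and A: "A \<ge> 0" and d: "d > 0"
    and le: "\<And>u. 0 \<le> u \<Longrightarrow> u \<le> Y \<Longrightarrow> norm (h (p + of_real u * v)) \<le> A * exp (- (d * u))"
  shows "norm (contour_integral (linepath p (p + of_real Y * v)) h) \<le> A / d"
proof -
  have "norm (contour_integral (linepath p (p + of_real Y * v)) h)
      \<le> - (A / d) * exp (- (d * Y)) - (- (A / d) * exp (- (d * 0)))"
    by (rule contour_integral_segment_bound[OF cont Y v le, where G = "\<lambda>u. - (A / d) * exp (- (d * u))"])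
       (use d in \<open>auto intro!: derivative_eq_intros\<close>)
  also have "\<dots> \<le> A / d" using A d by simp
  finally show ?thesis .
qed

lemma contour_integral_segment_powr_bound:
  assumes cont: "continuous_on (closed_segment p (p + of_real Y * v)) h"
    and Y: "Y \<ge> 0" and v: "norm v = 1" and A: "A \<ge> 0" and mu: "\<mu> > 1"
    and le: "\<And>u. 0 \<le> u \<Longrightarrow> u \<le> Y \<Longrightarrow> norm (h (p + of_real u * v)) \<le> A * (1 + u) powr (- \<mu>)"
  shows "norm (contour_integral (linepath p (p + of_real Y * v)) h) \<le> A / (\<mu> - 1)"
proof -
  have "norm (contour_integral (linepath p (p + of_real Y * v)) h)
      \<le> - (A / (\<mu> - 1)) * (1 + Y) powr (1 - \<mu>) - (- (A / (\<mu> - 1)) * (1 + 0) powr (1 - \<mu>))"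
  proof (rule contour_integral_segment_bound[OF cont Y v le, where G = "\<lambda>u. - (A / (\<mu> - 1)) * (1 + u) powr (1 - \<mu>)"])
    fix u :: real assume "0 \<le> u"
    then have "((\<lambda>u. (1 + u) powr (1 - \<mu>)) has_real_derivative (1 - \<mu>) * (1 + u) powr (- \<mu>)) (at u)"
      by (auto intro!: derivative_eq_intros)
    from DERIV_cmult[OF this, of "- (A / (\<mu> - 1))"]
    show "((\<lambda>u. - (A / (\<mu> - 1)) * (1 + u) powr (1 - \<mu>)) has_real_derivative A * (1 + u) powr (- \<mu>)) (at u)"
    proof (rule DERIV_cong)
      have "- (A / (\<mu> - 1)) * (1 - \<mu>) = A" using mu by (simp add: field_simps)
      then show "- (A / (\<mu> - 1)) * ((1 - \<mu>) * (1 + u) powr (- \<mu>)) = A * (1 + u) powr (- \<mu>)"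
        by (simp only: mult.assoc[symmetric])
    qed
  qed auto
  also have "\<dots> \<le> A / (\<mu> - 1)" using A mu by simp
  finally show ?thesis .
qed

text \<open>|1 - w| <= |1 - q w| + (1 - q), and 1 - q is itself at most |1 - q w|. Along a vertical
  line this bounds the denominators of the kernel from below by half the value at the real
  point.\<close>

lemma norm_one_minus_scaled_ge:
  fixes w :: complex
  assumes "norm w = 1" "0 \<le> q" "q \<le> 1"
  shows "norm (1 - w) / 2 \<le> norm (1 - of_real q * w)"
proof -
  have "1 - w = (1 - of_real q * w) - of_real (1 - q) * w" by (simp add: algebra_simps)
  then have "norm (1 - w) \<le> norm (1 - of_real q * w) + norm (of_real (1 - q) * w)"
    by (metis norm_triangle_ineq4)
  also have "norm (of_real (1 - q) * w) = 1 - q"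
    unfolding norm_mult norm_of_real using assms by simp
  also have "1 - q \<le> norm (1 - of_real q * w)"
    using norm_triangle_ineq2[of 1 "of_real q * w"] assms by (simp add: norm_mult)
  finally show ?thesis by simp
qed

lemma cexp1_polar: "cexp1 s = of_real (exp (- 2 * pi * Im s)) * cexp1 (of_real (Re s))"
proof -
  have "2 * of_real pi * \<i> * s = of_real (- 2 * pi * Im s) + 2 * of_real pi * \<i> * of_real (Re s)"
    by (simp add: complex_eq_iff)
  then show ?thesis unfolding cexp1_def by (simp only: exp_add exp_of_real)
qed

lemma cexp1_minus: "cexp1 (- s) = inverse (cexp1 s)"
  by (simp add: cexp1_def exp_minus)

lemma norm_one_minus_cexp1_minus:
  "norm (1 - cexp1 (- of_real x)) = norm (1 - cexp1 (of_real x))"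
proof -
  have n: "norm (cexp1 (of_real x)) = 1" by (simp add: norm_cexp1)
  then have nz: "cexp1 (of_real x) \<noteq> 0" by auto
  have "norm (1 - cexp1 (- of_real x)) = norm ((cexp1 (of_real x) - 1) / cexp1 (of_real x))"
    unfolding cexp1_minus using nz by (simp add: field_simps)
  then show ?thesis using n by (simp add: norm_divide norm_minus_commute)
qed

lemma norm_abel_plana_kernel_upper:
  assumes "Im s \<ge> 0" "Re s \<notin> \<int>"
  shows "norm (cexp1 s / (1 - cexp1 s)) \<le> 2 / norm (1 - cexp1 (of_real (Re s))) * exp (- 2 * pi * Im s)"
proof -
  have "cexp1 (of_real (Re s)) \<noteq> 1" using assms by (auto simp: cexp1_eq_1_iff elim!: Ints_cases)
  then have p: "norm (1 - cexp1 (of_real (Re s))) > 0" by simp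
  have "norm (1 - cexp1 (of_real (Re s))) / 2 \<le> norm (1 - cexp1 s)"
    unfolding cexp1_polar[of s] using assms by (intro norm_one_minus_scaled_ge) (auto simp: norm_cexp1)
  then have "norm (cexp1 s) / norm (1 - cexp1 s) \<le> norm (cexp1 s) / (norm (1 - cexp1 (of_real (Re s))) / 2)"
    using p by (intro divide_left_mono mult_pos_pos) auto
  then show ?thesis by (simp add: norm_divide norm_cexp1 field_simps)
qed

text \<open>The reflection s to -s turns this kernel into the one for the upper half-plane.\<close>

lemma norm_abel_plana_kernel_lower:
  assumes "Im s \<le> 0" "Re s \<notin> \<int>"
  shows "norm (1 / (cexp1 s - 1)) \<le> 2 / norm (1 - cexp1 (of_real (Re s))) * exp (2 * pi * Im s)"
proof -
  have i: "- Re s \<notin> \<int>" using assms by (metis Ints_minus minus_minus)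
  have nz: "cexp1 s \<noteq> 0" by (simp add: cexp1_def)
  have "1 / (cexp1 s - 1) = cexp1 (- s) / (1 - cexp1 (- s))"
    unfolding cexp1_minus using nz by (simp add: field_simps)
  then show ?thesis using norm_abel_plana_kernel_upper[of "-s"] assms i
    by (simp add: norm_one_minus_cexp1_minus)
qed

text \<open>On verticals through half-integers the denominator of the kernel has modulus 2 at the
  real point, so the kernel bound there does not depend on the abscissa.\<close>

lemma cexp1_half_odd: "cexp1 (of_real (of_int n + 1/2)) = -1"
proof -
  have "2 * of_real pi * \<i> * complex_of_real (of_int n + 1/2) = of_real ((2 * of_int n + 1) * pi) * \<i>"
    by (simp add: algebra_simps)
  then show ?thesis unfolding cexp1_def using exp_integer_2pi_plus1[of "of_int n"] by (simp only:) simp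
qed

text \<open>The quantifier over $B$ expresses decay faster than any exponential as $\Re s \to \infty$.\<close>

definition strip_decay :: "(complex \<Rightarrow> complex) \<Rightarrow> real \<Rightarrow> real \<Rightarrow> real \<Rightarrow> bool" where
  "strip_decay h c \<mu> \<kappa> \<longleftrightarrow> (\<forall>B. \<exists>C\<ge>0. \<forall>s. c \<le> Re s \<longrightarrow>
      norm (h s) \<le> C * (1 + norm s) powr (- \<mu>) * exp (\<kappa> * \<bar>Im s\<bar> - B * Re s))"

lemma strip_decayD:
  assumes "strip_decay h c \<mu> \<kappa>"
  shows "\<exists>C\<ge>0. \<forall>s. c \<le> Re s \<longrightarrow>
      norm (h s) \<le> C * (1 + norm s) powr (- \<mu>) * exp (\<kappa> * \<bar>Im s\<bar> - B * Re s)"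
  using assms unfolding strip_decay_def by blast

text \<open>On a vertical line the growth pi + \<kappa> of the integrand meets the decay 2 pi of the
  kernel, and \<kappa> < pi leaves exponential decay. The left side of the rectangle yields the
  stated bound with a constant free of l; the other three sides vanish as X grows.\<close>

lemma abel_plana_bound:
  assumes h: "h holomorphic_on UNIV" and dec: "strip_decay h c 0 \<kappa>" and kap: "\<kappa> < pi" and c: "c \<notin> \<int>"
  obtains C where "C > 0"
    "\<And>l. \<bar>Im l\<bar> \<le> pi \<Longrightarrow> \<forall>\<^sub>F X in at_top.
       norm ((\<Sum>k\<in>{k::int. c < k \<and> k \<le> X}. exp (l * of_int k) * h (of_int k))
             - contour_integral (linepath (of_real c) (of_real X)) (\<lambda>s. exp (l * s) * h s)) \<le> C * exp (c * Re l)"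
proof -
  define d where "d = pi - \<kappa>"
  have d: "d > 0" using kap by (simp add: d_def)
  define M where "M = 2 / norm (1 - cexp1 (of_real c))"
  have "cexp1 (of_real c) \<noteq> 1" using c by (auto simp: cexp1_eq_1_iff elim!: Ints_cases)
  then have M: "M > 0" by (simp add: M_def)
  obtain C0 where C0: "C0 \<ge> 0"
    "\<And>s. c \<le> Re s \<Longrightarrow> norm (h s) \<le> C0 * (1 + norm s) powr (- 0) * exp (\<kappa> * \<bar>Im s\<bar> - 0 * Re s)"
    using strip_decayD[OF dec, of 0] by blast
  \<comment> \<open>Twice the left side, once upwards and once downwards; the 1 pays for everything
    that tends to 0 with X.\<close>
  define C where "C = 2 * (C0 * M / d) + 1"
  have "\<forall>\<^sub>F X in at_top.
       norm ((\<Sum>k\<in>{k::int. c < k \<and> k \<le> X}. exp (l * of_int k) * h (of_int k))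
             - contour_integral (linepath (of_real c) (of_real X)) (\<lambda>s. exp (l * s) * h s)) \<le> C * exp (c * Re l)"
    if l: "\<bar>Im l\<bar> \<le> pi" for l
  proof -
    \<comment> \<open>This constant depends on l. The rate Re l + 1 leaves a factor exp(-Re s) after
      multiplication by exp(l s); it is used only for the sides that disappear in the limit.\<close>
    obtain C1 where C1: "C1 \<ge> 0"
      "\<And>s. c \<le> Re s \<Longrightarrow> norm (h s) \<le> C1 * (1 + norm s) powr (- 0) * exp (\<kappa> * \<bar>Im s\<bar> - (Re l + 1) * Re s)"
      using strip_decayD[OF dec, of "Re l + 1"] by blast
    have pos: "1 + norm s \<noteq> 0" for s :: complex using norm_ge_zero[of s] by linarith
    define f where "f = (\<lambda>s. exp (l * s) * h s)"
    have f: "f holomorphic_on UNIV" unfolding f_def by (intro holomorphic_intros h)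
    have el: "norm (exp (l * s)) \<le> exp (Re l * Re s + pi * \<bar>Im s\<bar>)" for s
    proof -
      have "- (Im l * Im s) \<le> \<bar>Im l\<bar> * \<bar>Im s\<bar>" by (simp add: abs_mult[symmetric])
      also have "\<dots> \<le> pi * \<bar>Im s\<bar>" using l by (intro mult_right_mono) auto
      finally show ?thesis by simp
    qed
    have f0: "norm (f s) \<le> C0 * exp (Re l * Re s + (pi + \<kappa>) * \<bar>Im s\<bar>)" if "c \<le> Re s" for s
    proof -
      have "norm (f s) \<le> exp (Re l * Re s + pi * \<bar>Im s\<bar>) * (C0 * exp (\<kappa> * \<bar>Im s\<bar>))"
        unfolding f_def norm_mult using el[of s] C0(2)[OF that]
        by (intro mult_mono) (auto simp: pos)
      also have "\<dots> = C0 * exp ((Re l * Re s + pi * \<bar>Im s\<bar>) + \<kappa> * \<bar>Im s\<bar>)"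
        by (simp only: exp_add mult_ac)
      finally show ?thesis by (simp add: algebra_simps)
    qed
    have f1: "norm (f s) \<le> C1 * exp (- Re s + (pi + \<kappa>) * \<bar>Im s\<bar>)" if "c \<le> Re s" for s
    proof -
      have "norm (f s) \<le> exp (Re l * Re s + pi * \<bar>Im s\<bar>) * (C1 * exp (\<kappa> * \<bar>Im s\<bar> - (Re l + 1) * Re s))"
        unfolding f_def norm_mult using el[of s] C1(2)[OF that]
        by (intro mult_mono) (auto simp: pos)
      also have "\<dots> = C1 * exp ((Re l * Re s + pi * \<bar>Im s\<bar>) + (\<kappa> * \<bar>Im s\<bar> - (Re l + 1) * Re s))"
        by (simp only: exp_add mult_ac)
      finally show ?thesis by (simp add: algebra_simps)
    qed
    define K where "K = (\<lambda>s. f s / (cexp1 s - 1))"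
    define U where "U = (\<lambda>s. f s * cexp1 s / (1 - cexp1 s))"
    have fc: "continuous_on A f" for A
      by (rule continuous_on_subset[OF holomorphic_on_imp_continuous_on[OF f]]) simp
    have contK: "continuous_on A K" and contU: "continuous_on A U" if "\<And>s. s \<in> A \<Longrightarrow> cexp1 s \<noteq> 1" for A
    proof -
      have "1 - cexp1 s \<noteq> 0" if "s \<in> A" for s using \<open>\<And>s. s \<in> A \<Longrightarrow> cexp1 s \<noteq> 1\<close>[OF that] by auto
      then show "continuous_on A K" "continuous_on A U" unfolding K_def U_def using that
        by (auto intro!: continuous_intros fc holomorphic_on_imp_continuous_on[OF holomorphic_on_cexp1])
    qed
    have kerU: "norm (U s) \<le> norm (f s) * (2 / norm (1 - cexp1 (of_real (Re s))) * exp (- 2 * pi * \<bar>Im s\<bar>))"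
      if "Im s \<ge> 0" "Re s \<notin> \<int>" for s
      using mult_left_mono[OF norm_abel_plana_kernel_upper[OF that], of "norm (f s)"] that
      by (simp add: U_def norm_mult norm_divide)
    have kerK: "norm (K s) \<le> norm (f s) * (2 / norm (1 - cexp1 (of_real (Re s))) * exp (- 2 * pi * \<bar>Im s\<bar>))"
      if "Im s \<le> 0" "Re s \<notin> \<int>" for s
      using mult_left_mono[OF norm_abel_plana_kernel_lower[OF that], of "norm (f s)"] that
      by (simp add: K_def norm_divide)
    have vert: "norm (contour_integral (linepath (of_real x) (of_real x + \<i> * of_real Y)) U) \<le> A * (2 / norm (1 - cexp1 (of_real x))) / d"
      "norm (contour_integral (linepath (of_real x) (of_real x - \<i> * of_real Y)) K) \<le> A * (2 / norm (1 - cexp1 (of_real x))) / d"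
      if x: "x \<notin> \<int>" and Y: "Y \<ge> 0" and A: "A \<ge> 0" and fA: "\<And>y. norm (f (Complex x y)) \<le> A * exp ((pi + \<kappa>) * \<bar>y\<bar>)" for x Y A
    proof -
      have ex: "exp ((pi + \<kappa>) * \<bar>y\<bar>) * exp (- 2 * pi * \<bar>y\<bar>) = exp (- (d * \<bar>y\<bar>))" for y
        by (simp add: d_def algebra_simps flip: exp_add)
      have nz: "cexp1 s \<noteq> 1" if "s \<in> closed_segment (of_real x) (of_real x + of_real Y * v)" "v = \<i> \<or> v = - \<i>" for s v
      proof -
        have "Re s = x" using that by (auto simp: closed_segment_def algebra_simps)
        then show ?thesis using x by (auto simp: cexp1_eq_1_iff elim!: Ints_cases)
      qed
      define A' where "A' = A * (2 / norm (1 - cexp1 (of_real x)))"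
      have A': "A' \<ge> 0" using A by (simp add: A'_def)
      have "norm (contour_integral (linepath (of_real x) (of_real x + of_real Y * \<i>)) U) \<le> A' / d"
      proof (rule contour_integral_segment_exp_bound[OF contU Y _ A' d])
        fix u :: real assume u: "0 \<le> u"
        have "norm (U (Complex x u)) \<le> (A * exp ((pi + \<kappa>) * \<bar>u\<bar>)) * (2 / norm (1 - cexp1 (of_real x)) * exp (- 2 * pi * \<bar>u\<bar>))"
        proof (rule order_trans[OF kerU])
          show "norm (f (Complex x u)) * (2 / norm (1 - cexp1 (of_real (Re (Complex x u)))) * exp (- 2 * pi * \<bar>Im (Complex x u)\<bar>))
            \<le> (A * exp ((pi + \<kappa>) * \<bar>u\<bar>)) * (2 / norm (1 - cexp1 (of_real x)) * exp (- 2 * pi * \<bar>u\<bar>))"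
            unfolding complex.sel by (intro mult_right_mono fA) simp
        qed (use u x in auto)
        also have "\<dots> = A' * (exp ((pi + \<kappa>) * \<bar>u\<bar>) * exp (- 2 * pi * \<bar>u\<bar>))" by (simp add: A'_def)
        also have "\<dots> = A' * exp (- (d * u))" unfolding ex using u by simp
        finally show "norm (U (of_real x + of_real u * \<i>)) \<le> A' * exp (- (d * u))"
          by (simp add: Complex_eq mult.commute)
      qed (use nz[of _ "\<i>"] in auto)
      then show "norm (contour_integral (linepath (of_real x) (of_real x + \<i> * of_real Y)) U) \<le> A * (2 / norm (1 - cexp1 (of_real x))) / d"
        by (simp add: A'_def mult.commute)
      have "norm (contour_integral (linepath (of_real x) (of_real x + of_real Y * (- \<i>))) K) \<le> A' / d"
      proof (rule contour_integral_segment_exp_bound[OF contK Y _ A' d])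
        fix u :: real assume u: "0 \<le> u"
        have "norm (K (Complex x (- u))) \<le> (A * exp ((pi + \<kappa>) * \<bar>u\<bar>)) * (2 / norm (1 - cexp1 (of_real x)) * exp (- 2 * pi * \<bar>u\<bar>))"
        proof (rule order_trans[OF kerK])
          show "norm (f (Complex x (- u))) * (2 / norm (1 - cexp1 (of_real (Re (Complex x (- u))))) * exp (- 2 * pi * \<bar>Im (Complex x (- u))\<bar>))
            \<le> (A * exp ((pi + \<kappa>) * \<bar>u\<bar>)) * (2 / norm (1 - cexp1 (of_real x)) * exp (- 2 * pi * \<bar>u\<bar>))"
            unfolding complex.sel abs_minus by (intro mult_right_mono fA[of "- u", unfolded abs_minus]) simp
        qed (use u x in auto)
        also have "\<dots> = A' * (exp ((pi + \<kappa>) * \<bar>u\<bar>) * exp (- 2 * pi * \<bar>u\<bar>))" by (simp add: A'_def)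
        also have "\<dots> = A' * exp (- (d * u))" unfolding ex using u by simp
        finally show "norm (K (of_real x + of_real u * (- \<i>))) \<le> A' * exp (- (d * u))"
          by (simp add: Complex_eq mult.commute)
      qed (use nz[of _ "- \<i>"] in auto)
      then show "norm (contour_integral (linepath (of_real x) (of_real x - \<i> * of_real Y)) K) \<le> A * (2 / norm (1 - cexp1 (of_real x))) / d"
        by (simp add: A'_def mult.commute)
    qed
    have horiz: "norm (contour_integral (linepath (of_real c + \<i> * of_real Y) (of_real X + \<i> * of_real Y)) U)
          \<le> 2 * C1 * exp (- c) * exp (- (d * Y)) * (X - c)"
      "norm (contour_integral (linepath (of_real c - \<i> * of_real Y) (of_real X - \<i> * of_real Y)) K)
          \<le> 2 * C1 * exp (- c) * exp (- (d * Y)) * (X - c)"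
      if Y: "Y \<ge> 1" and X: "X \<ge> c" for X Y :: real
    proof -
      have Y2: "exp (2 * pi * Y) \<ge> 2"
      proof -
        have "1 * 1 \<le> (2 * pi) * Y" using Y pi_gt3 by (intro mult_mono) auto
        then show ?thesis using exp_ge_add_one_self[of "2 * pi * Y"] by linarith
      qed
      then have Y3: "exp (- (2 * pi * Y)) \<le> 1/2" by (simp add: exp_minus field_simps)
      have ex: "exp (- c + (pi + \<kappa>) * Y) * exp (- (2 * pi * Y)) = exp (- c) * exp (- (d * Y))"
        by (simp add: d_def algebra_simps flip: exp_add)
      have fb: "norm (f s) \<le> C1 * exp (- c + (pi + \<kappa>) * Y)" if "Re s \<ge> c" "\<bar>Im s\<bar> = Y" for s
      proof -
        have "C1 * exp (- Re s + (pi + \<kappa>) * \<bar>Im s\<bar>) \<le> C1 * exp (- c + (pi + \<kappa>) * Y)"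
          using that C1(1) by (intro mult_left_mono) auto
        then show ?thesis using f1[OF that(1)] by linarith
      qed
      have seg: "Re s \<ge> c" "Im s = v" if sv: "s \<in> closed_segment (Complex c v) (Complex X v)" for s v
      proof -
        obtain t where t: "0 \<le> t" "t \<le> 1" "s = (1 - t) *\<^sub>R Complex c v + t *\<^sub>R Complex X v"
          using sv by (auto simp: closed_segment_def)
        have "Re s = c + t * (X - c)" by (simp add: t(3) algebra_simps)
        then show "Re s \<ge> c" using t(1) X by simp
        show "Im s = v" by (simp add: t(3) algebra_simps)
      qed
      have e1: "of_real c + \<i> * of_real Y = Complex c Y" "of_real X + \<i> * of_real Y = Complex X Y"
        "of_real c - \<i> * of_real Y = Complex c (- Y)" "of_real X - \<i> * of_real Y = Complex X (- Y)"
        by (auto simp: complex_eq_iff)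
      have len: "norm (Complex X v - Complex c v) = X - c" for v
        using X by (simp add: cmod_def)
      have "norm (contour_integral (linepath (Complex c Y) (Complex X Y)) U)
          \<le> 2 * C1 * exp (- c) * exp (- (d * Y)) * norm (Complex X Y - Complex c Y)"
      proof (rule contour_integral_bound_linepath[OF contour_integrable_continuous_linepath[OF contU]])
        fix s assume s: "s \<in> closed_segment (Complex c Y) (Complex X Y)"
        have n: "norm (cexp1 s) = exp (- (2 * pi * Y))" using seg(2)[OF s] by (simp add: norm_cexp1)
        have "norm (1 - cexp1 s) \<ge> 1 - norm (cexp1 s)" by (metis norm_triangle_ineq2 norm_one)
        then have n2: "norm (1 - cexp1 s) \<ge> 1/2" using n Y3 by linarith
        have "norm (U s) = norm (f s) * norm (cexp1 s) / norm (1 - cexp1 s)" by (simp add: U_def norm_mult norm_divide)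
        also have "\<dots> \<le> norm (f s) * norm (cexp1 s) / (1/2)" using n2 by (intro divide_left_mono) auto
        also have "\<dots> \<le> (C1 * exp (- c + (pi + \<kappa>) * Y)) * exp (- (2 * pi * Y)) / (1/2)"
          unfolding n using fb[of s] seg[OF s] Y by (intro divide_right_mono mult_right_mono) auto
        also have "\<dots> = 2 * C1 * (exp (- c + (pi + \<kappa>) * Y) * exp (- (2 * pi * Y)))" by (simp only: mult_ac divide_inverse inverse_divide) simp
        also have "\<dots> = 2 * C1 * exp (- c) * exp (- (d * Y))" unfolding ex by (simp only: mult_ac)
        finally show "norm (U s) \<le> 2 * C1 * exp (- c) * exp (- (d * Y))" .
      next
        fix s assume s: "s \<in> closed_segment (Complex c Y) (Complex X Y)"
        then show "cexp1 s \<noteq> 1" using seg[OF s] Y by (auto simp: cexp1_eq_1_iff elim!: Ints_cases)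
      qed (use C1 in auto)
      then show "norm (contour_integral (linepath (of_real c + \<i> * of_real Y) (of_real X + \<i> * of_real Y)) U)
          \<le> 2 * C1 * exp (- c) * exp (- (d * Y)) * (X - c)" unfolding e1 len .
      have "norm (contour_integral (linepath (Complex c (- Y)) (Complex X (- Y))) K)
          \<le> 2 * C1 * exp (- c) * exp (- (d * Y)) * norm (Complex X (- Y) - Complex c (- Y))"
      proof (rule contour_integral_bound_linepath[OF contour_integrable_continuous_linepath[OF contK]])
        fix s assume s: "s \<in> closed_segment (Complex c (- Y)) (Complex X (- Y))"
        have n: "norm (cexp1 s) = exp (2 * pi * Y)" using seg(2)[OF s] by (simp add: norm_cexp1)
        have "norm (cexp1 s - 1) \<ge> norm (cexp1 s) - 1" by (metis norm_triangle_ineq2 norm_one)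
        then have n2: "norm (cexp1 s - 1) \<ge> exp (2 * pi * Y) / 2" using n Y2 by linarith
        have "norm (K s) = norm (f s) / norm (cexp1 s - 1)" by (simp add: K_def norm_divide)
        also have "\<dots> \<le> norm (f s) / (exp (2 * pi * Y) / 2)"
          using n2 by (intro divide_left_mono mult_pos_pos) (auto intro: less_le_trans[OF _ n2])
        also have "\<dots> = norm (f s) * exp (- (2 * pi * Y)) / (1/2)" by (simp add: exp_minus field_simps)
        also have "\<dots> \<le> (C1 * exp (- c + (pi + \<kappa>) * Y)) * exp (- (2 * pi * Y)) / (1/2)"
          using fb[of s] seg[OF s] Y by (intro divide_right_mono mult_right_mono) auto
        also have "\<dots> = 2 * C1 * (exp (- c + (pi + \<kappa>) * Y) * exp (- (2 * pi * Y)))" by (simp only: mult_ac divide_inverse inverse_divide) simp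
        also have "\<dots> = 2 * C1 * exp (- c) * exp (- (d * Y))" unfolding ex by (simp only: mult_ac)
        finally show "norm (K s) \<le> 2 * C1 * exp (- c) * exp (- (d * Y))" .
      next
        fix s assume s: "s \<in> closed_segment (Complex c (- Y)) (Complex X (- Y))"
        then show "cexp1 s \<noteq> 1" using seg[OF s] Y by (auto simp: cexp1_eq_1_iff elim!: Ints_cases)
      qed (use C1 in auto)
      then show "norm (contour_integral (linepath (of_real c - \<i> * of_real Y) (of_real X - \<i> * of_real Y)) K)
          \<le> 2 * C1 * exp (- c) * exp (- (d * Y)) * (X - c)" unfolding e1 len .
    qed
    \<comment> \<open>Collects the right side, the horizontal sides and the short piece between the
      right side and X; it contains all occurrences of \<open>C1\<close>.\<close>
    define err where "err = (\<lambda>X. 2 * (C1 / d) * exp (1 - X) + 4 * C1 * exp (- c) * exp (d / 2 - d * X) * (X + 1 - c) + C1 * exp (1 - X))"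
    have "((\<lambda>X::real. exp (1 - X)) \<longlongrightarrow> 0) at_top" by real_asymp
    moreover have "((\<lambda>X::real. exp (d / 2 - d * X) * (X + 1 - c)) \<longlongrightarrow> 0) at_top" using d by real_asymp
    ultimately have "(err \<longlongrightarrow> 2 * (C1 / d) * 0 + 4 * C1 * exp (- c) * 0 + C1 * 0) at_top"
      unfolding err_def mult.assoc by (intro tendsto_add tendsto_mult_left)
    then have "(err \<longlongrightarrow> 0) at_top" by simp
    then have "\<forall>\<^sub>F X in at_top. err X < exp (c * Re l)" by (rule order_tendstoD) simp
    moreover have "\<forall>\<^sub>F X in at_top. X \<ge> max 2 (c + 2)" by (rule eventually_ge_at_top)
    ultimately show ?thesis
    proof eventually_elim
      case (elim X)
      \<comment> \<open>The right side is put at the half-integer next to X: no pole lies on it, the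
        integers k <= X are exactly those below it, and the kernel is uniformly bounded there. The
        same number serves as the height of the rectangle.\<close>
      define X' where "X' = of_int \<lfloor>X\<rfloor> + (1/2::real)"
      have X'b: "X - 1/2 \<le> X'" "X' \<le> X + 1/2" unfolding X'_def by linarith+
      have dX: "\<bar>X - X'\<bar> \<le> 1/2" using X'b by linarith
      have cX': "c < X'" "X' \<ge> 1" using X'b elim by auto
      have X'Z: "X' \<notin> \<int>"
      proof
        assume "X' \<in> \<int>"
        then obtain n where "X' = of_int n" by (auto elim: Ints_cases)
        then have "2 * \<lfloor>X\<rfloor> + 1 = 2 * n" unfolding X'_def by linarith
        then show False by presburger
      qed
      have set: "{k::int. c < k \<and> k \<le> X} = {k. c < k \<and> k < X'}"
      proof -
        have "real_of_int k \<le> X \<longleftrightarrow> real_of_int k < X'" for k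
          unfolding X'_def le_floor_iff[symmetric] by linarith
        then show ?thesis by auto
      qed
      have two: "norm (1 - cexp1 (of_real X')) = 2" unfolding X'_def cexp1_half_odd by simp
      have fX': "norm (f (Complex X' y)) \<le> (C1 * exp (- X')) * exp ((pi + \<kappa>) * \<bar>y\<bar>)" for y
        using f1[of "Complex X' y"] cX' unfolding exp_add by (simp add: mult.assoc)
      have fcy: "norm (f (Complex c y)) \<le> (C0 * exp (c * Re l)) * exp ((pi + \<kappa>) * \<bar>y\<bar>)" for y
        using f0[of "Complex c y"] unfolding exp_add by (simp add: mult_ac)
      let ?J = "\<lambda>a b. contour_integral (linepath a b)"
      have c1: "norm (?J (of_real c) (of_real c - \<i> * of_real X') K) \<le> C0 * exp (c * Re l) * M / d"
        "norm (?J (of_real c) (of_real c + \<i> * of_real X') U) \<le> C0 * exp (c * Re l) * M / d"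
        unfolding M_def using cX' C0(1) by (intro vert c fcy; simp)+
      have "C1 * exp (- X') * (2 / norm (1 - cexp1 (of_real X'))) / d \<le> (C1 / d) * exp (1 - X)"
        unfolding two using X'b C1(1) d by (simp add: divide_right_mono mult_left_mono)
      then have c2: "norm (?J (of_real X') (of_real X' - \<i> * of_real X') K) \<le> (C1 / d) * exp (1 - X)"
        "norm (?J (of_real X') (of_real X' + \<i> * of_real X') U) \<le> (C1 / d) * exp (1 - X)"
        using cX' C1(1) by - (rule order_trans[OF vert(2)[OF X'Z _ _ fX']], simp_all, rule order_trans[OF vert(1)[OF X'Z _ _ fX']], simp_all)
      have hb: "2 * C1 * exp (- c) * exp (- (d * X')) * (X' - c) \<le> 2 * C1 * exp (- c) * exp (d / 2 - d * X) * (X + 1 - c)"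
      proof -
        have "d * (X - 1/2) \<le> d * X'" using X'b d by (intro mult_left_mono) auto
        then have "exp (- (d * X')) \<le> exp (d / 2 - d * X)" by (simp add: algebra_simps)
        then show ?thesis using X'b cX' C1(1) by (intro mult_mono mult_left_mono) auto
      qed
      have c3: "norm (?J (of_real c - \<i> * of_real X') (of_real X' - \<i> * of_real X') K) \<le> 2 * C1 * exp (- c) * exp (d / 2 - d * X) * (X + 1 - c)"
        "norm (?J (of_real c + \<i> * of_real X') (of_real X' + \<i> * of_real X') U) \<le> 2 * C1 * exp (- c) * exp (d / 2 - d * X) * (X + 1 - c)"
        using horiz[of X' X'] cX' hb by linarith+
      have c4: "norm (?J (of_real X') (of_real X) f) \<le> C1 * exp (1 - X) * norm (of_real X - complex_of_real X')"
      proof (rule contour_integral_bound_linepath[OF contour_integrable_continuous_linepath[OF fc]])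
        fix s assume "s \<in> closed_segment (of_real X') (complex_of_real X)"
        then obtain t where t: "0 \<le> t" "t \<le> 1" "s = (1 - t) *\<^sub>R of_real X' + t *\<^sub>R of_real X"
          by (auto simp: closed_segment_def)
        have re: "Re s = X' + t * (X - X')" "Im s = 0" by (auto simp: t(3) algebra_simps)
        have "\<bar>t * (X - X')\<bar> \<le> 1 * (1/2)" unfolding abs_mult using t dX by (intro mult_mono) auto
        then have re2: "Re s \<ge> X - 1" using re X'b by linarith
        then have "norm (f s) \<le> C1 * exp (- Re s + (pi + \<kappa>) * \<bar>Im s\<bar>)" using elim by (intro f1) auto
        also have "\<dots> \<le> C1 * exp (1 - X)" using re re2 C1(1) by (intro mult_left_mono) auto
        finally show "norm (f s) \<le> C1 * exp (1 - X)" .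
      qed (use C1 in auto)
      have "norm (of_real X - complex_of_real X') \<le> 1"
        using dX unfolding of_real_diff[symmetric] norm_of_real by linarith
      then have c5: "norm (?J (of_real X') (of_real X) f) \<le> C1 * exp (1 - X)"
        using c4 C1(1) by (elim order_trans) (simp add: mult_left_le)
      have id: "(\<Sum>k\<in>{k::int. c < k \<and> k \<le> X}. f (of_int k)) - ?J (of_real c) (of_real X) f
          = ?J (of_real c) (of_real c - \<i> * of_real X') K + ?J (of_real c - \<i> * of_real X') (of_real X' - \<i> * of_real X') K
          - ?J (of_real X') (of_real X' - \<i> * of_real X') K
          + (?J (of_real c) (of_real c + \<i> * of_real X') U + ?J (of_real c + \<i> * of_real X') (of_real X' + \<i> * of_real X') U
          - ?J (of_real X') (of_real X' + \<i> * of_real X') U) - ?J (of_real X') (of_real X) f"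
        using abel_plana_rectangle[OF f c X'Z cX'(1), of X'] cX'
          contour_integral_entire_linepath_split[OF f, of "of_real c" "of_real X" "of_real X'"]
        unfolding set K_def U_def by (simp add: algebra_simps)
      have tri: "norm (a1 + a2 - a3 + (a4 + a5 - a6) - a7) \<le> norm a1 + norm a2 + norm a3 + (norm a4 + norm a5 + norm a6) + norm a7"
        for a1 a2 a3 a4 a5 a6 a7 :: complex
        by (smt (verit) norm_triangle_ineq norm_triangle_ineq4)
      have err: "err X = 2 * ((C1 / d) * exp (1 - X)) + 2 * (2 * C1 * exp (- c) * exp (d / 2 - d * X) * (X + 1 - c)) + C1 * exp (1 - X)"
        by (simp add: err_def)
      have "norm ((\<Sum>k\<in>{k::int. c < k \<and> k \<le> X}. f (of_int k)) - ?J (of_real c) (of_real X) f)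
         \<le> 2 * (C0 * exp (c * Re l) * M / d) + err X"
      proof -
        have gen: "a1 + a2 + a3 + (a4 + a5 + a6) + a7 \<le> 2 * p + (2 * r + 2 * q + w)"
          if "a1 \<le> p" "a2 \<le> q" "a3 \<le> r" "a4 \<le> p" "a5 \<le> q" "a6 \<le> r" "a7 \<le> w" for a1 a2 a3 a4 a5 a6 a7 p q r w :: real
          using that by linarith
        show ?thesis unfolding id err
          by (rule order_trans[OF tri gen[OF c1(1) c3(1) c2(1) c1(2) c3(2) c2(2) c5]])
      qed
      also have "\<dots> \<le> C * exp (c * Re l)" using elim by (simp add: C_def algebra_simps)
      finally show ?case by (simp add: f_def)
    qed
  qed
  moreover have "C > 0" using C0(1) M d by (simp add: C_def add_nonneg_pos)
  ultimately show ?thesis using that by blast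
qed

section \<open>Rotating the contour\<close>

lemma powr_exp_bounded:
  fixes p d :: real
  assumes "d > 0"
  obtains D where "D > 0" "\<And>r. r \<ge> 0 \<Longrightarrow> (1 + r) powr p \<le> D * exp (d * r)"
proof (cases "p > 0")
  case True
  \<comment> \<open>The constant is the exact maximum of (1 + r)^p exp(-d r), attained formally at 1
    + r = p/d; \<open>ln_le_minus_one\<close> at (1 + r) d / p is the tangent inequality
    there.\<close>
  have "(1 + r) powr p \<le> exp (d - p + p * ln (p / d)) * exp (d * r)" if r: "r \<ge> 0" for r
  proof -
    have "ln ((1 + r) * (d / p)) \<le> (1 + r) * (d / p) - 1"
      using assms True r by (intro ln_le_minus_one) auto
    moreover have "ln ((1 + r) * (d / p)) = ln (1 + r) - ln (p / d)"
      using assms True r by (subst ln_mult) (auto simp: ln_div)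
    ultimately have "p * ln (1 + r) \<le> p * ((1 + r) * (d / p) - 1 + ln (p / d))"
      using True by (intro mult_left_mono) auto
    also have "\<dots> = d - p + p * ln (p / d) + d * r" using True by (simp add: field_simps)
    finally show ?thesis using r by (simp add: powr_def flip: exp_add)
  qed
  then show ?thesis by (rule that[rotated]) simp_all
next
  case False
  have "(1 + r) powr p \<le> 1 * exp (d * r)" if r: "r \<ge> 0" for r
  proof -
    have "(1 + r) powr p \<le> (1 + r) powr 0" using r False by (intro powr_mono) auto
    also have "\<dots> \<le> exp (d * r)" using r assms by simp
    finally show ?thesis by simp
  qed
  then show ?thesis by (rule that[rotated]) simp_all
qed

text \<open>A power of 1 + |s| costs exp(d |s|) with d the gain in \<kappa>, and |s| <= Re s + 2 |c|
  + |Im s|. The part in Im s is paid by the larger \<kappa>', the part in Re s by asking for the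
  rate B + d.\<close>

lemma strip_decay_weaken:
  assumes dec: "strip_decay h c \<mu> \<kappa>" and k: "\<kappa> < \<kappa>'"
  shows "strip_decay h c \<mu>' \<kappa>'"
  unfolding strip_decay_def
proof
  fix B
  define d where "d = \<kappa>' - \<kappa>"
  have d: "d > 0" using k by (simp add: d_def)
  obtain D where D: "D > 0" "\<And>r. r \<ge> 0 \<Longrightarrow> (1 + r) powr (\<mu>' - \<mu>) \<le> D * exp (d * r)"
    using powr_exp_bounded[OF d] by blast
  obtain C where C: "C \<ge> 0" "\<And>s. c \<le> Re s \<Longrightarrow>
      norm (h s) \<le> C * (1 + norm s) powr (- \<mu>) * exp (\<kappa> * \<bar>Im s\<bar> - (B + d) * Re s)"
    using strip_decayD[OF dec, of "B + d"] by blast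
  show "\<exists>C\<ge>0. \<forall>s. c \<le> Re s \<longrightarrow>
      norm (h s) \<le> C * (1 + norm s) powr (- \<mu>') * exp (\<kappa>' * \<bar>Im s\<bar> - B * Re s)"
  proof (intro exI[of _ "C * (D * exp (2 * d * \<bar>c\<bar>))"] conjI allI impI)
    fix s assume s: "c \<le> Re s"
    have "norm s \<le> \<bar>Re s\<bar> + \<bar>Im s\<bar>" by (rule cmod_le)
    also have "\<bar>Re s\<bar> \<le> Re s + 2 * \<bar>c\<bar>" using s by linarith
    finally have ns: "norm s \<le> Re s + 2 * \<bar>c\<bar> + \<bar>Im s\<bar>" by simp
    have "(1 + norm s) powr (- \<mu>) = (1 + norm s) powr (- \<mu>') * (1 + norm s) powr (\<mu>' - \<mu>)"
      by (simp flip: powr_add)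
    also have "\<dots> \<le> (1 + norm s) powr (- \<mu>') * (D * exp (d * norm s))"
      by (intro mult_left_mono D) auto
    also have "\<dots> \<le> (1 + norm s) powr (- \<mu>') * (D * exp (d * (Re s + 2 * \<bar>c\<bar> + \<bar>Im s\<bar>)))"
      using D(1) d ns by (intro mult_left_mono) auto
    finally have 1: "(1 + norm s) powr (- \<mu>) \<le> (1 + norm s) powr (- \<mu>') * (D * exp (d * (Re s + 2 * \<bar>c\<bar> + \<bar>Im s\<bar>)))" .
    have "norm (h s) \<le> C * (1 + norm s) powr (- \<mu>) * exp (\<kappa> * \<bar>Im s\<bar> - (B + d) * Re s)" by (rule C(2)[OF s])
    also have "\<dots> \<le> C * ((1 + norm s) powr (- \<mu>') * (D * exp (d * (Re s + 2 * \<bar>c\<bar> + \<bar>Im s\<bar>)))) * exp (\<kappa> * \<bar>Im s\<bar> - (B + d) * Re s)"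
      using C(1) 1 by (intro mult_right_mono mult_left_mono) auto
    also have "\<dots> = C * (1 + norm s) powr (- \<mu>') * D * exp (d * (Re s + 2 * \<bar>c\<bar> + \<bar>Im s\<bar>) + (\<kappa> * \<bar>Im s\<bar> - (B + d) * Re s))"
      unfolding exp_add by (simp only: mult_ac)
    also have "d * (Re s + 2 * \<bar>c\<bar> + \<bar>Im s\<bar>) + (\<kappa> * \<bar>Im s\<bar> - (B + d) * Re s) = 2 * d * \<bar>c\<bar> + (\<kappa>' * \<bar>Im s\<bar> - B * Re s)"
      by (simp add: d_def algebra_simps)
    also have "C * (1 + norm s) powr (- \<mu>') * D * exp \<dots>
      = C * (D * exp (2 * d * \<bar>c\<bar>)) * (1 + norm s) powr (- \<mu>') * exp (\<kappa>' * \<bar>Im s\<bar> - B * Re s)"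
      unfolding exp_add by (simp only: mult_ac)
    finally show "norm (h s) \<le> \<dots>" .
  qed (use C D in auto)
qed

lemma rotate_to_vertical:
  assumes h: "h holomorphic_on UNIV" and dec: "strip_decay h c \<mu> \<kappa>" and mu: "\<mu> > 1"
  obtains C where "C > 0"
    "\<And>l. \<kappa> \<le> Im l \<Longrightarrow> \<forall>\<^sub>F X in at_top.
       norm (contour_integral (linepath (of_real c) (of_real X)) (\<lambda>s. exp (l * s) * h s)) \<le> C * exp (c * Re l)"
proof -
  obtain C0 where C0: "C0 \<ge> 0"
    "\<And>s. c \<le> Re s \<Longrightarrow> norm (h s) \<le> C0 * (1 + norm s) powr (- \<mu>) * exp (\<kappa> * \<bar>Im s\<bar> - 0 * Re s)"
    using strip_decayD[OF dec, of 0] by blast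
  define C where "C = C0 / (\<mu> - 1) + 1"
  have "\<forall>\<^sub>F X in at_top.
       norm (contour_integral (linepath (of_real c) (of_real X)) (\<lambda>s. exp (l * s) * h s)) \<le> C * exp (c * Re l)"
    if l: "\<kappa> \<le> Im l" for l
  proof -
    obtain C1 where C1: "C1 \<ge> 0"
      "\<And>s. c \<le> Re s \<Longrightarrow> norm (h s) \<le> C1 * (1 + norm s) powr (- \<mu>) * exp (\<kappa> * \<bar>Im s\<bar> - (Re l + 1) * Re s)"
      using strip_decayD[OF dec, of "Re l + 1"] by blast
    define f where "f = (\<lambda>s. exp (l * s) * h s)"
    have f: "f holomorphic_on UNIV" unfolding f_def by (intro holomorphic_intros h)
    have fc: "continuous_on A f" for A
      by (rule continuous_on_subset[OF holomorphic_on_imp_continuous_on[OF f]]) simp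
    have fb: "norm (f s) \<le> A * (1 + norm s) powr (- \<mu>) * exp ((Re l - B) * Re s)"
      if s: "c \<le> Re s" "Im s \<ge> 0" and A: "A \<ge> 0" and
        hs: "norm (h s) \<le> A * (1 + norm s) powr (- \<mu>) * exp (\<kappa> * \<bar>Im s\<bar> - B * Re s)" for A B s
    proof -
      have "norm (f s) \<le> exp (Re l * Re s - Im l * Im s) * (A * (1 + norm s) powr (- \<mu>) * exp (\<kappa> * \<bar>Im s\<bar> - B * Re s))"
        unfolding f_def norm_mult using hs by (intro mult_mono) auto
      also have "\<dots> = A * (1 + norm s) powr (- \<mu>) * exp ((Re l * Re s - Im l * Im s) + (\<kappa> * \<bar>Im s\<bar> - B * Re s))"
        unfolding exp_add by (simp only: mult_ac)
      also have "\<dots> \<le> A * (1 + norm s) powr (- \<mu>) * exp ((Re l - B) * Re s)"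
      proof -
        have "\<kappa> * Im s \<le> Im l * Im s" using l s by (intro mult_right_mono) auto
        then show ?thesis using A s by (intro mult_left_mono) (auto simp: algebra_simps)
      qed
      finally show ?thesis .
    qed
    define err where "err = (\<lambda>X. C1 * exp (- c) * ((1 + X) powr (- \<mu>) * (X - c)) + C1 * (exp (- X) * X))"
    have "((\<lambda>X::real. (1 + X) powr (- \<mu>) * (X - c)) \<longlongrightarrow> 0) at_top" using mu by real_asymp
    moreover have "((\<lambda>X::real. exp (- X) * X) \<longlongrightarrow> 0) at_top" by real_asymp
    ultimately have "(err \<longlongrightarrow> C1 * exp (- c) * 0 + C1 * 0) at_top"
      unfolding err_def by (intro tendsto_add tendsto_mult_left)
    then have "(err \<longlongrightarrow> 0) at_top" by simp
    then have "\<forall>\<^sub>F X in at_top. err X < exp (c * Re l)" by (rule order_tendstoD) simp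
    moreover have "\<forall>\<^sub>F X in at_top. X \<ge> max 1 (c + 1)" by (rule eventually_ge_at_top)
    ultimately show ?thesis
    proof eventually_elim
      case (elim X)
      then have X: "X \<ge> 1" "X \<ge> c + 1" by auto
      let ?J = "\<lambda>a b. contour_integral (linepath a b)"
      \<comment> \<open>The path goes up to height X, across, and down to X. Only the first side
        survives; the horizontal one is of order X^(1 - \<mu>) and the right one decays like X
        exp(-X).\<close>
      let ?p = "of_real c + of_real X * \<i>" and ?q = "of_real X + of_real X * \<i>"
      have pw1: "(1 + norm s) powr (- \<mu>) \<le> (1 + y) powr (- \<mu>)" if "0 \<le> y" "y \<le> norm s" for y s
        using that mu by (intro powr_mono2') auto
      have v1: "norm (?J (of_real c) ?p f) \<le> C0 * exp (c * Re l) / (\<mu> - 1)"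
      proof (rule contour_integral_segment_powr_bound[OF fc _ _ _ mu])
        fix u :: real assume u: "0 \<le> u"
        have "norm (f (Complex c u)) \<le> C0 * (1 + norm (Complex c u)) powr (- \<mu>) * exp ((Re l - 0) * Re (Complex c u))"
          using u by (intro fb C0) auto
        also have "\<dots> \<le> C0 * (1 + u) powr (- \<mu>) * exp ((Re l - 0) * Re (Complex c u))"
          using u C0(1) abs_Im_le_cmod[of "Complex c u"] by (intro mult_right_mono mult_left_mono pw1) auto
        finally show "norm (f (of_real c + of_real u * \<i>)) \<le> C0 * exp (c * Re l) * (1 + u) powr (- \<mu>)"
          by (simp add: Complex_eq mult_ac)
      qed (use X C0(1) in auto)
      have v2: "norm (?J ?p ?q f) \<le> C1 * exp (- c) * (1 + X) powr (- \<mu>) * norm (?q - ?p)"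
      proof (rule contour_integral_bound_linepath[OF contour_integrable_continuous_linepath[OF fc]])
        fix s assume "s \<in> closed_segment ?p ?q"
        then obtain t where t: "0 \<le> t" "t \<le> 1" "s = (1 - t) *\<^sub>R ?p + t *\<^sub>R ?q"
          unfolding closed_segment_def by blast
        have im: "Im s = X" by (simp add: t(3) algebra_simps)
        have re: "Re s = c + t * (X - c)" by (simp add: t(3) algebra_simps)
        have re2: "Re s \<ge> c" unfolding re using t X by simp
        have "norm (f s) \<le> C1 * (1 + norm s) powr (- \<mu>) * exp ((Re l - (Re l + 1)) * Re s)"
          using re2 im X by (intro fb C1) auto
        also have "\<dots> \<le> C1 * (1 + X) powr (- \<mu>) * exp (- c)"
          using re2 im X C1(1) abs_Im_le_cmod[of s] by (intro mult_mono mult_left_mono pw1) auto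
        finally show "norm (f s) \<le> C1 * exp (- c) * (1 + X) powr (- \<mu>)" by (simp add: mult_ac)
      qed (use C1(1) in auto)
      have v3: "norm (?J ?q (of_real X) f) \<le> C1 * exp (- X) * norm (of_real X - ?q)"
      proof (rule contour_integral_bound_linepath[OF contour_integrable_continuous_linepath[OF fc]])
        fix s assume "s \<in> closed_segment ?q (of_real X)"
        then obtain t where t: "0 \<le> t" "t \<le> 1" "s = (1 - t) *\<^sub>R ?q + t *\<^sub>R of_real X"
          unfolding closed_segment_def by blast
        have im: "Im s = (1 - t) * X" by (simp add: t(3) algebra_simps)
        have re: "Re s = X" by (simp add: t(3) algebra_simps)
        have "norm (f s) \<le> C1 * (1 + norm s) powr (- \<mu>) * exp ((Re l - (Re l + 1)) * Re s)"
          using re im X t by (intro fb C1) auto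
        also have "\<dots> \<le> C1 * (1 + 0) powr (- \<mu>) * exp (- X)"
          using re X C1(1) by (intro mult_mono mult_left_mono pw1) auto
        finally show "norm (f s) \<le> C1 * exp (- X)" by simp
      qed (use C1(1) in auto)
      have n1: "norm (?q - ?p) = X - c"
      proof -
        have "?q - ?p = of_real (X - c)" by simp
        then show ?thesis using X by (simp only: norm_of_real)
      qed
      have n2: "norm (of_real X - ?q) = X" using X by (simp add: norm_mult)
      have "?J (of_real c) (of_real X) f = ?J (of_real c) ?p f + ?J ?p ?q f + ?J ?q (of_real X) f"
        using contour_integral_entire_linepath_split[OF f, of "of_real c" "of_real X" ?p]
          contour_integral_entire_linepath_split[OF f, of ?p "of_real X" ?q] by simp
      then have "norm (?J (of_real c) (of_real X) f) \<le> norm (?J (of_real c) ?p f) + norm (?J ?p ?q f) + norm (?J ?q (of_real X) f)"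
        by (simp only: order_trans[OF norm_triangle_ineq add_right_mono[OF norm_triangle_ineq]])
      also have "\<dots> \<le> C0 * exp (c * Re l) / (\<mu> - 1) + C1 * exp (- c) * (1 + X) powr (- \<mu>) * (X - c) + C1 * exp (- X) * X"
        using v1 v2 v3 unfolding n1 n2 by (intro add_mono)
      also have "\<dots> = C0 * exp (c * Re l) / (\<mu> - 1) + err X" by (simp add: err_def)
      also have "\<dots> \<le> C * exp (c * Re l)" using elim by (simp add: C_def algebra_simps)
      finally show ?case by (simp add: f_def)
    qed
  qed
  moreover have "C > 0" using C0(1) mu by (simp add: C_def add_nonneg_pos)
  ultimately show ?thesis using that by blast
qed

lemma eventually_powr_le_exp:
  fixes p d :: real
  assumes "d > 0"
  shows "\<forall>\<^sub>F x in at_top. x powr p \<le> exp (d * x)"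
  using assms by real_asymp

text \<open>The saddle point of $e^{ls} h(s)$ on the ray is at distance $\Lambda = e^{\Re l/a + d}$ from the origin.\<close>

lemma rotate_to_ray:
  assumes h: "h holomorphic_on UNIV" and dec: "strip_decay h 0 0 \<kappa>"
    and a: "a > 0" and psi: "0 < \<psi>" "\<psi> < pi / 2"
    and ray: "\<And>u. u \<ge> 1 \<Longrightarrow> norm (h (of_real u * cis \<psi>))
        \<le> D * u powr (- \<nu>) * exp (a * u * (cos \<psi> * (1 + d - ln u) + \<psi> * sin \<psi>))"
  obtains C L0 where "C > 0"
    "\<And>l. L0 \<le> Re l \<Longrightarrow> a * \<psi> \<le> Im l \<Longrightarrow> \<forall>\<^sub>F X in at_top.
       norm (contour_integral (linepath 0 (of_real X)) (\<lambda>s. exp (l * s) * h s))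
         \<le> C * (exp (Re l / a + d) powr (1 - \<nu>) * exp (a * cos \<psi> * exp (Re l / a + d)))"
proof -
  define v where "v = cis \<psi>"
  define t where "t = a * cos \<psi>"
  have cpos: "cos \<psi> > 0" using psi by (intro cos_gt_zero) auto
  have spos: "sin \<psi> > 0" using psi by (intro sin_gt_zero) auto
  have t: "t > 0" using a cpos by (simp add: t_def)
  have v: "norm v = 1" by (simp add: v_def)
  have D: "D \<ge> 0"
  proof -
    have "0 \<le> norm (h (of_real 1 * cis \<psi>))" by simp
    also have "\<dots> \<le> D * 1 powr (- \<nu>) * exp (a * 1 * (cos \<psi> * (1 + d - ln 1) + \<psi> * sin \<psi>))" by (rule ray) simp
    finally show ?thesis by (simp add: zero_le_mult_iff)
  qed
  \<comment> \<open>Cut-off for the tail: for u >= M x one has 1 + ln (x/u) <= -1, so the majorant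
    on the ray decays exponentially from there on.\<close>
  define M where "M = exp (2::real)"
  have M: "M \<ge> 3" using exp_ge_add_one_self[of 2] by (simp add: M_def)
  obtain H where H: "\<And>s. s \<in> cball 0 1 \<Longrightarrow> norm (h s) \<le> H"
  proof -
    have "compact (h ` cball 0 1)"
      by (intro compact_continuous_image continuous_on_subset[OF holomorphic_on_imp_continuous_on[OF h]]) auto
    then have "bounded (h ` cball 0 1)" by (rule compact_imp_bounded)
    then show ?thesis using that unfolding bounded_iff by (metis imageI)
  qed
  have H0: "H \<ge> 0" using H[of 0] norm_ge_zero[of "h 0"] by (simp del: norm_ge_zero)
  obtain D' where D': "D' > 0" "\<And>r. r \<ge> 0 \<Longrightarrow> (1 + r) powr \<bar>\<nu>\<bar> \<le> D' * exp ((t / 2) * r)"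
    using powr_exp_bounded[of "t / 2"] t by (metis half_gt_zero)
  \<comment> \<open>The length x of the relevant part of the ray times the value of the majorant at
    the saddle point u = x.\<close>
  define T where "T = (\<lambda>x. x powr (1 - \<nu>) * exp (t * x))"
  define C where "C = H * (exp (- a * d) + 1) + D + D * M powr \<bar>\<nu>\<bar> * M + 2 * D * D' / t + 1"
  \<comment> \<open>The comparisons that make the other pieces negligible: the first, with 1 <= T,
    handles the segment up to 1, where exp(Re l) is a multiple of x^a; the second handles the
    stretch from 1 to x/2; and 1 <= T handles the tail and the closing segment.\<close>
  have "\<forall>\<^sub>F x in at_top. x \<ge> (4::real) \<and> x powr a \<le> T x \<and> x powr (1 + \<bar>\<nu>\<bar>) * exp (t * ((1 + ln 2) / 2) * x) \<le> T x \<and> 1 \<le> T x"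
  proof -
    have l2: "ln 2 < (1::real)" by (rule ln_2_less_1)
    have e1: "\<forall>\<^sub>F x in at_top. x powr (a - (1 - \<nu>)) \<le> exp (t * x)" by (rule eventually_powr_le_exp[OF t])
    have e2: "\<forall>\<^sub>F x in at_top. x powr (1 + \<bar>\<nu>\<bar> - (1 - \<nu>)) \<le> exp (t * ((1 - ln 2) / 2) * x)"
      by (rule eventually_powr_le_exp) (use t l2 in auto)
    have e3: "\<forall>\<^sub>F x in at_top. x powr (0 - (1 - \<nu>)) \<le> exp (t * x)" by (rule eventually_powr_le_exp[OF t])
    have key: "x powr p \<le> x powr (1 - \<nu>) * E" if "x powr (p - (1 - \<nu>)) \<le> E" "x > 0" for x p E :: real
    proof -
      have "x powr p = x powr (1 - \<nu>) * x powr (p - (1 - \<nu>))" by (simp flip: powr_add)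
      also have "\<dots> \<le> x powr (1 - \<nu>) * E" using that by (intro mult_left_mono) auto
      finally show ?thesis .
    qed
    show ?thesis using e1 e2 e3 eventually_ge_at_top[of 4]
    proof eventually_elim
      case (elim x)
      have x: "x > 0" using elim by simp
      have "x powr (1 + \<bar>\<nu>\<bar>) * exp (t * ((1 + ln 2) / 2) * x)
          \<le> (x powr (1 - \<nu>) * exp (t * ((1 - ln 2) / 2) * x)) * exp (t * ((1 + ln 2) / 2) * x)"
        using key[OF elim(2) x] by (intro mult_right_mono) auto
      also have "\<dots> = x powr (1 - \<nu>) * exp (t * ((1 - ln 2) / 2) * x + t * ((1 + ln 2) / 2) * x)"
        by (simp only: exp_add mult.assoc)
      also have "t * ((1 - ln 2) / 2) * x + t * ((1 + ln 2) / 2) * x = t * x" by (simp add: field_simps)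
      finally show ?case using elim key[OF elim(1) x] key[OF elim(3) x] x by (simp add: T_def)
    qed
  qed
  then obtain N where N: "\<And>x. x \<ge> N \<Longrightarrow> x \<ge> (4::real) \<and> x powr a \<le> T x \<and> x powr (1 + \<bar>\<nu>\<bar>) * exp (t * ((1 + ln 2) / 2) * x) \<le> T x \<and> 1 \<le> T x"
    by (auto simp: eventually_at_top_linorder)
  define N' where "N' = max N 1"
  have "\<forall>\<^sub>F X in at_top. norm (contour_integral (linepath 0 (of_real X)) (\<lambda>s. exp (l * s) * h s)) \<le> C * T (exp (Re l / a + d))"
    if l0: "a * (ln N' - d) \<le> Re l" and l1: "a * \<psi> \<le> Im l" for l
  proof -
    define x where "x = exp (Re l / a + d)"
    have "ln N' \<le> Re l / a + d" using l0 a by (simp add: field_simps)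
    then have "N' \<le> x" unfolding x_def by (metis N'_def exp_le_cancel_iff exp_ln max.strict_coboundedI2 zero_less_one)
    then have "N \<le> x" by (simp add: N'_def)
    from N[OF this] have x: "x \<ge> 4" "x powr a \<le> T x" "x powr (1 + \<bar>\<nu>\<bar>) * exp (t * ((1 + ln 2) / 2) * x) \<le> T x" "1 \<le> T x" by auto
    have x0: "x > 0" using x by simp
    have lx: "ln x = Re l / a + d" by (simp add: x_def)
    have il: "Im l \<ge> 0" using l1 a psi by (meson less_imp_le mult_nonneg_nonneg order_trans)
    define f where "f = (\<lambda>s. exp (l * s) * h s)"
    have f: "f holomorphic_on UNIV" unfolding f_def by (intro holomorphic_intros h)
    have fc: "continuous_on A f" for A
      by (rule continuous_on_subset[OF holomorphic_on_imp_continuous_on[OF f]]) simp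
    have re_uv: "Re (l * (of_real u * v)) = u * (cos \<psi> * Re l - sin \<psi> * Im l)" for u
      by (simp add: v_def algebra_simps)
    \<comment> \<open>Here a \<psi> <= Im l enters: the terms with sin \<psi> add up to something
      nonpositive. The remaining exponent t u (1 + ln (x/u)) has its maximum t x at u = x.\<close>
    have fray: "norm (f (of_real u * v)) \<le> D * (u powr (- \<nu>) * exp (t * (u * (1 + ln (x / u)))))" if u: "u \<ge> 1" for u
    proof -
      have "norm (f (of_real u * v)) \<le> exp (u * (cos \<psi> * Re l - sin \<psi> * Im l)) *
           (D * u powr (- \<nu>) * exp (a * u * (cos \<psi> * (1 + d - ln u) + \<psi> * sin \<psi>)))"
        unfolding f_def norm_mult using ray[OF u] re_uv[of u] by (intro mult_mono) (auto simp: v_def)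
      also have "\<dots> = D * (u powr (- \<nu>) * exp (u * (cos \<psi> * Re l - sin \<psi> * Im l) + a * u * (cos \<psi> * (1 + d - ln u) + \<psi> * sin \<psi>)))"
        unfolding exp_add by (simp only: mult_ac)
      also have "\<dots> \<le> D * (u powr (- \<nu>) * exp (t * (u * (1 + ln (x / u)))))"
      proof -
        have h1: "u * sin \<psi> * (a * \<psi>) \<le> u * sin \<psi> * Im l" using l1 u spos by (intro mult_left_mono) auto
        have h2: "ln (x / u) = Re l / a + d - ln u" using x0 u lx by (simp add: ln_div)
        have h3: "t * (u * (1 + (Re l / a + d - ln u))) = u * cos \<psi> * Re l + a * u * cos \<psi> * (1 + d - ln u)"
          using a by (simp add: t_def field_simps)
        have h4: "u * (cos \<psi> * Re l - sin \<psi> * Im l) + a * u * (cos \<psi> * (1 + d - ln u) + \<psi> * sin \<psi>)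
            = (u * cos \<psi> * Re l + a * u * cos \<psi> * (1 + d - ln u)) + (u * sin \<psi> * (a * \<psi>) - u * sin \<psi> * Im l)"
          by (simp add: algebra_simps)
        have "u * (cos \<psi> * Re l - sin \<psi> * Im l) + a * u * (cos \<psi> * (1 + d - ln u) + \<psi> * sin \<psi>) \<le> t * (u * (1 + ln (x / u)))"
          unfolding h2 h3 h4 using h1 by linarith
        then show ?thesis using D by (intro mult_left_mono) auto
      qed
      finally show ?thesis .
    qed
    let ?J = "\<lambda>a b. contour_integral (linepath a b)"
    have on_seg: "\<exists>u. s = of_real u * v \<and> p \<le> u \<and> u \<le> q" if s: "s \<in> closed_segment (of_real p * v) (of_real q * v)" and pq: "p \<le> q" for s p q
    proof -
      obtain r where r: "0 \<le> r" "r \<le> 1" "s = (1 - r) *\<^sub>R (of_real p * v) + r *\<^sub>R (of_real q * v)"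
        using s unfolding closed_segment_def by blast
      have "s = of_real (p + r * (q - p)) * v" by (simp add: r(3) scaleR_conv_of_real algebra_simps)
      moreover have "r * (q - p) \<le> 1 * (q - p)" "0 \<le> r * (q - p)" using r pq by (intro mult_right_mono mult_nonneg_nonneg; simp)+
      ultimately show ?thesis by (intro exI[of _ "p + r * (q - p)"]) auto
    qed
    have bound: "norm (?J (of_real p * v) (of_real q * v) f) \<le> B * (q - p)"
      if pq: "p \<le> q" and B: "B \<ge> 0" "\<And>u. p \<le> u \<Longrightarrow> u \<le> q \<Longrightarrow> norm (f (of_real u * v)) \<le> B" for p q B
    proof -
      have "norm (of_real q * v - of_real p * v) = q - p"
        using v pq by (simp add: norm_mult flip: left_diff_distrib of_real_diff)
      then show ?thesis
        using contour_integral_bound_linepath[OF contour_integrable_continuous_linepath[OF fc] B(1), of "of_real p * v" "of_real q * v"]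
          on_seg[of _ p q] pq B(2) by metis
    qed
    have s1: "norm (?J (of_real 0 * v) (of_real 1 * v) f) \<le> H * (exp (- a * d) + 1) * T x"
    proof -
      have "norm (?J (of_real 0 * v) (of_real 1 * v) f) \<le> (exp (max 0 (Re l)) * H) * (1 - 0)"
      proof (rule bound)
        fix u :: real assume u: "0 \<le> u" "u \<le> 1"
        have "u * (cos \<psi> * Re l - sin \<psi> * Im l) \<le> u * (cos \<psi> * Re l)"
          using u spos il by (intro mult_left_mono) auto
        also have "\<dots> \<le> u * (cos \<psi> * max 0 (Re l))" using u cpos by (intro mult_left_mono) auto
        also have "\<dots> \<le> 1 * (1 * max 0 (Re l))" using u cpos by (intro mult_mono) auto
        finally have "exp (u * (cos \<psi> * Re l - sin \<psi> * Im l)) \<le> exp (max 0 (Re l))" by simp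
        moreover have "norm (h (of_real u * v)) \<le> H" using u v by (intro H) (simp add: norm_mult)
        ultimately show "norm (f (of_real u * v)) \<le> exp (max 0 (Re l)) * H"
          unfolding f_def norm_mult norm_exp_eq_Re re_uv by (intro mult_mono) auto
      qed (use H0 in auto)
      also have "\<dots> \<le> ((exp (- a * d) + 1) * T x) * H * 1"
      proof -
        have "Re l = a * ln x + - a * d" using a by (simp add: lx field_simps)
        then have "exp (Re l) = exp (- a * d) * x powr a" using x0 by (simp only: exp_add powr_def) simp
        also have "\<dots> \<le> exp (- a * d) * T x" using x by (intro mult_left_mono) auto
        finally have "exp (max 0 (Re l)) \<le> exp (- a * d) * T x + 1 * T x"
          using x(4) by (auto simp: max_def intro: add_increasing add_increasing2)
        from mult_right_mono[OF this H0] show ?thesis by (simp add: distrib_right)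
      qed
      also have "\<dots> = H * (exp (- a * d) + 1) * T x" by (simp only: mult_ac mult_1_right)
      finally show ?thesis .
    qed
    have s2: "norm (?J (of_real 1 * v) (of_real (x / 2) * v) f) \<le> D * T x"
    proof -
      have "norm (?J (of_real 1 * v) (of_real (x / 2) * v) f) \<le> (D * (x powr \<bar>\<nu>\<bar> * exp (t * ((1 + ln 2) / 2) * x))) * (x / 2 - 1)"
      proof (rule bound)
        fix u assume u: "1 \<le> u" "u \<le> x / 2"
        have "u powr (- \<nu>) \<le> u powr \<bar>\<nu>\<bar>" using u by (intro powr_mono) auto
        also have "\<dots> \<le> x powr \<bar>\<nu>\<bar>" using u by (intro powr_mono2) auto
        finally have p1: "u powr (- \<nu>) \<le> x powr \<bar>\<nu>\<bar>" .
        \<comment> \<open>Applying ln y <= y - 1 at y = x/(2u), not at x/u, yields the rate (1 + ln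
          2)/2 < 1 for u <= x/2. This strict gain absorbs the powers of x.\<close>
        have "ln (x / u / 2) \<le> x / u / 2 - 1" using u x0 by (intro ln_le_minus_one) auto
        moreover have "ln (x / u / 2) = ln (x / u) - ln 2" using u x0 by (subst ln_div) auto
        ultimately have "u * (1 + ln (x / u)) \<le> u * (x / u / 2 + ln 2)" using u by (intro mult_left_mono) auto
        also have "\<dots> = x / 2 + u * ln 2" using u by (simp add: field_simps)
        also have "\<dots> \<le> x / 2 + (x / 2) * ln 2" using u by (intro add_left_mono mult_right_mono) auto
        finally have "t * (u * (1 + ln (x / u))) \<le> t * (x / 2 + (x / 2) * ln 2)" using t by (intro mult_left_mono) auto
        then have "exp (t * (u * (1 + ln (x / u)))) \<le> exp (t * ((1 + ln 2) / 2) * x)" by (simp add: algebra_simps)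
        then have "D * (u powr (- \<nu>) * exp (t * (u * (1 + ln (x / u))))) \<le> D * (x powr \<bar>\<nu>\<bar> * exp (t * ((1 + ln 2) / 2) * x))"
          using D p1 by (intro mult_left_mono mult_mono) auto
        with fray[OF u(1)] show "norm (f (of_real u * v)) \<le> D * (x powr \<bar>\<nu>\<bar> * exp (t * ((1 + ln 2) / 2) * x))" by linarith
      qed (use x D in auto)
      also have "\<dots> \<le> (D * (x powr \<bar>\<nu>\<bar> * exp (t * ((1 + ln 2) / 2) * x))) * x"
        using x D by (intro mult_left_mono) auto
      also have "\<dots> = D * (x powr (1 + \<bar>\<nu>\<bar>) * exp (t * ((1 + ln 2) / 2) * x))"
        using x0 by (simp add: powr_add)
      also have "\<dots> \<le> D * T x" using x D by (intro mult_left_mono) auto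
      finally show ?thesis .
    qed
    have s3: "norm (?J (of_real (x / 2) * v) (of_real (M * x) * v) f) \<le> D * M powr \<bar>\<nu>\<bar> * M * T x"
    proof -
      have "norm (?J (of_real (x / 2) * v) (of_real (M * x) * v) f) \<le> (D * (M powr \<bar>\<nu>\<bar> * x powr (- \<nu>) * exp (t * x))) * (M * x - x / 2)"
      proof (rule bound)
        fix u assume u: "x / 2 \<le> u" "u \<le> M * x"
        have u1: "u \<ge> 1" using u x by simp
        have q: "u / x \<le> M" "1 / M \<le> u / x" using u x0 M by (auto simp: field_simps intro: order_trans mult_mono)
        have "(u / x) powr (- \<nu>) \<le> M powr \<bar>\<nu>\<bar>"
        proof (cases "\<nu> \<ge> 0")
          case True
          have "(u / x) powr (- \<nu>) \<le> (1 / M) powr (- \<nu>)" using q True M by (intro powr_mono2') auto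
          also have "\<dots> = M powr \<nu>" using M by (simp add: powr_divide powr_minus field_simps)
          finally show ?thesis using True by simp
        next
          case False
          then show ?thesis using q u1 x0 powr_mono2[of "- \<nu>" "u / x" M] by simp
        qed
        then have "(u / x) powr (- \<nu>) * x powr (- \<nu>) \<le> M powr \<bar>\<nu>\<bar> * x powr (- \<nu>)" by (intro mult_right_mono) auto
        then have p1: "u powr (- \<nu>) \<le> M powr \<bar>\<nu>\<bar> * x powr (- \<nu>)" using x0 u1 by (simp add: powr_divide)
        have "ln (x / u) \<le> x / u - 1" using u1 x0 by (intro ln_le_minus_one) auto
        then have "u * (1 + ln (x / u)) \<le> u * (x / u)" using u1 by (intro mult_left_mono) auto
        then have "t * (u * (1 + ln (x / u))) \<le> t * x" using t u1 by (intro mult_left_mono) auto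
        then have "D * (u powr (- \<nu>) * exp (t * (u * (1 + ln (x / u))))) \<le> D * (M powr \<bar>\<nu>\<bar> * x powr (- \<nu>) * exp (t * x))"
          using D p1 by (intro mult_left_mono mult_mono) auto
        with fray[OF u1] show "norm (f (of_real u * v)) \<le> D * (M powr \<bar>\<nu>\<bar> * x powr (- \<nu>) * exp (t * x))" by linarith
      next
        have "(1/2) * x \<le> M * x" using M x0 by (intro mult_right_mono) auto
        then show "x / 2 \<le> M * x" by simp
      qed (use x D in auto)
      also have "\<dots> \<le> (D * (M powr \<bar>\<nu>\<bar> * x powr (- \<nu>) * exp (t * x))) * (M * x)"
        using x D by (intro mult_left_mono) auto
      also have "\<dots> = D * M powr \<bar>\<nu>\<bar> * M * T x"
        using x0 by (simp add: powr_diff powr_minus T_def field_simps)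
      finally show ?thesis .
    qed
    have s4: "norm (?J (of_real (M * x) * v) (of_real X * v) f) \<le> 2 * D * D' / t" if X: "X \<ge> M * x" for X
    proof -
      have "norm (?J (of_real (M * x) * v) (of_real (M * x) * v + of_real (X - M * x) * v) f) \<le> (D * D') / (t / 2)"
      proof (rule contour_integral_segment_exp_bound[OF fc _ v])
        fix r :: real assume r: "0 \<le> r"
        define u where "u = M * x + r"
        have "1 * 1 \<le> M * x" using M x by (intro mult_mono) auto
        then have u: "u \<ge> 1" "u \<ge> M * x" "u \<ge> r" using r by (auto simp: u_def)
        have "u powr (- \<nu>) \<le> u powr \<bar>\<nu>\<bar>" using u by (intro powr_mono) auto
        also have "\<dots> \<le> (1 + u) powr \<bar>\<nu>\<bar>" using u by (intro powr_mono2) auto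
        also have "\<dots> \<le> D' * exp ((t / 2) * u)" using u by (intro D') auto
        finally have p1: "u powr (- \<nu>) \<le> D' * exp ((t / 2) * u)" .
        have "x / u \<le> inverse M" using u x0 M by (simp add: field_simps)
        then have "ln (x / u) \<le> ln (inverse M)" using u x0 M by (subst ln_le_cancel_iff) auto
        also have "ln (inverse M) = -2" by (simp add: M_def ln_inverse)
        finally have "u * (1 + ln (x / u)) \<le> u * (-1)" using u by (intro mult_left_mono) auto
        then have "t * (u * (1 + ln (x / u))) \<le> t * (u * (-1))" by (rule mult_left_mono) (use t in simp)
        then have "D * (u powr (- \<nu>) * exp (t * (u * (1 + ln (x / u))))) \<le> D * ((D' * exp ((t / 2) * u)) * exp (t * (u * (-1))))"
          using D p1 D'(1) by (intro mult_left_mono mult_mono) auto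
        also have "\<dots> = (D * D') * exp ((t / 2) * u + t * (u * (-1)))" unfolding exp_add by (simp only: mult_ac)
        also have "\<dots> \<le> (D * D') * exp (- ((t / 2) * r))"
          using u(3) t D D'(1) by (intro mult_left_mono) (auto simp: field_simps)
        finally have "norm (f (of_real u * v)) \<le> (D * D') * exp (- ((t / 2) * r))" using fray[OF u(1)] by linarith
        then show "norm (f (of_real (M * x) * v + of_real r * v)) \<le> (D * D') * exp (- ((t / 2) * r))"
          by (simp add: u_def algebra_simps)
      qed (use X t D D' in auto)
      then show ?thesis by (simp add: algebra_simps)
    qed
    \<comment> \<open>Chosen for the closing segment from X v to X: there Re s >= X cos \<psi> and
      |Im s| <= X, so the rate b outweighs the vertical growth and leaves exp(-X).\<close>
    define b where "b = (\<bar>\<kappa>\<bar> + 1) / cos \<psi>"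
    obtain C1 where C1: "C1 \<ge> 0"
      "\<And>s. 0 \<le> Re s \<Longrightarrow> norm (h s) \<le> C1 * (1 + norm s) powr (- 0) * exp (\<kappa> * \<bar>Im s\<bar> - (Re l + b) * Re s)"
      using strip_decayD[OF dec, of "Re l + b"] by blast
    have s5: "norm (?J (of_real X * v) (of_real X) f) \<le> C1 * exp (- X) * (2 * X)" if X: "X > 0" for X
    proof -
      have "norm (?J (of_real X * v) (of_real X) f) \<le> C1 * exp (- X) * norm (of_real X - of_real X * v)"
      proof (rule contour_integral_bound_linepath[OF contour_integrable_continuous_linepath[OF fc]])
        fix s assume "s \<in> closed_segment (of_real X * v) (of_real X)"
        then obtain r where r: "0 \<le> r" "r \<le> 1" "s = (1 - r) *\<^sub>R (of_real X * v) + r *\<^sub>R (of_real X)"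
          unfolding closed_segment_def by blast
        have re: "Re s = X * (cos \<psi> + r * (1 - cos \<psi>))" by (simp add: r(3) v_def algebra_simps)
        have im: "Im s = X * ((1 - r) * sin \<psi>)" by (simp add: r(3) v_def algebra_simps)
        have re2: "Re s \<ge> X * cos \<psi>" unfolding re using r X by (intro mult_left_mono) auto
        have "(1 - r) * sin \<psi> \<le> 1 * 1" using r spos by (intro mult_mono) auto
        then have im2: "0 \<le> Im s" "Im s \<le> X" unfolding im using r X spos by (auto intro: mult_left_le)
        have re0: "Re s \<ge> 0" using re2 X cpos by (meson less_imp_le mult_pos_pos order_trans)
        have "norm (f s) \<le> exp (Re l * Re s - Im l * Im s) * (C1 * (1 + norm s) powr (- 0) * exp (\<kappa> * \<bar>Im s\<bar> - (Re l + b) * Re s))"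
          unfolding f_def norm_mult using C1(2)[OF re0] by (intro mult_mono) auto
        also have "\<dots> \<le> exp (Re l * Re s - Im l * Im s) * (C1 * 1 * exp (\<kappa> * \<bar>Im s\<bar> - (Re l + b) * Re s))"
          using C1(1) by (intro mult_left_mono mult_right_mono) auto
        also have "\<dots> = C1 * exp ((Re l * Re s - Im l * Im s) + (\<kappa> * \<bar>Im s\<bar> - (Re l + b) * Re s))"
          unfolding exp_add by (simp only: mult_ac mult_1)
        also have "\<dots> \<le> C1 * exp (- X)"
        proof -
          have "0 \<le> Im l * Im s" using il im2 by simp
          moreover have "\<kappa> * \<bar>Im s\<bar> \<le> \<bar>\<kappa>\<bar> * X" using im2 by (intro mult_mono) auto
          moreover have "b * (X * cos \<psi>) \<le> b * Re s" using re2 cpos by (intro mult_left_mono) (auto simp: b_def)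
          moreover have "b * (X * cos \<psi>) = (\<bar>\<kappa>\<bar> + 1) * X" using cpos by (simp add: b_def)
          ultimately have "(Re l * Re s - Im l * Im s) + (\<kappa> * \<bar>Im s\<bar> - (Re l + b) * Re s) \<le> - X"
            by (simp add: algebra_simps)
          then show ?thesis using C1(1) by (intro mult_left_mono) auto
        qed
        finally show "norm (f s) \<le> C1 * exp (- X)" .
      qed (use C1(1) in auto)
      also have "\<dots> \<le> C1 * exp (- X) * (2 * X)"
      proof (intro mult_left_mono)
        show "norm (of_real X - of_real X * v) \<le> 2 * X"
          using X v by (intro order_trans[OF norm_triangle_ineq4]) (simp add: norm_mult)
      qed (use C1(1) in auto)
      finally show ?thesis .
    qed
    have "((\<lambda>X::real. exp (- X) * (2 * X)) \<longlongrightarrow> 0) at_top" by real_asymp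
    then have "((\<lambda>X::real. C1 * (exp (- X) * (2 * X))) \<longlongrightarrow> C1 * 0) at_top" by (rule tendsto_mult_left)
    then have "\<forall>\<^sub>F X in at_top. C1 * (exp (- X) * (2 * X)) < 1" by (rule order_tendstoD) simp
    then show ?thesis using eventually_ge_at_top[of "M * x"]
    proof eventually_elim
      case (elim X)
      have "M * x > 0" using M x0 by simp
      then have X: "X > 0" "X \<ge> M * x" using elim by linarith+
      have split: "?J 0 (of_real X) f = ?J (of_real 0 * v) (of_real 1 * v) f + ?J (of_real 1 * v) (of_real (x/2) * v) f
        + ?J (of_real (x/2) * v) (of_real (M * x) * v) f + ?J (of_real (M * x) * v) (of_real X * v) f + ?J (of_real X * v) (of_real X) f"
        using contour_integral_entire_linepath_split[OF f, of 0 "of_real X" "of_real X * v"]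
          contour_integral_entire_linepath_split[OF f, of 0 "of_real X * v" "of_real (M * x) * v"]
          contour_integral_entire_linepath_split[OF f, of 0 "of_real (M * x) * v" "of_real (x/2) * v"]
          contour_integral_entire_linepath_split[OF f, of 0 "of_real (x/2) * v" "of_real 1 * v"]
        by (simp add: algebra_simps)
      have tri: "norm (a1 + a2 + a3 + a4 + a5) \<le> b1 + b2 + b3 + b4 + b5"
        if "norm a1 \<le> b1" "norm a2 \<le> b2" "norm a3 \<le> b3" "norm a4 \<le> b4" "norm a5 \<le> b5" for a1 a2 a3 a4 a5 :: complex and b1 b2 b3 b4 b5
        using that by (intro norm_triangle_le add_mono) (auto intro!: norm_triangle_le add_mono)
      have "norm (?J 0 (of_real X) f) \<le> H * (exp (- a * d) + 1) * T x + D * T x + D * M powr \<bar>\<nu>\<bar> * M * T x + 2 * D * D' / t + C1 * exp (- X) * (2 * X)"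
        unfolding split by (rule tri[OF s1 s2 s3 s4[OF X(2)] s5[OF X(1)]])
      also have "\<dots> \<le> H * (exp (- a * d) + 1) * T x + D * T x + D * M powr \<bar>\<nu>\<bar> * M * T x + 2 * D * D' / t * T x + 1 * T x"
      proof (intro add_mono order_refl)
        have "2 * D * D' / t * 1 \<le> 2 * D * D' / t * T x" using D D' t x by (intro mult_left_mono) auto
        then show "2 * D * D' / t \<le> 2 * D * D' / t * T x" by simp
        show "C1 * exp (- X) * (2 * X) \<le> 1 * T x" using elim x by (simp add: mult.assoc)
      qed
      also have "\<dots> = C * T x" by (simp add: C_def algebra_simps)
      finally show ?case by (simp add: f_def x_def)
    qed
  qed
  moreover have "C > 0" unfolding C_def using H0 D D' t M by (intro add_nonneg_pos add_nonneg_nonneg) auto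
  ultimately show ?thesis
    by (intro that[of C "a * (ln N' - d)"]) (simp_all add: T_def t_def)
qed

section \<open>Functions with Stirling growth\<close>

text \<open>The growth of a reciprocal Gamma function of a s, with d recording a rescaling of s. The
  exponent l s + a s (1 + d - Ln s) has derivative l + a (d - Ln s), so its saddle point is exp(l/a
  + d).\<close>

definition stirling_type :: "(complex \<Rightarrow> complex) \<Rightarrow> real \<Rightarrow> real \<Rightarrow> real \<Rightarrow> bool" where
  "stirling_type h a d \<nu> \<longleftrightarrow> (\<exists>C R. C \<ge> 0 \<and> R \<ge> 1 \<and> (\<forall>s\<in>stirling_dom R.
      norm (h s) \<le> C * norm s powr (- \<nu>) * exp (a * Re (s * (1 + of_real d - Ln s)))))"

text \<open>In the left half-plane |arg s| exceeds pi/2 by arctan(|Re s| / |Im s|), and |Im s| times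
  this excess is at most |Re s|. On a half-plane Re s >= c the loss is therefore a constant, and the
  vertical growth rate remains exactly a pi / 2.\<close>

lemma Im_mult_Im_Ln_le:
  assumes "s \<noteq> 0"
  shows "Im s * Im (Ln s) \<le> pi / 2 * \<bar>Im s\<bar> + max 0 (- Re s)"
proof (cases "Re s \<ge> 0")
  case True
  have "Im s * Im (Ln s) \<le> \<bar>Im s\<bar> * \<bar>Im (Ln s)\<bar>" by (simp add: abs_mult[symmetric])
  also have "\<dots> \<le> \<bar>Im s\<bar> * (pi / 2)" using Re_Ln_pos_le[OF assms] True by (intro mult_left_mono) auto
  finally show ?thesis using True by (simp add: mult.commute)
next
  case False
  then have x: "Re s < 0" by simp
  have *: "y * (pi + arctan (y / x)) \<le> pi / 2 * y - x" if "y > 0" "x < 0" for x y :: real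
  proof -
    have "arctan (inverse (- x / y)) = pi / 2 - arctan (- x / y)"
      using that by (intro arctan_inverse) (simp add: divide_neg_pos)
    then have "arctan (y / x) = - pi / 2 - arctan (x / y)" by (simp add: arctan_minus)
    moreover have "arctan (- x / y) \<le> - x / y" using that by (intro arctan_le_self) (auto simp: divide_nonpos_pos)
    then have "- arctan (x / y) \<le> - x / y" by (simp add: arctan_minus)
    ultimately have "pi + arctan (y / x) \<le> pi / 2 - x / y" by simp
    then have "y * (pi + arctan (y / x)) \<le> y * (pi / 2 - x / y)" using that by (intro mult_left_mono) auto
    also have "\<dots> = pi / 2 * y - x" using that by (simp add: field_simps)
    finally show ?thesis .
  qed
  consider "Im s > 0" | "Im s = 0" | "Im s < 0" by linarith
  then show ?thesis
  proof cases
    case 1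
    then show ?thesis using *[OF 1 x] x Im_Ln_eq[OF assms] by (simp add: add.commute)
  next
    case 2
    then show ?thesis by simp
  next
    case 3
    have "- Im s > 0" using 3 by simp
    note * = *[OF this x]
    have "Im (Ln s) = - (pi + arctan (- Im s / Re s))"
      using 3 x Im_Ln_eq[OF assms] by (simp add: arctan_minus)
    then have "Im s * Im (Ln s) = - Im s * (pi + arctan (- Im s / Re s))"
      by (simp only: mult_minus_left mult_minus_right)
    then show ?thesis using * 3 x by linarith
  qed
qed

lemma Re_stirling_exponent:
  assumes "s \<noteq> 0"
  shows "Re (s * (1 + of_real d - Ln s)) = Re s * (1 + d - ln (norm s)) + Im s * Im (Ln s)"
  using assms by (simp add: algebra_simps)

lemma entire_bounded_cball:
  assumes "h holomorphic_on UNIV"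
  obtains H where "H \<ge> 0" "\<And>s. norm s \<le> R \<Longrightarrow> norm (h s) \<le> H"
proof -
  have "compact (h ` cball 0 R)"
    by (intro compact_continuous_image continuous_on_subset[OF holomorphic_on_imp_continuous_on[OF assms]]) auto
  then have "bounded (h ` cball 0 R)" by (rule compact_imp_bounded)
  then obtain H where "\<forall>s\<in>cball 0 R. norm (h s) \<le> H" by (auto simp: bounded_iff)
  then show ?thesis by (intro that[of "max 0 H"]) (auto intro: max.coboundedI2)
qed

text \<open>In -a Re s ln |s| split Re s as c + (Re s - c). The first part gives the power |s|^(-a
  c), whence the exponent \<nu> + a c; the second beats any exp(-B Re s) as soon as ln |s| is
  large.\<close>

lemma stirling_type_imp_strip_decay:
  assumes h: "h holomorphic_on UNIV" and st: "stirling_type h a d \<nu>" and a: "a > 0"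
  shows "strip_decay h c (\<nu> + a * c) (a * pi / 2)"
  unfolding strip_decay_def
proof
  fix B :: real
  define \<mu> where "\<mu> = \<nu> + a * c"
  obtain C R where CR: "C \<ge> 0" "R \<ge> 1" "\<And>s. s \<in> stirling_dom R \<Longrightarrow>
      norm (h s) \<le> C * norm s powr (- \<nu>) * exp (a * Re (s * (1 + of_real d - Ln s)))"
    using st unfolding stirling_type_def by blast
  define b where "b = 1 + d + B / a"
  \<comment> \<open>Beyond this radius the points with Re s >= c lie in the sector, because |c| <=
    |s|/2, and ln |s| >= b gives the rate B. Inside, compactness bounds h.\<close>
  define R' where "R' = max R (max (2 * \<bar>c\<bar>) (exp b))"
  obtain H where H: "H \<ge> 0" "\<And>s. norm s \<le> R' \<Longrightarrow> norm (h s) \<le> H"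
    using entire_bounded_cball[OF h] by blast
  have R': "R' \<ge> R" "R' \<ge> 2 * \<bar>c\<bar>" "R' \<ge> exp b" "R' \<ge> 1" using CR(2) by (auto simp: R'_def)
  define C1 where "C1 = C * exp (a * \<bar>c\<bar>) * exp (a * b * c) * 2 powr \<bar>\<mu>\<bar>"
  define C2 where "C2 = H * (1 + R') powr \<bar>\<mu>\<bar> * exp (\<bar>B\<bar> * R')"
  show "\<exists>C\<ge>0. \<forall>s. c \<le> Re s \<longrightarrow> norm (h s) \<le> C * (1 + norm s) powr (- (\<nu> + a * c)) * exp (a * pi / 2 * \<bar>Im s\<bar> - B * Re s)"
    unfolding \<mu>_def[symmetric]
  proof (intro exI[of _ "C1 + C2"] conjI allI impI)
    fix s assume s: "c \<le> Re s"
    define Q where "Q = (1 + norm s) powr (- \<mu>) * exp (a * pi / 2 * \<bar>Im s\<bar> - B * Re s)"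
    have Q0: "Q \<ge> 0" by (simp add: Q_def)
    have "norm (h s) \<le> C1 * Q \<or> norm (h s) \<le> C2 * Q"
    proof (cases "norm s \<le> R'")
      case True
      have "1 \<le> (1 + R') powr \<bar>\<mu>\<bar> * (1 + norm s) powr (- \<mu>)"
      proof -
        have "(1 + norm s) powr \<mu> \<le> (1 + norm s) powr \<bar>\<mu>\<bar>" by (intro powr_mono) auto
        also have "\<dots> \<le> (1 + R') powr \<bar>\<mu>\<bar>" using True by (intro powr_mono2) auto
        finally have "(1 + norm s) powr \<mu> * (1 + norm s) powr (- \<mu>) \<le> (1 + R') powr \<bar>\<mu>\<bar> * (1 + norm s) powr (- \<mu>)"
          by (intro mult_right_mono) auto
        moreover have "1 + norm s \<noteq> 0" using norm_ge_zero[of s] by linarith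
        ultimately show ?thesis by (simp flip: powr_add)
      qed
      moreover have "1 \<le> exp (\<bar>B\<bar> * R') * exp (a * pi / 2 * \<bar>Im s\<bar> - B * Re s)"
      proof -
        have "B * Re s \<le> \<bar>B\<bar> * \<bar>Re s\<bar>" by (simp add: abs_mult[symmetric])
        also have "\<dots> \<le> \<bar>B\<bar> * R'" using True abs_Re_le_cmod[of s] by (intro mult_left_mono) auto
        finally have "B * Re s \<le> \<bar>B\<bar> * R'" .
        moreover have "0 \<le> a * pi / 2 * \<bar>Im s\<bar>" using a by (intro mult_nonneg_nonneg) auto
        ultimately have "0 \<le> \<bar>B\<bar> * R' + (a * pi / 2 * \<bar>Im s\<bar> - B * Re s)" by linarith
        then show ?thesis by (simp flip: exp_add)
      qed
      ultimately have "1 * 1 \<le> ((1 + R') powr \<bar>\<mu>\<bar> * (1 + norm s) powr (- \<mu>)) * (exp (\<bar>B\<bar> * R') * exp (a * pi / 2 * \<bar>Im s\<bar> - B * Re s))"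
        by (intro mult_mono) auto
      then have "H * 1 \<le> H * (((1 + R') powr \<bar>\<mu>\<bar> * (1 + norm s) powr (- \<mu>)) * (exp (\<bar>B\<bar> * R') * exp (a * pi / 2 * \<bar>Im s\<bar> - B * Re s)))"
        using H(1) by (intro mult_left_mono) auto
      also have "\<dots> = C2 * Q" by (simp only: C2_def Q_def mult_ac)
      finally show ?thesis using H(2)[OF True] by simp
    next
      case False
      define n where "n = norm s"
      have n: "n > R'" "n \<ge> 1" using False R' by (auto simp: n_def)
      have s0: "s \<noteq> 0" using n by (auto simp: n_def)
      have dom: "s \<in> stirling_dom R" using n R' s by (auto simp: stirling_dom_def n_def)
      have im: "Im s * Im (Ln s) \<le> pi / 2 * \<bar>Im s\<bar> + \<bar>c\<bar>"
        using Im_mult_Im_Ln_le[OF s0] s by linarith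
      have "b \<le> ln n" using n R'(3) by (subst ln_ge_iff) auto
      then have "b * (Re s - c) \<le> ln n * (Re s - c)" using s by (intro mult_right_mono) auto
      then have "Re s * (1 + d - ln n) \<le> - (c * ln n) - (B / a) * Re s + b * c"
        by (simp add: b_def algebra_simps)
      with im have "Re (s * (1 + of_real d - Ln s)) \<le> (- (c * ln n) - (B / a) * Re s + b * c) + (pi / 2 * \<bar>Im s\<bar> + \<bar>c\<bar>)"
        unfolding Re_stirling_exponent[OF s0] n_def by linarith
      then have "a * Re (s * (1 + of_real d - Ln s)) \<le> a * ((- (c * ln n) - (B / a) * Re s + b * c) + (pi / 2 * \<bar>Im s\<bar> + \<bar>c\<bar>))"
        using a by (intro mult_left_mono) auto
      also have "\<dots> = (- (a * c)) * ln n + (a * pi / 2 * \<bar>Im s\<bar> - B * Re s) + a * b * c + a * \<bar>c\<bar>"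
        using a by (simp add: field_simps)
      finally have e: "exp (a * Re (s * (1 + of_real d - Ln s))) \<le> exp ((- (a * c)) * ln n) * exp (a * pi / 2 * \<bar>Im s\<bar> - B * Re s) * exp (a * b * c) * exp (a * \<bar>c\<bar>)"
        by (simp flip: exp_add)
      have nn: "n powr (- \<nu>) * exp ((- (a * c)) * ln n) = n powr (- \<mu>)"
        using n by (simp add: powr_def \<mu>_def algebra_simps flip: exp_add)
      have n2: "n powr (- \<mu>) \<le> 2 powr \<bar>\<mu>\<bar> * (1 + n) powr (- \<mu>)"
      proof (cases "\<mu> \<ge> 0")
        case True
        have "(1 + n) powr \<mu> \<le> (2 * n) powr \<mu>" using n True by (intro powr_mono2) auto
        then have "(1 + n) powr \<mu> \<le> 2 powr \<mu> * n powr \<mu>" using n by (simp add: powr_mult)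
        then show ?thesis using n True by (simp add: powr_minus field_simps)
      next
        case neg: False
        have "1 * n powr (- \<mu>) \<le> 2 powr \<bar>\<mu>\<bar> * (1 + n) powr (- \<mu>)"
          using n neg by (intro mult_mono powr_mono2 ge_one_powr_ge_zero) auto
        then show ?thesis by simp
      qed
      have "norm (h s) \<le> C * n powr (- \<nu>) * exp (a * Re (s * (1 + of_real d - Ln s)))"
        using CR(3)[OF dom] by (simp add: n_def)
      also have "\<dots> \<le> C * n powr (- \<nu>) * (exp ((- (a * c)) * ln n) * exp (a * pi / 2 * \<bar>Im s\<bar> - B * Re s) * exp (a * b * c) * exp (a * \<bar>c\<bar>))"
        using CR(1) e by (intro mult_left_mono) auto
      also have "\<dots> = (C * exp (a * \<bar>c\<bar>) * exp (a * b * c)) * exp (a * pi / 2 * \<bar>Im s\<bar> - B * Re s) * (n powr (- \<nu>) * exp ((- (a * c)) * ln n))"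
        by (simp only: mult_ac)
      also have "\<dots> \<le> (C * exp (a * \<bar>c\<bar>) * exp (a * b * c)) * exp (a * pi / 2 * \<bar>Im s\<bar> - B * Re s) * (2 powr \<bar>\<mu>\<bar> * (1 + n) powr (- \<mu>))"
        unfolding nn using n2 CR(1) by (intro mult_left_mono) auto
      also have "\<dots> = C1 * Q" by (simp only: C1_def Q_def n_def mult_ac)
      finally show ?thesis by simp
    qed
    moreover have "C1 * Q \<ge> 0" "C2 * Q \<ge> 0" using CR(1) H(1) Q0 by (auto simp: C1_def C2_def)
    ultimately have "norm (h s) \<le> (C1 + C2) * Q" by (auto simp: distrib_right)
    then show "norm (h s) \<le> (C1 + C2) * (1 + norm s) powr (- \<mu>) * exp (a * pi / 2 * \<bar>Im s\<bar> - B * Re s)"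
      by (simp add: Q_def mult.assoc)
  qed (use CR(1) H(1) in \<open>auto simp: C1_def C2_def\<close>)
qed

text \<open>On the ray \<open>Ln s\<close> is ln u + i \<psi>, which makes the Stirling exponent
  explicit. Between u = 1 and the radius where the growth bound starts, the quotient of the two
  sides is continuous on a compact interval.\<close>

lemma stirling_type_ray:
  assumes h: "h holomorphic_on UNIV" and st: "stirling_type h a d \<nu>" and psi: "0 < \<psi>" "\<psi> < pi / 2"
  obtains D where "\<And>u. u \<ge> 1 \<Longrightarrow> norm (h (of_real u * cis \<psi>))
        \<le> D * u powr (- \<nu>) * exp (a * u * (cos \<psi> * (1 + d - ln u) + \<psi> * sin \<psi>))"
proof -
  obtain C R where CR: "C \<ge> 0" "R \<ge> 1" "\<And>s. s \<in> stirling_dom R \<Longrightarrow>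
      norm (h s) \<le> C * norm s powr (- \<nu>) * exp (a * Re (s * (1 + of_real d - Ln s)))"
    using st unfolding stirling_type_def by blast
  have cpos: "cos \<psi> > 0" using psi by (intro cos_gt_zero) auto
  define q where "q = (\<lambda>u. u powr (- \<nu>) * exp (a * u * (cos \<psi> * (1 + d - ln u) + \<psi> * sin \<psi>)))"
  have qpos: "q u > 0" if "u \<ge> 1" for u using that by (simp add: q_def)
  have "continuous_on {1..R} (\<lambda>u. norm (h (of_real u * cis \<psi>)) / q u)"
    unfolding q_def
    by (intro continuous_intros continuous_on_compose2[OF holomorphic_on_imp_continuous_on[OF h]]) auto
  then have "compact ((\<lambda>u. norm (h (of_real u * cis \<psi>)) / q u) ` {1..R})"
    by (intro compact_continuous_image) auto
  then have "bounded ((\<lambda>u. norm (h (of_real u * cis \<psi>)) / q u) ` {1..R})" by (rule compact_imp_bounded)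
  then obtain D0 where D0: "\<And>u. 1 \<le> u \<Longrightarrow> u \<le> R \<Longrightarrow> norm (norm (h (of_real u * cis \<psi>)) / q u) \<le> D0"
    unfolding bounded_iff by (metis imageI atLeastAtMost_iff)
  have "norm (h (of_real u * cis \<psi>)) \<le> max C D0 * q u" if u: "u \<ge> 1" for u
  proof (cases "u \<le> R")
    case True
    have "norm (h (of_real u * cis \<psi>)) / q u \<le> D0" using D0[OF u True] qpos[OF u] by simp
    then have "norm (h (of_real u * cis \<psi>)) \<le> D0 * q u" using qpos[OF u] by (simp add: divide_le_eq)
    also have "\<dots> \<le> max C D0 * q u" using qpos[OF u] by (intro mult_right_mono) auto
    finally show ?thesis .
  next
    case False
    define s where "s = of_real u * cis \<psi>"
    have n: "norm s = u" using u by (simp add: s_def norm_mult)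
    have dom: "s \<in> stirling_dom R" using False cpos n u by (auto simp: stirling_dom_def s_def intro: order_trans[of _ 0])
    have Ln: "Ln s = of_real (ln u) + \<i> * of_real \<psi>"
    proof -
      have "s = exp (of_real (ln u) + \<i> * of_real \<psi>)"
        using u by (simp add: s_def exp_add cis_conv_exp exp_of_real)
      then show ?thesis using psi pi_gt_zero by (simp add: Ln_exp)
    qed
    have "Re (s * (1 + of_real d - Ln s)) = u * (cos \<psi> * (1 + d - ln u) + \<psi> * sin \<psi>)"
      unfolding Ln by (simp add: s_def algebra_simps)
    then have "norm (h s) \<le> C * q u" using CR(3)[OF dom] n by (simp add: q_def mult_ac)
    also have "\<dots> \<le> max C D0 * q u" using qpos[OF u] by (intro mult_right_mono) auto
    finally show ?thesis by (simp add: s_def)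
  qed
  then show ?thesis by (intro that[of "max C D0"]) (simp add: q_def mult.assoc)
qed

section \<open>Two-term expansions at infinity in the sector\<close>

lemma stirling_dom_mono: "R \<le> R' \<Longrightarrow> stirling_dom R' \<subseteq> stirling_dom R"
  by (auto simp: stirling_dom_def)

lemma stirling_dom_scale:
  assumes "a > 0" "z \<in> stirling_dom (R / a)"
  shows "of_real a * z \<in> stirling_dom R"
proof -
  have "a * (- norm z / 2) \<le> a * Re z" using assms by (intro mult_left_mono) (auto simp: stirling_dom_def)
  then show ?thesis using assms by (auto simp: stirling_dom_def norm_mult field_simps)
qed

lemma stirling_dom_not_nonpos: "z \<in> stirling_dom R \<Longrightarrow> R > 0 \<Longrightarrow> z \<notin> \<real>\<^sub>\<le>\<^sub>0"
  using stirling_dom_add_not_nonpos[of z R 0] by simp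

definition expands2 :: "(complex \<Rightarrow> complex) \<Rightarrow> complex \<Rightarrow> complex \<Rightarrow> bool" where
  "expands2 f k0 k1 \<longleftrightarrow> (\<exists>C R. C \<ge> 0 \<and> R \<ge> 1 \<and> (\<forall>z\<in>stirling_dom R. norm (f z - (k0 + k1 / z)) \<le> C / (norm z)\<^sup>2))"

text \<open>The additional radius \<open>R'\<close> lets two expansions be used on one common
  sector.\<close>

lemma expands2D:
  assumes "expands2 f k0 k1"
  obtains C R where "C \<ge> 0" "R \<ge> 1" "\<And>z R'. R' \<ge> R \<Longrightarrow> z \<in> stirling_dom R' \<Longrightarrow> norm (f z - (k0 + k1 / z)) \<le> C / (norm z)\<^sup>2"
proof -
  obtain C R where CR: "C \<ge> 0" "R \<ge> 1" "\<And>z. z \<in> stirling_dom R \<Longrightarrow> norm (f z - (k0 + k1 / z)) \<le> C / (norm z)\<^sup>2"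
    using assms unfolding expands2_def by blast
  then show ?thesis using stirling_dom_mono by (intro that[of C R]) blast+
qed

lemma expands2I:
  assumes "C \<ge> 0" "R \<ge> 1" "\<And>z. z \<in> stirling_dom R \<Longrightarrow> norm z \<ge> 1 \<Longrightarrow> z \<noteq> 0 \<Longrightarrow> norm (f z - (k0 + k1 / z)) \<le> C / (norm z)\<^sup>2"
  shows "expands2 f k0 k1"
  unfolding expands2_def
proof (rule exI[of _ C], rule exI[of _ R], intro conjI ballI)
  fix z assume z: "z \<in> stirling_dom R"
  then have "norm z \<ge> 1" "z \<noteq> 0" using assms(2) by (auto simp: stirling_dom_def)
  with z show "norm (f z - (k0 + k1 / z)) \<le> C / (norm z)\<^sup>2" by (intro assms(3))
qed (use assms in auto)

lemma expands2_mult: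
  assumes "expands2 f k0 k1" "expands2 g l0 l1"
  shows "expands2 (\<lambda>z. f z * g z) (k0 * l0) (k0 * l1 + k1 * l0)"
proof -
  obtain C R where C: "C \<ge> 0" "R \<ge> 1" "\<And>z R'. R' \<ge> R \<Longrightarrow> z \<in> stirling_dom R' \<Longrightarrow> norm (f z - (k0 + k1 / z)) \<le> C / (norm z)\<^sup>2"
    using expands2D[OF assms(1)] by blast
  obtain D S where D: "D \<ge> 0" "S \<ge> 1" "\<And>z R'. R' \<ge> S \<Longrightarrow> z \<in> stirling_dom R' \<Longrightarrow> norm (g z - (l0 + l1 / z)) \<le> D / (norm z)\<^sup>2"
    using expands2D[OF assms(2)] by blast
  show ?thesis
  proof (rule expands2I)
    fix z assume z: "z \<in> stirling_dom (max R S)" "norm z \<ge> 1" "z \<noteq> 0"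
    define x where "x = norm z"
    have x: "x \<ge> 1" using z by (simp add: x_def)
    then have x2: "x\<^sup>2 \<ge> 1" by simp
    define F where "F = f z - (k0 + k1 / z)"
    define G where "G = g z - (l0 + l1 / z)"
    have F: "norm F \<le> C / x\<^sup>2" unfolding F_def x_def by (rule C(3)[OF _ z(1)]) simp
    have G: "norm G \<le> D / x\<^sup>2" unfolding G_def x_def by (rule D(3)[OF _ z(1)]) simp
    have F1: "norm F \<le> C" using F x2 C(1) by (elim order_trans) (simp add: divide_le_eq mult_left_le_one_le field_simps mult_le_cancel_left1)
    have inv: "norm (k / z) \<le> norm k" for k using x by (simp add: norm_divide x_def[symmetric] divide_le_eq mult_le_cancel_left1)
    have K: "norm (k0 + k1 / z) \<le> norm k0 + norm k1"
      by (rule order_trans[OF norm_triangle_ineq]) (use inv in simp)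
    have L: "norm (l0 + l1 / z) \<le> norm l0 + norm l1"
      by (rule order_trans[OF norm_triangle_ineq]) (use inv in simp)
    have "f z * g z - (k0 * l0 + (k0 * l1 + k1 * l0) / z) = F * (l0 + l1 / z) + (k0 + k1 / z) * G + F * G + k1 * l1 / z\<^sup>2"
      using z by (simp add: F_def G_def field_simps power2_eq_square)
    also have "norm \<dots> \<le> norm F * norm (l0 + l1 / z) + norm (k0 + k1 / z) * norm G + norm F * norm G + norm (k1 * l1) / x\<^sup>2"
      by (intro norm_triangle_le add_mono) (auto simp: norm_mult norm_divide norm_power x_def)
    also have "\<dots> \<le> (C / x\<^sup>2) * (norm l0 + norm l1) + (norm k0 + norm k1) * (D / x\<^sup>2) + C * (D / x\<^sup>2) + norm (k1 * l1) / x\<^sup>2"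
      using F G F1 K L C(1) D(1) by (intro add_mono mult_mono order_refl) auto
    also have "\<dots> = (C * (norm l0 + norm l1) + (norm k0 + norm k1) * D + C * D + norm (k1 * l1)) / x\<^sup>2"
      by (simp add: add_divide_distrib distrib_left distrib_right)
    finally show "norm (f z * g z - (k0 * l0 + (k0 * l1 + k1 * l0) / z))
        \<le> (C * (norm l0 + norm l1) + (norm k0 + norm k1) * D + C * D + norm (k1 * l1)) / (norm z)\<^sup>2"
      by (simp add: x_def)
  qed (use C D in auto)
qed

lemma expands2_power:
  assumes "expands2 f 1 k"
  shows "expands2 (\<lambda>z. f z ^ n) 1 (of_nat n * k)"
proof (induction n)
  case 0
  show ?case by (rule expands2I[of 0 1]) auto
next
  case (Suc n)
  from expands2_mult[OF assms Suc] show ?case by (simp add: algebra_simps)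
qed

lemma expands2_scale:
  assumes "expands2 f k0 k1" "a > 0"
  shows "expands2 (\<lambda>z. f (of_real a * z)) k0 (k1 / of_real a)"
proof -
  obtain C R where C: "C \<ge> 0" "R \<ge> 1" "\<And>z R'. R' \<ge> R \<Longrightarrow> z \<in> stirling_dom R' \<Longrightarrow> norm (f z - (k0 + k1 / z)) \<le> C / (norm z)\<^sup>2"
    using expands2D[OF assms(1)] by blast
  show ?thesis
  proof (rule expands2I[of "C / a\<^sup>2" "max 1 (R / a)"])
    fix z assume "z \<in> stirling_dom (max 1 (R / a))"
    then have "z \<in> stirling_dom (R / a)" using stirling_dom_mono[of "R / a" "max 1 (R / a)"] by auto
    then have "of_real a * z \<in> stirling_dom R" by (rule stirling_dom_scale[OF assms(2)])
    from C(3)[OF order_refl this] show "norm (f (of_real a * z) - (k0 + k1 / of_real a / z)) \<le> C / a\<^sup>2 / (norm z)\<^sup>2"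
      using assms(2) by (simp add: norm_mult power_mult_distrib)
  qed (use C in auto)
qed

lemma expands2_diff:
  assumes "expands2 f k0 k1" "expands2 g l0 l1"
  shows "expands2 (\<lambda>z. f z - g z) (k0 - l0) (k1 - l1)"
proof -
  obtain C R where C: "C \<ge> 0" "R \<ge> 1" "\<And>z R'. R' \<ge> R \<Longrightarrow> z \<in> stirling_dom R' \<Longrightarrow> norm (f z - (k0 + k1 / z)) \<le> C / (norm z)\<^sup>2"
    using expands2D[OF assms(1)] by blast
  obtain D S where D: "D \<ge> 0" "S \<ge> 1" "\<And>z R'. R' \<ge> S \<Longrightarrow> z \<in> stirling_dom R' \<Longrightarrow> norm (g z - (l0 + l1 / z)) \<le> D / (norm z)\<^sup>2"
    using expands2D[OF assms(2)] by blast
  show ?thesis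
  proof (rule expands2I)
    fix z assume z: "z \<in> stirling_dom (max R S)"
    have "f z - g z - (k0 - l0 + (k1 - l1) / z) = (f z - (k0 + k1 / z)) - (g z - (l0 + l1 / z))"
      by (simp add: diff_divide_distrib)
    also have "norm \<dots> \<le> C / (norm z)\<^sup>2 + D / (norm z)\<^sup>2"
      by (rule order_trans[OF norm_triangle_ineq4 add_mono[OF C(3)[OF _ z] D(3)[OF _ z]]]) simp_all
    finally show "norm (f z - g z - (k0 - l0 + (k1 - l1) / z)) \<le> (C + D) / (norm z)\<^sup>2"
      by (simp add: add_divide_distrib)
  qed (use C D in auto)
qed

lemma expands2_const: "expands2 (\<lambda>z. c) c 0"
  by (rule expands2I[of 0 1]) auto

lemma expands2_inverse: "expands2 (\<lambda>z. 1 / z) 0 1"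
  by (rule expands2I[of 0 1]) auto

lemma expands2_bounded:
  assumes "expands2 f k0 k1"
  obtains C R where "C \<ge> 0" "R \<ge> 1" "\<And>z. z \<in> stirling_dom R \<Longrightarrow> norm (f z) \<le> C"
proof -
  obtain C R where C: "C \<ge> 0" "R \<ge> 1" "\<And>z R'. R' \<ge> R \<Longrightarrow> z \<in> stirling_dom R' \<Longrightarrow> norm (f z - (k0 + k1 / z)) \<le> C / (norm z)\<^sup>2"
    using expands2D[OF assms(1)] by blast
  have "norm (f z) \<le> C + (norm k0 + norm k1)" if z: "z \<in> stirling_dom R" for z
  proof -
    have x: "norm z \<ge> 1" using z C(2) by (auto simp: stirling_dom_def)
    have "f z = (f z - (k0 + k1 / z)) + (k0 + k1 / z)" by simp
    also have "norm \<dots> \<le> C / (norm z)\<^sup>2 + (norm k0 + norm k1 / norm z)"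
      by (rule order_trans[OF norm_triangle_ineq add_mono[OF C(3)[OF order_refl z] order_trans[OF norm_triangle_ineq]]])
         (simp add: norm_divide)
    also have "\<dots> \<le> C / 1 + (norm k0 + norm k1 / 1)"
    proof -
      have "(norm z)\<^sup>2 \<ge> 1" "z \<noteq> 0" using x by auto
      then show ?thesis using x C(1) by (intro add_mono divide_left_mono order_refl) auto
    qed
    finally show ?thesis by simp
  qed
  then show ?thesis using C by (intro that[of "C + (norm k0 + norm k1)" R]) auto
qed

section \<open>Powers of reciprocal Gamma functions\<close>

lemma expands2_stirling_quot:
  "expands2 (\<lambda>z. of_real (sqrt (2 * pi)) * stirling_quot b z) 1 (- of_real (stirling_coeff b))"
proof -
  obtain R C where "R \<ge> 1" "C \<ge> 0"
    "\<And>z. z \<in> stirling_dom R \<Longrightarrow>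
      norm (of_real (sqrt (2 * pi)) * stirling_quot b z - (1 - of_real (stirling_coeff b) / z)) \<le> C / (norm z)\<^sup>2"
    using stirling_quot_asymp[of b] by blast
  then show ?thesis by (intro expands2I[of C R]) auto
qed

lemma rGamma_stirling_quot: "rGamma (z + of_real b) = stirling_quot b z * exp (z - (z + of_real b - 1/2) * Ln z)"
proof -
  have "exp ((z + of_real b - 1/2) * Ln z - z) * exp (z - (z + of_real b - 1/2) * Ln z) = 1"
    by (simp flip: exp_add)
  then show ?thesis unfolding stirling_quot_def by (simp add: mult.assoc)
qed

text \<open>The exponential factor is the m-th power of Stirling's at \<alpha> s. Since m (\<beta> -
  1/2) = b - 1/2, it carries the power |s|^(-(b - 1/2)), to which the decay of \<open>Q\<close> adds
  \<nu>; the shift -ln \<alpha> comes from \<open>Ln\<close> of \<alpha> s.\<close>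

lemma expands2_imp_stirling_type:
  fixes \<alpha> \<beta> :: real and m :: nat
  defines "a \<equiv> \<alpha> * m" and "b \<equiv> real m * \<beta> - (real m - 1) / 2"
  assumes al: "\<alpha> > 0" and ex: "\<exists>C R. C \<ge> 0 \<and> R \<ge> 1 \<and> (\<forall>z\<in>stirling_dom R. norm (Q z) \<le> C * norm z powr (- \<nu>))"
    and h: "\<And>s. s \<notin> \<real>\<^sub>\<le>\<^sub>0 \<Longrightarrow> h s = Q (of_real \<alpha> * s) *
       exp (of_nat m * (of_real \<alpha> * s - (of_real \<alpha> * s + of_real \<beta> - 1/2) * Ln (of_real \<alpha> * s)))"
  shows "stirling_type h a (- ln \<alpha>) (b - 1/2 + \<nu>)"
proof -
  obtain C R where C: "C \<ge> 0" "R \<ge> 1" "\<And>z. z \<in> stirling_dom R \<Longrightarrow> norm (Q z) \<le> C * norm z powr (- \<nu>)"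
    using ex by blast
  define K where "K = \<alpha> powr (- \<nu>) * exp (- (b - 1/2) * ln \<alpha>)"
  have "norm (h s) \<le> (C * K) * norm s powr (- (b - 1/2 + \<nu>)) * exp (a * Re (s * (1 + of_real (- ln \<alpha>) - Ln s)))"
    if s: "s \<in> stirling_dom (max 1 (R / \<alpha>))" for s
  proof -
    have dom: "of_real \<alpha> * s \<in> stirling_dom R"
      using s stirling_dom_mono[of "R / \<alpha>" "max 1 (R / \<alpha>)"] by (intro stirling_dom_scale[OF al]) auto
    have sn: "norm s \<ge> 1" "s \<noteq> 0" using s by (auto simp: stirling_dom_def)
    have s1: "s \<notin> \<real>\<^sub>\<le>\<^sub>0" using stirling_dom_not_nonpos[OF s] by simp
    have Ln: "Ln (of_real \<alpha> * s) = of_real (ln \<alpha>) + Ln s"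
      using Ln_times_of_real[OF al sn(2)] al by (simp add: Ln_of_real)
    have rr: "Re (of_real x * w) = x * Re w" for x w by simp
    have "Re (of_nat m * (of_real \<alpha> * s - (of_real \<alpha> * s + of_real \<beta> - 1/2) * Ln (of_real \<alpha> * s)))
        = a * Re (s * (1 + of_real (- ln \<alpha>) - Ln s)) - (b - 1/2) * ln \<alpha> - (b - 1/2) * ln (norm s)"
    proof -
      have "of_nat m * (of_real \<alpha> * s - (of_real \<alpha> * s + of_real \<beta> - 1/2) * Ln (of_real \<alpha> * s))
        = of_real a * (s * (1 + of_real (- ln \<alpha>) - Ln s)) - of_real (b - 1/2) * (of_real (ln \<alpha>) + Ln s)"
        unfolding Ln a_def b_def by (simp add: field_simps)
      then have "Re (of_nat m * (of_real \<alpha> * s - (of_real \<alpha> * s + of_real \<beta> - 1/2) * Ln (of_real \<alpha> * s)))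
        = Re (of_real a * (s * (1 + of_real (- ln \<alpha>) - Ln s))) - Re (of_real (b - 1/2) * (of_real (ln \<alpha>) + Ln s))"
        by simp
      also have "Re (of_real (b - 1/2) * (of_real (ln \<alpha>) + Ln s)) = (b - 1/2) * (ln \<alpha> + ln (norm s))"
        unfolding rr using sn by simp
      also have "Re (of_real a * (s * (1 + of_real (- ln \<alpha>) - Ln s))) = a * Re (s * (1 + of_real (- ln \<alpha>) - Ln s))"
        by (rule rr)
      finally show ?thesis by (simp add: algebra_simps)
    qed
    then have "norm (h s) = norm (Q (of_real \<alpha> * s)) * exp (a * Re (s * (1 + of_real (- ln \<alpha>) - Ln s)) - (b - 1/2) * ln \<alpha> - (b - 1/2) * ln (norm s))"
      unfolding h[OF s1] norm_mult norm_exp_eq_Re by simp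
    also have "\<dots> \<le> (C * norm (of_real \<alpha> * s) powr (- \<nu>)) * exp (a * Re (s * (1 + of_real (- ln \<alpha>) - Ln s)) - (b - 1/2) * ln \<alpha> - (b - 1/2) * ln (norm s))"
      by (intro mult_right_mono C(3)[OF dom]) auto
    also have "exp (a * Re (s * (1 + of_real (- ln \<alpha>) - Ln s)) - (b - 1/2) * ln \<alpha> - (b - 1/2) * ln (norm s))
       = exp (a * Re (s * (1 + of_real (- ln \<alpha>) - Ln s))) * exp (- (b - 1/2) * ln \<alpha>) * norm s powr (- (b - 1/2))"
      using sn by (simp add: powr_def algebra_simps flip: exp_add)
    also have "norm (of_real \<alpha> * s) powr (- \<nu>) = \<alpha> powr (- \<nu>) * norm s powr (- \<nu>)"
      using al by (simp add: norm_mult powr_mult)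
    also have "norm s powr (- (b - 1/2 + \<nu>)) = norm s powr (- (b - 1/2)) * norm s powr (- \<nu>)"
      by (simp flip: powr_add)
    ultimately show ?thesis by (simp add: K_def mult_ac)
  qed
  moreover have "C * K \<ge> 0" using C by (simp add: K_def)
  ultimately show ?thesis unfolding stirling_type_def
    by (intro exI[where x = "C * K"] exI[where x = "max 1 (R / \<alpha>)"] conjI ballI) auto
qed


lemma stirling_type_rGamma_power:
  fixes \<alpha> \<beta> :: real and m :: nat
  defines "a \<equiv> \<alpha> * m" and "b \<equiv> real m * \<beta> - (real m - 1) / 2"
  assumes al: "\<alpha> > 0"
  shows "stirling_type (\<lambda>s. rGamma (of_real \<alpha> * s + of_real \<beta>) ^ m) a (- ln \<alpha>) (b - 1/2)"
proof -
  define S where "S = complex_of_real (sqrt (2 * pi))"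
  have S: "S \<noteq> 0" by (simp add: S_def)
  obtain C R where C: "C \<ge> 0" "R \<ge> 1" "\<And>z. z \<in> stirling_dom R \<Longrightarrow> norm ((S * stirling_quot \<beta> z) ^ m) \<le> C"
    using expands2_bounded[OF expands2_power[OF expands2_stirling_quot, of \<beta> m]] unfolding S_def by blast
  have "stirling_type (\<lambda>s. rGamma (of_real \<alpha> * s + of_real \<beta>) ^ m) a (- ln \<alpha>) (b - 1/2 + 0)"
    unfolding a_def b_def
  proof (rule expands2_imp_stirling_type[OF al, where Q = "\<lambda>z. stirling_quot \<beta> z ^ m"])
    have "norm (stirling_quot \<beta> z ^ m) \<le> (C / norm (S ^ m)) * norm z powr (- 0)" if z: "z \<in> stirling_dom R" for z
    proof -
      have "norm z \<noteq> 0" using z C(2) by (auto simp: stirling_dom_def)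
      moreover have "norm (S ^ m) * norm (stirling_quot \<beta> z ^ m) \<le> C"
        using C(3)[OF z] by (simp only: power_mult_distrib norm_mult)
      ultimately show ?thesis using S by (simp add: field_simps)
    qed
    moreover have "C / norm (S ^ m) \<ge> 0" using C by simp
    ultimately show "\<exists>C R. C \<ge> 0 \<and> R \<ge> 1 \<and> (\<forall>z\<in>stirling_dom R. norm (stirling_quot \<beta> z ^ m) \<le> C * norm z powr (- 0))"
      using C(2) by blast
  qed (simp add: rGamma_stirling_quot power_mult_distrib flip: exp_of_nat_mult)
  then show ?thesis by simp
qed

text \<open>With z = \<alpha> s, the m-th power and m^(m z) / Gamma(m z + b) have the same Stirling
  factor up to a constant: b is determined by equating the powers of z. \<open>A0\<close> matches
  the constants and \<open>A1\<close> the 1/z terms, so the difference gains two powers, from b -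
  1/2 to b + 3/2.\<close>

lemma stirling_type_rGamma_power_diff:
  fixes \<alpha> \<beta> :: real and m :: nat
  defines "a \<equiv> \<alpha> * m" and "b \<equiv> real m * \<beta> - (real m - 1) / 2"
  defines "A0 \<equiv> (2 * pi) powr ((1 - real m) / 2) * real m powr (b - 1/2)"
  assumes al: "\<alpha> > 0" and m: "m \<ge> 1"
  obtains A1 :: complex where "stirling_type (\<lambda>s. rGamma (of_real \<alpha> * s + of_real \<beta>) ^ m
      - exp (of_real (a * ln m) * s) * (of_real A0 * rGamma (of_real a * s + of_real b) + A1 * rGamma (of_real a * s + of_real (b + 1))))
      a (- ln \<alpha>) (b + 3/2)"
proof -
  define S where "S = complex_of_real (sqrt (2 * pi))"
  have S: "S \<noteq> 0" by (simp add: S_def)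
  define M where "M = complex_of_real (real m)"
  have mM: "of_nat m = M" by (simp add: M_def)
  have M: "M \<noteq> 0" using m by (simp add: M_def)
  define k1 where "k1 = complex_of_real (stirling_coeff \<beta>)"
  define k2 where "k2 = complex_of_real (stirling_coeff b)"
  define k3 where "k3 = complex_of_real (stirling_coeff (b + 1))"
  \<comment> \<open>The 1/z coefficient is -M k1 for the m-th power and -k2/M for the single Gamma
    function; the second Gamma term has to supply the difference.\<close>
  define k where "k = k2 / M - M * k1"
  define L where "L = complex_of_real (ln (real m))"
  define T where "T = (\<lambda>z. (S * stirling_quot \<beta> z) ^ m - S * stirling_quot b (M * z) - (k * (S * stirling_quot (b + 1) (M * z))) * (1 / z))"
  \<comment> \<open>Undoes the factor m^(-(b + 1/2)) that accompanies the second Gamma term and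
    adjusts the powers of sqrt (2 pi). The factor 1/z is supplied by raising the argument from b to
    b + 1.\<close>
  define A1 where "A1 = S * k * exp (of_real (b + 1/2) * L) / S ^ m"
  have e1: "expands2 (\<lambda>z. (S * stirling_quot \<beta> z) ^ m) 1 (M * (- k1))"
    unfolding S_def k1_def M_def using expands2_power[OF expands2_stirling_quot, of \<beta> m] by simp
  have e2: "expands2 (\<lambda>z. S * stirling_quot b (M * z)) 1 (- k2 / M)"
    unfolding S_def k2_def M_def using m by (intro expands2_scale[OF expands2_stirling_quot]) simp
  have e3: "expands2 (\<lambda>z. S * stirling_quot (b + 1) (M * z)) 1 (- k3 / M)"
    unfolding S_def k3_def M_def using m by (intro expands2_scale[OF expands2_stirling_quot]) simp
  have "expands2 T 0 0"
    using expands2_diff[OF expands2_diff[OF e1 e2] expands2_mult[OF expands2_mult[OF expands2_const[of k] e3] expands2_inverse]]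
    unfolding T_def k_def by simp
  then obtain C R where C: "C \<ge> 0" "R \<ge> 1" "\<And>z. z \<in> stirling_dom R \<Longrightarrow> norm (T z) \<le> C / (norm z)\<^sup>2"
    unfolding expands2_def by auto
  have A0: "of_real A0 = S / S ^ m * exp (of_real (b - 1/2) * L)"
  proof -
    have "sqrt (2 * pi) / sqrt (2 * pi) ^ m = (2 * pi) powr ((1 - real m) / 2)"
      by (simp add: powr_half_sqrt[symmetric] powr_power powr_diff[symmetric] diff_divide_distrib)
    moreover have "real m powr (b - 1/2) = exp ((b - 1/2) * ln (real m))" using m by (simp add: powr_def)
    ultimately have "A0 = sqrt (2 * pi) / sqrt (2 * pi) ^ m * exp ((b - 1/2) * ln (real m))" by (simp add: A0_def)
    then show ?thesis by (simp only: of_real_mult of_real_divide of_real_power S_def L_def exp_of_real[symmetric])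
  qed
  have "stirling_type (\<lambda>s. rGamma (of_real \<alpha> * s + of_real \<beta>) ^ m
      - exp (of_real (a * ln m) * s) * (of_real A0 * rGamma (of_real a * s + of_real b) + A1 * rGamma (of_real a * s + of_real (b + 1))))
      a (- ln \<alpha>) (b - 1/2 + 2)"
    unfolding a_def b_def
  proof (rule expands2_imp_stirling_type[OF al, where Q = "\<lambda>z. T z / S ^ m"], goal_cases)
    case 1
    have "norm (T z / S ^ m) \<le> (C / norm (S ^ m)) * norm z powr (- 2)" if z: "z \<in> stirling_dom R" for z
    proof -
      have "norm z > 0" using z C(2) by (auto simp: stirling_dom_def)
      then have "norm z powr (- 2) = 1 / (norm z)\<^sup>2" by (simp add: powr_minus inverse_eq_divide)
      moreover have "norm (T z / S ^ m) \<le> C / (norm z)\<^sup>2 / norm (S ^ m)"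
        unfolding norm_divide by (intro divide_right_mono C(3)[OF z]) simp
      ultimately show ?thesis by (simp add: field_simps)
    qed
    moreover have "C / norm (S ^ m) \<ge> 0" using C by simp
    ultimately show ?case using C(2) by blast
  next
    case (2 s)
    define z where "z = of_real \<alpha> * s"
    have z0: "z \<noteq> 0" using 2 al by (auto simp: z_def)
    have Ln: "Ln (M * z) = L + Ln z"
      using Ln_times_of_real[of "real m" z] m z0 by (simp add: M_def L_def Ln_of_real)
    define P where "P = exp (M * (z - (z + of_real \<beta> - 1/2) * Ln z))"
    have az: "of_real a * s = M * z" by (simp add: a_def M_def z_def)
    have az2: "of_real (a * ln m) * s = M * z * L" by (simp add: a_def M_def z_def L_def)
    have bb: "M * z + of_real b - 1/2 = M * (z + of_real \<beta> - 1/2)"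
      by (simp add: b_def M_def field_simps)
    have g1: "rGamma (z + of_real \<beta>) ^ m = stirling_quot \<beta> z ^ m * P"
      unfolding P_def rGamma_stirling_quot power_mult_distrib mM[symmetric] exp_of_nat_mult ..
    have g2: "exp (M * z * L) * rGamma (M * z + of_real b) = stirling_quot b (M * z) * (P * exp (- of_real (b - 1/2) * L))"
    proof -
      have "M * z * L + (M * z - (M * z + of_real b - 1/2) * Ln (M * z)) = M * (z - (z + of_real \<beta> - 1/2) * Ln z) + - of_real (b - 1/2) * L"
      proof -
        have "(M * z + of_real b - 1/2) * Ln (M * z) = (M * z + of_real b - 1/2) * L + M * (z + of_real \<beta> - 1/2) * Ln z"
          unfolding Ln distrib_left bb ..
        then show ?thesis by (simp add: algebra_simps)
      qed
      then show ?thesis unfolding rGamma_stirling_quot P_def by (simp only: exp_add[symmetric] mult.left_commute[of "exp _" "stirling_quot _ _"])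
    qed
    have g3: "exp (M * z * L) * rGamma (M * z + of_real (b + 1)) = stirling_quot (b + 1) (M * z) * (P * exp (- of_real (b + 1/2) * L) / z)"
    proof -
      have "M * z * L + (M * z - (M * z + of_real (b + 1) - 1/2) * Ln (M * z)) = (M * (z - (z + of_real \<beta> - 1/2) * Ln z) + - of_real (b + 1/2) * L) + - Ln z"
      proof -
        have "(M * z + of_real (b + 1) - 1/2) * Ln (M * z) = (M * z + of_real b - 1/2) * L + L + M * (z + of_real \<beta> - 1/2) * Ln z + Ln z"
          unfolding bb[symmetric] Ln by (simp add: algebra_simps)
        then show ?thesis by (simp add: algebra_simps)
      qed
      moreover have "exp (- Ln z) = 1 / z" using z0 by (simp add: exp_minus inverse_eq_divide)
      ultimately have "exp (M * z * L + (M * z - (M * z + of_real (b + 1) - 1/2) * Ln (M * z))) = P * exp (- of_real (b + 1/2) * L) / z"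
        by (simp only: exp_add P_def) simp
      then show ?thesis unfolding rGamma_stirling_quot by (simp only: exp_add mult.left_commute[of "exp _" "stirling_quot _ _"])
    qed
    have x1: "exp (x * L) * exp (- x * L) = 1" for x
      by (simp flip: exp_add)
    have A0': "of_real A0 * exp (- of_real (b - 1/2) * L) = S / S ^ m"
      unfolding A0 mult.assoc x1 by simp
    have A1': "A1 * exp (- of_real (b + 1/2) * L) = S * k / S ^ m"
      unfolding A1_def times_divide_eq_left mult.assoc x1 by simp
    have "rGamma (z + of_real \<beta>) ^ m - exp (M * z * L) * (of_real A0 * rGamma (M * z + of_real b) + A1 * rGamma (M * z + of_real (b + 1)))
       = rGamma (z + of_real \<beta>) ^ m - (of_real A0 * (exp (M * z * L) * rGamma (M * z + of_real b)) + A1 * (exp (M * z * L) * rGamma (M * z + of_real (b + 1))))"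
      by (simp add: algebra_simps)
    also have "\<dots> = P * (stirling_quot \<beta> z ^ m - (of_real A0 * exp (- of_real (b - 1/2) * L)) * stirling_quot b (M * z)
        - (A1 * exp (- of_real (b + 1/2) * L)) * stirling_quot (b + 1) (M * z) / z)"
      unfolding g1 g2 g3 by (simp add: algebra_simps)
    also have "\<dots> = P * (T z / S ^ m)"
      unfolding A0' A1' T_def using S by (simp add: field_simps power_mult_distrib)
    finally show ?case unfolding a_def[symmetric] b_def[symmetric] az az2 z_def[symmetric] mM P_def by (simp add: mult.commute)
  qed
  then show ?thesis using that by (simp add: algebra_simps)
qed

section \<open>Exponential series as integrals\<close>

definition exp_series :: "(complex \<Rightarrow> complex) \<Rightarrow> complex \<Rightarrow> complex" where
  "exp_series h l = (\<Sum>k. exp (l * of_nat k) * h (of_nat k))"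

lemma exp_series_sums:
  assumes dec: "strip_decay h 0 0 \<kappa>"
  shows "(\<lambda>k. exp (l * of_nat k) * h (of_nat k)) sums exp_series h l"
proof -
  obtain C where C: "C \<ge> 0"
    "\<And>s. 0 \<le> Re s \<Longrightarrow> norm (h s) \<le> C * (1 + norm s) powr (- 0) * exp (\<kappa> * \<bar>Im s\<bar> - (Re l + 1) * Re s)"
    using strip_decayD[OF dec, of "Re l + 1"] by blast
  have "summable (\<lambda>k. exp (l * of_nat k) * h (of_nat k))"
  proof (rule summable_comparison_test')
    show "summable (\<lambda>k. C * exp (- 1) ^ k)" by (intro summable_mult summable_geometric) simp
    fix k :: nat
    have "norm (h (of_nat k)) \<le> C * exp (- (Re l + 1) * real k)"
      using C(2)[of "of_nat k"] by (simp add: algebra_simps)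
    then have "norm (exp (l * of_nat k) * h (of_nat k)) \<le> exp (Re l * real k) * (C * exp (- (Re l + 1) * real k))"
      by (simp add: norm_mult mult_left_mono)
    also have "\<dots> = C * exp (Re l * real k + - (Re l + 1) * real k)" unfolding exp_add by (simp only: mult_ac)
    also have "Re l * real k + - (Re l + 1) * real k = real k * (- 1)" by (simp add: algebra_simps)
    also have "exp (real k * (- 1)) = exp (- 1 :: real) ^ k" by (rule exp_of_nat_mult)
    finally show "norm (exp (l * of_nat k) * h (of_nat k)) \<le> C * exp (- 1) ^ k" .
  qed
  then show ?thesis unfolding exp_series_def by (rule summable_sums)
qed

lemma sum_int_interval:
  fixes f :: "int \<Rightarrow> 'a :: comm_monoid_add"
  shows "(\<Sum>k\<in>{- int K..int n}. f k) = (\<Sum>k=1..K. f (- int k)) + (\<Sum>k\<le>n. f (int k))"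
proof -
  have "{- int K..int n} = (\<lambda>k. - int k) ` {1..K} \<union> int ` {..n}"
  proof (intro equalityI subsetI)
    fix k assume k: "k \<in> {- int K..int n}"
    show "k \<in> (\<lambda>k. - int k) ` {1..K} \<union> int ` {..n}"
    proof (cases "k \<ge> 0")
      case True
      then show ?thesis using k by (intro UnI2 image_eqI[of _ _ "nat k"]) auto
    next
      case False
      then show ?thesis using k by (intro UnI1 image_eqI[of _ _ "nat (- k)"]) auto
    qed
  qed auto
  moreover have "(\<lambda>k. - int k) ` {1..K} \<inter> int ` {..n} = {}" by auto
  ultimately have "(\<Sum>k\<in>{- int K..int n}. f k) = (\<Sum>k\<in>(\<lambda>k. - int k) ` {1..K}. f k) + (\<Sum>k\<in>int ` {..n}. f k)"
    by (simp add: sum.union_disjoint)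
  also have "(\<Sum>k\<in>(\<lambda>k. - int k) ` {1..K}. f k) = (\<Sum>k=1..K. f (- int k))"
    by (subst sum.reindex) (auto simp: inj_on_def)
  also have "(\<Sum>k\<in>int ` {..n}. f k) = (\<Sum>k\<le>n. f (int k))"
    by (subst sum.reindex) (auto simp: inj_on_def)
  finally show ?thesis .
qed

text \<open>The Abel-Plana sum runs over c < k <= X, the series and its algebraic correction over -K
  <= k <= X. An index in only one of the ranges is at most c or at most -(K + 1), which for Re l >=
  0 gives the two error terms; c may lie on either side of -K.\<close>

lemma exp_series_integral:
  fixes K :: nat
  assumes h: "h holomorphic_on UNIV" and dec: "\<And>c. strip_decay h c 0 \<kappa>" and kap: "\<kappa> < pi" and c: "c \<notin> \<int>"
  obtains C where "C > 0"
    "\<And>l. \<bar>Im l\<bar> \<le> pi \<Longrightarrow> 0 \<le> Re l \<Longrightarrow> \<forall>\<^sub>F X in at_top.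
       norm (exp_series h l + (\<Sum>k=1..K. exp (- (l * of_nat k)) * h (- of_nat k))
             - contour_integral (linepath (of_real c) (of_real X)) (\<lambda>s. exp (l * s) * h s))
       \<le> C * (exp (c * Re l) + exp (- (real K + 1) * Re l))"
proof -
  obtain C0 where C0: "C0 > 0"
    "\<And>l. \<bar>Im l\<bar> \<le> pi \<Longrightarrow> \<forall>\<^sub>F X in at_top.
       norm ((\<Sum>k\<in>{k::int. c < k \<and> k \<le> X}. exp (l * of_int k) * h (of_int k))
             - contour_integral (linepath (of_real c) (of_real X)) (\<lambda>s. exp (l * s) * h s)) \<le> C0 * exp (c * Re l)"
    using abel_plana_bound[OF h dec kap c] by blast
  \<comment> \<open>All indices belonging to only one of the two ranges lie between -N and N, so
    \<open>H\<close> controls their coefficients independently of X and l.\<close>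
  define N where "N = \<lceil>\<bar>c\<bar>\<rceil> + int K + 1"
  define H where "H = (\<Sum>k\<in>{- N..N}. norm (h (of_int k)))"
  have H: "H \<ge> 0" by (simp add: H_def sum_nonneg)
  have "\<forall>\<^sub>F X in at_top.
       norm (exp_series h l + (\<Sum>k=1..K. exp (- (l * of_nat k)) * h (- of_nat k))
             - contour_integral (linepath (of_real c) (of_real X)) (\<lambda>s. exp (l * s) * h s))
       \<le> (C0 + 2 * H + 1) * (exp (c * Re l) + exp (- (real K + 1) * Re l))"
    if l: "\<bar>Im l\<bar> \<le> pi" "0 \<le> Re l" for l
  proof -
    define t where "t = (\<lambda>k::int. exp (l * of_int k) * h (of_int k))"
    define S where "S = (\<lambda>n. \<Sum>k\<le>n. t (int k))"
    have "(\<lambda>n. \<Sum>k\<le>n. exp (l * of_nat k) * h (of_nat k)) \<longlonglongrightarrow> exp_series h l"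
      using exp_series_sums[OF dec] unfolding sums_def_le .
    then have "S \<longlonglongrightarrow> exp_series h l" by (simp add: S_def t_def)
    moreover have "filterlim (\<lambda>X::real. nat \<lfloor>X\<rfloor>) sequentially at_top"
      by (intro filterlim_compose[OF filterlim_nat_sequentially filterlim_floor_sequentially])
    ultimately have "((\<lambda>X::real. S (nat \<lfloor>X\<rfloor>)) \<longlongrightarrow> exp_series h l) at_top" by (rule filterlim_compose)
    then have "\<forall>\<^sub>F X::real in at_top. dist (S (nat \<lfloor>X\<rfloor>)) (exp_series h l) < exp (c * Re l)"
      by (rule tendstoD) simp
    moreover have "\<forall>\<^sub>F X in at_top. X \<ge> max 0 (real_of_int N)" by (rule eventually_ge_at_top)
    ultimately show ?thesis using C0(2)[OF l(1)]
    proof eventually_elim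
      case (elim X)
      define A where "A = {k::int. c < k \<and> k \<le> X}"
      define B where "B = {- int K..int (nat \<lfloor>X\<rfloor>)}"
      have X: "X \<ge> 0" "X \<ge> N" using elim by auto
      have nX: "int (nat \<lfloor>X\<rfloor>) = \<lfloor>X\<rfloor>" using X by simp
      have finA: "finite A"
        by (rule finite_subset[of _ "{\<lfloor>c\<rfloor>..\<lfloor>X\<rfloor>}"]) (auto simp: A_def le_floor_iff, linarith)
      have finB: "finite B" by (simp add: B_def)
      have cN: "\<bar>c\<bar> \<le> of_int N - real K - 1" unfolding N_def by linarith
      have AB: "k \<in> {- N..N} \<and> real_of_int k \<le> - (real K + 1)" if "k \<in> A - B" for k
      proof -
        have k: "c < k" "k \<le> \<lfloor>X\<rfloor>" "\<not> (- int K \<le> k)" using that nX by (auto simp: A_def B_def le_floor_iff)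
        then have "k \<le> - int K - 1" by simp
        then have "real_of_int k \<le> - (real K + 1)" by linarith
        moreover have "- N \<le> k" using k(1) cN by linarith
        moreover have "k \<le> N" using \<open>k \<le> - int K - 1\<close> cN by linarith
        ultimately show ?thesis by simp
      qed
      have BA: "k \<in> {- N..N} \<and> real_of_int k \<le> c" if "k \<in> B - A" for k
      proof -
        have k: "- int K \<le> k" "k \<le> \<lfloor>X\<rfloor>" "\<not> (c < k)" using that nX by (auto simp: A_def B_def le_floor_iff)
        moreover have "- N \<le> k" using k(1) cN by linarith
        moreover have "k \<le> N" using k(3) cN by linarith
        ultimately show ?thesis by simp
      qed
      have part: "norm (\<Sum>k\<in>D. t k) \<le> H * exp (x * Re l)" if "\<And>k. k \<in> D \<Longrightarrow> k \<in> {- N..N} \<and> real_of_int k \<le> x" for D x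
      proof -
        have "norm (\<Sum>k\<in>D. t k) \<le> (\<Sum>k\<in>D. exp (x * Re l) * norm (h (of_int k)))"
        proof (rule sum_norm_le)
          fix k assume "k \<in> D"
          then have "real_of_int k * Re l \<le> x * Re l" using that l(2) by (intro mult_right_mono) auto
          then show "norm (t k) \<le> exp (x * Re l) * norm (h (of_int k))"
            unfolding t_def norm_mult by (intro mult_right_mono) (auto simp: mult.commute)
        qed
        also have "\<dots> \<le> (\<Sum>k\<in>{- N..N}. exp (x * Re l) * norm (h (of_int k)))"
          using that by (intro sum_mono2) auto
        finally show ?thesis by (simp add: H_def sum_distrib_left mult.commute)
      qed
      have "sum t A = sum t (A \<inter> B) + sum t (A - B)" "sum t B = sum t (A \<inter> B) + sum t (B - A)"
        using sum.Int_Diff[OF finA, of t B] sum.Int_Diff[OF finB, of t A] by (simp_all add: Int_commute)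
      then have "sum t B - sum t A = sum t (B - A) - sum t (A - B)" by simp
      then have d1: "norm (sum t B - sum t A) \<le> H * exp (c * Re l) + H * exp (- (real K + 1) * Re l)"
      proof -
        have "norm (sum t (B - A)) \<le> H * exp (c * Re l)" "norm (sum t (A - B)) \<le> H * exp (- (real K + 1) * Re l)"
          by (rule part, erule BA) (rule part, erule AB)
        then show ?thesis using \<open>sum t B - sum t A = sum t (B - A) - sum t (A - B)\<close>
            norm_triangle_ineq4[of "sum t (B - A)" "sum t (A - B)"] by simp
      qed
      define Kt where "Kt = (\<Sum>k=1..K. exp (- (l * of_nat k)) * h (- of_nat k))"
      have B: "sum t B = Kt + S (nat \<lfloor>X\<rfloor>)"
        unfolding B_def sum_int_interval S_def Kt_def t_def by simp
      define J where "J = contour_integral (linepath (of_real c) (of_real X)) (\<lambda>s. exp (l * s) * h s)"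
      have d2: "norm (sum t A - J) \<le> C0 * exp (c * Re l)" using elim(3) by (simp add: A_def t_def J_def)
      have d3: "norm (exp_series h l - S (nat \<lfloor>X\<rfloor>)) \<le> exp (c * Re l)"
        using elim(1) by (simp add: dist_norm norm_minus_commute)
      have "exp_series h l + Kt - J = (exp_series h l - S (nat \<lfloor>X\<rfloor>)) + (sum t B - sum t A) + (sum t A - J)"
        by (simp add: B)
      then have "norm (exp_series h l + Kt - J) \<le> norm (exp_series h l - S (nat \<lfloor>X\<rfloor>)) + norm (sum t B - sum t A) + norm (sum t A - J)"
        by (simp only: order_trans[OF norm_triangle_ineq add_right_mono[OF norm_triangle_ineq]])
      also have "\<dots> \<le> exp (c * Re l) + (H * exp (c * Re l) + H * exp (- (real K + 1) * Re l)) + C0 * exp (c * Re l)"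
        by (intro add_mono d1 d2 d3)
      also have "\<dots> \<le> (C0 + 2 * H + 1) * (exp (c * Re l) + exp (- (real K + 1) * Re l))"
      proof -
        have "(C0 + 2 * H + 1) * (x + y) = (x + (H * x + H * y) + C0 * x) + (C0 * y + H * x + H * y + y)" for x y
          by (simp add: algebra_simps)
        moreover have "0 \<le> C0 * exp (- (real K + 1) * Re l) + H * exp (c * Re l) + H * exp (- (real K + 1) * Re l) + exp (- (real K + 1) * Re l)"
          using C0(1) H by (intro add_nonneg_nonneg mult_nonneg_nonneg) auto
        ultimately show ?thesis by simp
      qed
      finally show ?case by (simp add: Kt_def J_def)
    qed
  qed
  moreover have "C0 + 2 * H + 1 > 0" using C0(1) H by simp
  ultimately show ?thesis using that by blast
qed

lemma contour_integral_linepath_affine: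
  fixes p q A B :: real
  assumes "A \<noteq> 0"
  shows "contour_integral (linepath (of_real p) (of_real q)) (\<lambda>s. f (of_real A * s + of_real B))
    = contour_integral (linepath (of_real (A * p + B)) (of_real (A * q + B))) f / of_real A"
proof -
  have l: "complex_of_real A * linepath (of_real p) (of_real q) x + of_real B = linepath (of_real (A * p + B)) (of_real (A * q + B)) x" for x
    by (simp add: linepath_def scaleR_conv_of_real algebra_simps)
  have "contour_integral (linepath (of_real p) (of_real q)) (\<lambda>s. f (of_real A * s + of_real B))
     = integral {0..1} (\<lambda>x. (f (linepath (of_real (A * p + B)) (of_real (A * q + B)) x) * of_real (A * (q - p))) * (1 / of_real A))"
    unfolding contour_integral_integral l using assms by simp
  also have "\<dots> = integral {0..1} (\<lambda>x. f (linepath (of_real (A * p + B)) (of_real (A * q + B)) x) * of_real (A * (q - p))) * (1 / of_real A)"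
    by (rule integral_mult_left)
  also have "\<dots> = contour_integral (linepath (of_real (A * p + B)) (of_real (A * q + B))) f / of_real A"
    unfolding contour_integral_integral by (simp add: algebra_simps)
  finally show ?thesis .
qed

text \<open>The true rate is pi/2; 3 pi / 4 lies strictly between it and pi, leaving room to discard
  the power and still to apply Abel-Plana.\<close>

lemma strip_decay_rGamma_plus1: "strip_decay (\<lambda>s. rGamma (s + 1)) c 0 (3 * pi / 4)"
proof -
  have "stirling_type (\<lambda>s. rGamma (s + 1)) 1 0 (1/2)"
    using stirling_type_rGamma_power[of 1 1 1] by simp
  then have "strip_decay (\<lambda>s. rGamma (s + 1)) c (1/2 + 1 * c) (1 * pi / 2)"
    by (intro stirling_type_imp_strip_decay) (auto intro!: holomorphic_intros)
  then show ?thesis by (rule strip_decay_weaken) simp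
qed

text \<open>The coefficient 1/Gamma(s + 1) vanishes at the negative integers, so no algebraic
  correction appears however far left c lies.\<close>

lemma integral_rGamma_exp:
  assumes c: "c \<notin> \<int>"
  obtains C where "C > 0"
    "\<And>l. \<bar>Im l\<bar> \<le> pi \<Longrightarrow> 0 \<le> Re l \<Longrightarrow> \<forall>\<^sub>F X in at_top.
       norm (contour_integral (linepath (of_real c) (of_real X)) (\<lambda>s. exp (l * s) * rGamma (s + 1)) - exp (exp l)) \<le> C * exp (c * Re l)"
proof -
  \<comment> \<open>Large enough that -(K + 1) <= c, so that the second error term of
    \<open>exp_series_integral\<close> is dominated by the first.\<close>
  define K where "K = nat \<lceil>\<bar>c\<bar>\<rceil>"
  have K: "- (real K + 1) \<le> c" unfolding K_def by linarith
  obtain C where C: "C > 0" "\<And>l. \<bar>Im l\<bar> \<le> pi \<Longrightarrow> 0 \<le> Re l \<Longrightarrow> \<forall>\<^sub>F X in at_top.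
       norm (exp_series (\<lambda>s. rGamma (s + 1)) l + (\<Sum>k=1..K. exp (- (l * of_nat k)) * rGamma (- of_nat k + 1))
             - contour_integral (linepath (of_real c) (of_real X)) (\<lambda>s. exp (l * s) * rGamma (s + 1)))
       \<le> C * (exp (c * Re l) + exp (- (real K + 1) * Re l))"
    by (rule exp_series_integral[of "\<lambda>s. rGamma (s + 1)" "3 * pi / 4" c K])
       (auto intro!: strip_decay_rGamma_plus1 holomorphic_intros c)
  have es: "exp_series (\<lambda>s. rGamma (s + 1)) l = exp (exp l)" for l
  proof -
    have "rGamma (of_nat k + 1 :: complex) = 1 / fact k" for k
      by (simp add: rGamma_inverse_Gamma inverse_eq_divide add.commute flip: Gamma_fact)
    then have "(\<lambda>k. exp (l * of_nat k) * rGamma (of_nat k + 1)) = (\<lambda>k. exp l ^ k /\<^sub>R fact k)"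
      by (intro ext) (simp add: scaleR_conv_of_real exp_of_nat2_mult field_simps)
    then show ?thesis unfolding exp_series_def by (simp add: exp_def)
  qed
  have z: "rGamma (- of_nat k + 1 :: complex) = 0" if "k \<ge> 1" for k
  proof -
    have "(- of_nat k + 1 :: complex) = - of_nat (k - 1)" using that by (simp add: of_nat_diff)
    then show ?thesis by (simp only: rGamma_eq_zero_iff) simp
  qed
  have "\<forall>\<^sub>F X in at_top.
       norm (contour_integral (linepath (of_real c) (of_real X)) (\<lambda>s. exp (l * s) * rGamma (s + 1)) - exp (exp l)) \<le> 2 * C * exp (c * Re l)"
    if l: "\<bar>Im l\<bar> \<le> pi" "0 \<le> Re l" for l
    using C(2)[OF l]
  proof eventually_elim
    case (elim X)
    have "(\<Sum>k=1..K. exp (- (l * of_nat k)) * rGamma (- of_nat k + 1)) = 0"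
      by (intro sum.neutral ballI) (subst z, auto)
    moreover have "exp (- (real K + 1) * Re l) \<le> exp (c * Re l)"
      using mult_right_mono[OF K l(2)] by simp
    then have "C * (exp (c * Re l) + exp (- (real K + 1) * Re l)) \<le> C * (exp (c * Re l) + exp (c * Re l))"
      using C(1) by (intro mult_left_mono) auto
    ultimately show ?case using elim by (simp add: es norm_minus_commute algebra_simps)
  qed
  then show ?thesis using C(1) by (intro that[of "2 * C"]) auto
qed

text \<open>The \<open>A1\<close> term is integrated exactly as well, by z = a s + b. Its value is
  smaller than the main term only by a factor exp(-L), where exp(L) = mm exp(l/a); in modulus it is
  the last summand of the error.\<close>

lemma main_term_integral:
  fixes a b c A0 mm :: real and A1 :: complex
  assumes a: "a > 0" and mm: "mm \<ge> 1" and c1: "a * c + b - 1 \<notin> \<int>"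
  obtains C where "C > 0"
    "\<And>l. 0 \<le> Im l \<Longrightarrow> Im l \<le> a * pi \<Longrightarrow> 0 \<le> Re l \<Longrightarrow> \<forall>\<^sub>F X in at_top.
       norm (contour_integral (linepath (of_real c) (of_real X)) (\<lambda>s. exp (l * s) * (exp (of_real (a * ln mm) * s)
           * (of_real A0 * rGamma (of_real a * s + of_real b) + A1 * rGamma (of_real a * s + of_real (b + 1)))))
         - of_real (A0 / a) * exp ((l / of_real a + of_real (ln mm)) * of_real (1 - b) + exp (l / of_real a + of_real (ln mm))))
       \<le> C * (exp (c * Re l) + exp (- b * (Re l / a + ln mm) + exp (Re l / a + ln mm) * cos (Im l / a)))"
proof -
  define c' where "c' = a * c + b - 1"
  have c2: "c' + 1 \<notin> \<int>"
  proof
    assume "c' + 1 \<in> \<int>"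
    then have "c' + 1 - 1 \<in> \<int>" by (rule Ints_diff) simp
    then show False using c1 by (simp add: c'_def)
  qed
  obtain C1 where C1: "C1 > 0" "\<And>l. \<bar>Im l\<bar> \<le> pi \<Longrightarrow> 0 \<le> Re l \<Longrightarrow> \<forall>\<^sub>F X in at_top.
       norm (contour_integral (linepath (of_real c') (of_real X)) (\<lambda>s. exp (l * s) * rGamma (s + 1)) - exp (exp l)) \<le> C1 * exp (c' * Re l)"
    using integral_rGamma_exp[OF c1[folded c'_def]] by blast
  obtain C2 where C2: "C2 > 0" "\<And>l. \<bar>Im l\<bar> \<le> pi \<Longrightarrow> 0 \<le> Re l \<Longrightarrow> \<forall>\<^sub>F X in at_top.
       norm (contour_integral (linepath (of_real (c' + 1)) (of_real X)) (\<lambda>s. exp (l * s) * rGamma (s + 1)) - exp (exp l)) \<le> C2 * exp ((c' + 1) * Re l)"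
    using integral_rGamma_exp[OF c2] by blast
  define E where "E = exp (a * c * ln mm)"
  define C where "C = \<bar>A0\<bar> / a * C1 * E + norm A1 / a * C2 * E + norm A1 / a + 1"
  have "\<forall>\<^sub>F X in at_top.
       norm (contour_integral (linepath (of_real c) (of_real X)) (\<lambda>s. exp (l * s) * (exp (of_real (a * ln mm) * s)
           * (of_real A0 * rGamma (of_real a * s + of_real b) + A1 * rGamma (of_real a * s + of_real (b + 1)))))
         - of_real (A0 / a) * exp ((l / of_real a + of_real (ln mm)) * of_real (1 - b) + exp (l / of_real a + of_real (ln mm))))
       \<le> C * (exp (c * Re l) + exp (- b * (Re l / a + ln mm) + exp (Re l / a + ln mm) * cos (Im l / a)))"
    if l: "0 \<le> Im l" "Im l \<le> a * pi" "0 \<le> Re l" for l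
  proof -
    define L where "L = l / of_real a + of_real (ln mm)"
    have ReL: "Re L = Re l / a + ln mm" and ImL: "Im L = Im l / a"
      by (simp_all add: L_def Re_divide_of_real Im_divide_of_real)
    \<comment> \<open>The hypotheses 0 <= Im l <= a pi are what the exponential series in exp(L)
      requires after the substitution; mm >= 1 keeps Re L nonnegative.\<close>
    have L: "\<bar>Im L\<bar> \<le> pi" "0 \<le> Re L" using l a mm by (auto simp: ReL ImL field_simps)
    have lim1: "filterlim (\<lambda>X. a * X + (b - 1)) at_top at_top" "filterlim (\<lambda>X. a * X + b) at_top at_top"
      using a by real_asymp+
    let ?h = "\<lambda>s. exp (L * s) * rGamma (s + 1)"
    have ev1: "\<forall>\<^sub>F X in at_top. norm (contour_integral (linepath (of_real c') (of_real (a * X + (b - 1)))) ?h - exp (exp L)) \<le> C1 * exp (c' * Re L)"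
      using C1(2)[OF L] lim1(1) by (rule eventually_compose_filterlim)
    have ev2: "\<forall>\<^sub>F X in at_top. norm (contour_integral (linepath (of_real (c' + 1)) (of_real (a * X + b))) ?h - exp (exp L)) \<le> C2 * exp ((c' + 1) * Re L)"
      using C2(2)[OF L] lim1(2) by (rule eventually_compose_filterlim)
    show ?thesis using ev1 ev2
    proof eventually_elim
      case (elim X)
      let ?P = "linepath (complex_of_real c) (of_real X)"
      define J1 where "J1 = contour_integral (linepath (of_real c') (of_real (a * X + (b - 1)))) ?h"
      define J2 where "J2 = contour_integral (linepath (of_real (c' + 1)) (of_real (a * X + b))) ?h"
      have g1: "exp (l * s) * exp (of_real (a * ln mm) * s) * rGamma (of_real a * s + of_real b)
          = exp (L * of_real (1 - b)) * ?h (of_real a * s + of_real (b - 1))" for s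
      proof -
        have "l * s + of_real (a * ln mm) * s = L * of_real (1 - b) + L * (of_real a * s + of_real (b - 1))"
          using a by (simp add: L_def field_simps)
        then have "exp (l * s) * exp (of_real (a * ln mm) * s) = exp (L * of_real (1 - b)) * exp (L * (of_real a * s + of_real (b - 1)))"
          by (simp only: exp_add[symmetric])
        then show ?thesis by simp
      qed
      have g2: "exp (l * s) * exp (of_real (a * ln mm) * s) * rGamma (of_real a * s + of_real (b + 1))
          = exp (L * of_real (- b)) * ?h (of_real a * s + of_real b)" for s
      proof -
        have "l * s + of_real (a * ln mm) * s = L * of_real (- b) + L * (of_real a * s + of_real b)"
          using a by (simp add: L_def field_simps)
        then have "exp (l * s) * exp (of_real (a * ln mm) * s) = exp (L * of_real (- b)) * exp (L * (of_real a * s + of_real b))"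
          by (simp only: exp_add[symmetric])
        then show ?thesis by (simp add: add.assoc)
      qed
      have fun_eq: "exp (l * s) * (exp (of_real (a * ln mm) * s)
           * (of_real A0 * rGamma (of_real a * s + of_real b) + A1 * rGamma (of_real a * s + of_real (b + 1))))
         = (of_real A0 * exp (L * of_real (1 - b))) * ?h (of_real a * s + of_real (b - 1)) + (A1 * exp (L * of_real (- b))) * ?h (of_real a * s + of_real b)" for s
        using g1[of s] g2[of s] by (simp only: distrib_left mult_ac)
      have int: "(\<lambda>s. u * ?h (of_real a * s + of_real v)) contour_integrable_on ?P" for u v
        by (intro contour_integrable_continuous_linepath holomorphic_on_imp_continuous_on) (intro holomorphic_intros)
      have lm: "contour_integral ?P (\<lambda>s. u * ?h (of_real a * s + of_real v)) = u * contour_integral ?P (\<lambda>s. ?h (of_real a * s + of_real v))" for u v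
        using int[of 1] by (intro contour_integral_lmul) simp
      have "contour_integral ?P (\<lambda>s. exp (l * s) * (exp (of_real (a * ln mm) * s)
           * (of_real A0 * rGamma (of_real a * s + of_real b) + A1 * rGamma (of_real a * s + of_real (b + 1)))))
        = contour_integral ?P (\<lambda>s. (of_real A0 * exp (L * of_real (1 - b))) * ?h (of_real a * s + of_real (b - 1))) + contour_integral ?P (\<lambda>s. (A1 * exp (L * of_real (- b))) * ?h (of_real a * s + of_real b))"
        unfolding fun_eq by (intro contour_integral_add int)
      also have "contour_integral ?P (\<lambda>s. (of_real A0 * exp (L * of_real (1 - b))) * ?h (of_real a * s + of_real (b - 1))) + contour_integral ?P (\<lambda>s. (A1 * exp (L * of_real (- b))) * ?h (of_real a * s + of_real b))
         = (of_real A0 * exp (L * of_real (1 - b))) * contour_integral ?P (\<lambda>s. ?h (of_real a * s + of_real (b - 1))) + (A1 * exp (L * of_real (- b))) * contour_integral ?P (\<lambda>s. ?h (of_real a * s + of_real b))"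
        by (simp only: lm)
      also have "contour_integral ?P (\<lambda>s. ?h (of_real a * s + of_real (b - 1))) = J1 / of_real a"
        using contour_integral_linepath_affine[of a c X ?h "b - 1"] a by (simp add: J1_def c'_def add_diff_eq)
      also have "contour_integral ?P (\<lambda>s. ?h (of_real a * s + of_real b)) = J2 / of_real a"
        using contour_integral_linepath_affine[of a c X ?h b] a by (simp add: J2_def c'_def)
      finally have cc: "contour_integral ?P (\<lambda>s. exp (l * s) * (exp (of_real (a * ln mm) * s)
           * (of_real A0 * rGamma (of_real a * s + of_real b) + A1 * rGamma (of_real a * s + of_real (b + 1)))))
        = (of_real A0 * exp (L * of_real (1 - b))) * (J1 / of_real a) + (A1 * exp (L * of_real (- b))) * (J2 / of_real a)" .
      have total: "contour_integral ?P (\<lambda>s. exp (l * s) * (exp (of_real (a * ln mm) * s)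
           * (of_real A0 * rGamma (of_real a * s + of_real b) + A1 * rGamma (of_real a * s + of_real (b + 1)))))
         - of_real (A0 / a) * exp (L * of_real (1 - b) + exp L)
         = of_real (A0 / a) * exp (L * of_real (1 - b)) * (J1 - exp (exp L)) + (A1 / of_real a) * exp (L * of_real (- b)) * (J2 - exp (exp L))
          + (A1 / of_real a) * exp (L * of_real (- b)) * exp (exp L)"
        unfolding cc exp_add[of "L * of_real (1 - b)" "exp L"] using a by (simp add: field_simps)
      have n1: "norm (exp (L * of_real y)) = exp (y * Re L)" for y by (simp add: mult.commute)
      have ec: "exp ((1 - b) * Re L) * exp (c' * Re L) = E * exp (c * Re l)" "exp ((- b) * Re L) * exp ((c' + 1) * Re L) = E * exp (c * Re l)"
        unfolding E_def ReL c'_def exp_add[symmetric] using a by (simp_all add: field_simps)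
      have nL: "norm (exp (exp L)) = exp (exp (Re L) * cos (Im L))" by (simp add: Re_exp)
      have na: "norm (complex_of_real (A0 / a)) = \<bar>A0\<bar> / a" "norm (A1 / of_real a) = norm A1 / a" using a by (simp_all add: norm_divide)
      have "norm (of_real (A0 / a) * exp (L * of_real (1 - b)) * (J1 - exp (exp L)) + (A1 / of_real a) * exp (L * of_real (- b)) * (J2 - exp (exp L))
          + (A1 / of_real a) * exp (L * of_real (- b)) * exp (exp L))
         \<le> norm (of_real (A0 / a) * exp (L * of_real (1 - b)) * (J1 - exp (exp L))) + norm ((A1 / of_real a) * exp (L * of_real (- b)) * (J2 - exp (exp L)))
          + norm ((A1 / of_real a) * exp (L * of_real (- b)) * exp (exp L))"
        by (rule order_trans[OF norm_triangle_ineq add_right_mono[OF norm_triangle_ineq]])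
      also have "\<dots> \<le> \<bar>A0\<bar> / a * exp ((1 - b) * Re L) * (C1 * exp (c' * Re L)) + norm A1 / a * exp ((- b) * Re L) * (C2 * exp ((c' + 1) * Re L))
          + norm A1 / a * exp ((- b) * Re L) * exp (exp (Re L) * cos (Im L))"
        unfolding norm_mult n1 na nL using elim a unfolding J1_def J2_def
        by (intro add_mono mult_left_mono order_refl) auto
      also have "\<dots> = (\<bar>A0\<bar> / a * C1 * E + norm A1 / a * C2 * E) * exp (c * Re l) + norm A1 / a * exp (- b * Re L + exp (Re L) * cos (Im L))"
      proof -
        have m1: "\<bar>A0\<bar> / a * exp ((1 - b) * Re L) * (C1 * exp (c' * Re L)) = \<bar>A0\<bar> / a * C1 * E * exp (c * Re l)"
          using ec(1) by (metis (no_types, opaque_lifting) mult.assoc mult.left_commute)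
        have m2: "norm A1 / a * exp ((- b) * Re L) * (C2 * exp ((c' + 1) * Re L)) = norm A1 / a * C2 * E * exp (c * Re l)"
          using ec(2) by (metis (no_types, opaque_lifting) mult.assoc mult.left_commute)
        have m3: "norm A1 / a * exp ((- b) * Re L) * exp (exp (Re L) * cos (Im L)) = norm A1 / a * exp (- b * Re L + exp (Re L) * cos (Im L))"
          by (simp only: exp_add mult.assoc)
        show ?thesis unfolding m1 m2 m3 by (simp only: distrib_right)
      qed
      also have "\<dots> \<le> C * exp (c * Re l) + C * exp (- b * Re L + exp (Re L) * cos (Im L))"
      proof -
        have "0 \<le> \<bar>A0\<bar> / a * C1 * E" "0 \<le> norm A1 / a * C2 * E" "0 \<le> norm A1 / a"
          using a C1(1) C2(1) by (auto simp: E_def)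
        then have "\<bar>A0\<bar> / a * C1 * E + norm A1 / a * C2 * E \<le> C" "norm A1 / a \<le> C"
          unfolding C_def by linarith+
        then show ?thesis by (intro add_mono mult_right_mono) auto
      qed
      finally show ?case unfolding total[symmetric] L_def[symmetric] ReL[symmetric] ImL[symmetric] by (simp add: distrib_left)
    qed
  qed
  moreover have "C > 0" unfolding C_def E_def using a C1(1) C2(1) by (intro add_nonneg_pos add_nonneg_nonneg) auto
  ultimately show ?thesis using that by blast
qed

section \<open>Asymptotics of the Le Roy type function\<close>

definition leroy_coeff :: "real \<Rightarrow> real \<Rightarrow> nat \<Rightarrow> complex \<Rightarrow> complex" where
  "leroy_coeff \<alpha> \<beta> m s = rGamma (of_real \<alpha> * s + of_real \<beta>) ^ m"

lemma holomorphic_leroy_coeff: "leroy_coeff \<alpha> \<beta> m holomorphic_on A"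
  unfolding leroy_coeff_def by (intro holomorphic_intros)

lemma leroy_coeff_of_real: "leroy_coeff \<alpha> \<beta> m (of_real x) = of_real (rGamma (\<alpha> * x + \<beta>) ^ m)"
  unfolding leroy_coeff_def by (simp flip: rGamma_complex_of_real)

lemma strip_decay_leroy_coeff:
  assumes "\<alpha> > 0" "m \<ge> 1" "\<kappa> > \<alpha> * real m * pi / 2"
  shows "strip_decay (leroy_coeff \<alpha> \<beta> m) c \<mu> \<kappa>"
proof -
  have "stirling_type (leroy_coeff \<alpha> \<beta> m) (\<alpha> * real m) (- ln \<alpha>) (real m * \<beta> - (real m - 1) / 2 - 1/2)"
    unfolding leroy_coeff_def by (rule stirling_type_rGamma_power[OF assms(1)])
  then have "strip_decay (leroy_coeff \<alpha> \<beta> m) c (real m * \<beta> - (real m - 1) / 2 - 1/2 + \<alpha> * real m * c) (\<alpha> * real m * pi / 2)"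
    using assms by (intro stirling_type_imp_strip_decay holomorphic_leroy_coeff) auto
  then show ?thesis using assms(3) by (rule strip_decay_weaken)
qed

lemma Fm_altdef: "Fm \<alpha> \<beta> m z = (\<Sum>k. z ^ k * rGamma (\<alpha> * real k + \<beta>) ^ m)"
  unfolding Fm_def by (simp add: rGamma_inverse_Gamma power_inverse divide_inverse)

lemma exp_Complex_ln_pi: "t > 0 \<Longrightarrow> exp (Complex (ln t) pi) = - of_real t"
  by (simp add: exp_eq_polar cis_pi)

lemma exp_series_leroy_neg:
  assumes al: "\<alpha> > 0" and m: "m \<ge> 1" and t: "t > 0"
  shows "exp_series (leroy_coeff \<alpha> \<beta> m) (Complex (ln t) pi) = of_real (Fm \<alpha> \<beta> m (- t))"
proof -
  define u where "u = (\<lambda>k. (- t) ^ k * rGamma (\<alpha> * real k + \<beta>) ^ m)"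
  have dec: "strip_decay (leroy_coeff \<alpha> \<beta> m) 0 0 (\<alpha> * real m * pi / 2 + 1)"
    by (intro strip_decay_leroy_coeff al m) simp
  have "exp (Complex (ln t) pi * of_nat k) * leroy_coeff \<alpha> \<beta> m (of_nat k) = of_real (u k)" for k
    unfolding u_def exp_of_nat2_mult exp_Complex_ln_pi[OF t]
    using leroy_coeff_of_real[of \<alpha> \<beta> m "real k"] by simp
  then have s: "(\<lambda>k. of_real (u k)) sums exp_series (leroy_coeff \<alpha> \<beta> m) (Complex (ln t) pi)"
    using exp_series_sums[OF dec, of "Complex (ln t) pi"] by simp
  from sums_Re[OF s] have "summable u" by (simp add: sums_iff)
  then have "exp_series (leroy_coeff \<alpha> \<beta> m) (Complex (ln t) pi) = of_real (suminf u)"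
    by (intro sums_unique2[OF s] sums_of_real summable_sums)
  then show ?thesis by (simp add: Fm_altdef u_def)
qed

text \<open>At l = ln t + i pi the imaginary part exceeds the growth rate \<kappa>, so the entire
  integral is an error term. The terms with negative index stand on the side of the series, which is
  why \<open>Hfun\<close> has the sign \<open>(-1) ^ (k + 1)\<close>.\<close>

lemma Fm_asymp_algebraic:
  assumes al: "\<alpha> > 0" and m: "m \<ge> 1" and small: "\<alpha> * real m < 2"
  shows "(\<lambda>t. Fm \<alpha> \<beta> m (- t) - Hfun \<alpha> \<beta> m K t) \<in> O[at_top](\<lambda>t. t powr (- real K - 1))"
proof -
  \<comment> \<open>The midpoint between the vertical growth rate and pi; the gap to the first
    allows any power decay, the gap to the second Abel-Plana and the rotation.\<close>
  define \<kappa> where "\<kappa> = (\<alpha> * real m * pi / 2 + pi) / 2"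
  have k: "\<kappa> > \<alpha> * real m * pi / 2" "\<kappa> < pi" using small by (auto simp: \<kappa>_def field_simps)
  define g where "g = leroy_coeff \<alpha> \<beta> m"
  have dec: "strip_decay g c \<mu> \<kappa>" for c \<mu>
    unfolding g_def by (rule strip_decay_leroy_coeff[OF al m k(1)])
  have hol: "g holomorphic_on UNIV" unfolding g_def by (rule holomorphic_leroy_coeff)
  \<comment> \<open>A half-integer to the left of -(K + 1), so that exp(c Re l) is smaller than the
    claimed error.\<close>
  define c where "c = - real K - 3/2"
  have c: "c \<notin> \<int>"
  proof
    assume "c \<in> \<int>"
    then obtain n where "c = of_int n" by (auto elim: Ints_cases)
    then have "2 * n = - 2 * int K - 3" unfolding c_def by linarith
    then show False by presburger
  qed
  obtain C where C: "C > 0" "\<And>l. \<bar>Im l\<bar> \<le> pi \<Longrightarrow> 0 \<le> Re l \<Longrightarrow> \<forall>\<^sub>F X in at_top.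
       norm (exp_series g l + (\<Sum>k=1..K. exp (- (l * of_nat k)) * g (- of_nat k))
             - contour_integral (linepath (of_real c) (of_real X)) (\<lambda>s. exp (l * s) * g s))
       \<le> C * (exp (c * Re l) + exp (- (real K + 1) * Re l))"
    using exp_series_integral[OF hol dec k(2) c, of K] by blast
  obtain D where D: "D > 0" "\<And>l. \<kappa> \<le> Im l \<Longrightarrow> \<forall>\<^sub>F X in at_top.
       norm (contour_integral (linepath (of_real c) (of_real X)) (\<lambda>s. exp (l * s) * g s)) \<le> D * exp (c * Re l)"
    using rotate_to_vertical[OF hol dec, of 2 c] by auto
  show ?thesis
  proof (rule bigoI[where c = "2 * C + D"])
    show "\<forall>\<^sub>F t in at_top. norm (Fm \<alpha> \<beta> m (- t) - Hfun \<alpha> \<beta> m K t) \<le> (2 * C + D) * norm (t powr (- real K - 1))"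
      using eventually_ge_at_top[of 1]
    proof eventually_elim
      case (elim t)
      then have t: "t > 0" "ln t \<ge> 0" by auto
      define l where "l = Complex (ln t) pi"
      have el: "exp l = - of_real t" unfolding l_def by (rule exp_Complex_ln_pi[OF t(1)])
      define A where "A = exp_series g l + (\<Sum>k=1..K. exp (- (l * of_nat k)) * g (- of_nat k))"
      have "exp (- (l * of_nat k)) * g (- of_nat k) = of_real ((- 1) ^ k * t powr (- real k) * rGamma (\<beta> - \<alpha> * real k) ^ m)" for k
      proof -
        have "exp (- (l * of_nat k)) = 1 / (- of_real t) ^ k"
          by (simp add: exp_minus exp_of_nat2_mult el inverse_eq_divide)
        also have "\<dots> = of_real ((- 1) ^ k * t powr (- real k))"
        proof -
          have "(- complex_of_real t) ^ k = of_real ((- 1) ^ k * t ^ k)"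
            by (subst power_minus) simp
          moreover have "1 / ((- 1) ^ k * t ^ k) = (- 1) ^ k * t powr (- real k)"
          proof -
            have "t powr (- real k) = 1 / t ^ k" using t by (simp add: powr_minus powr_realpow inverse_eq_divide)
            moreover have "1 / (- 1 :: real) ^ k = (- 1) ^ k" by (cases "even k") auto
            moreover have "1 / ((- 1) ^ k * t ^ k) = (1 / (- 1) ^ k) * (1 / t ^ k)" by simp
            ultimately show ?thesis by (simp only:)
          qed
          moreover have "1 / complex_of_real y = of_real (1 / y)" for y by simp
          ultimately show ?thesis by (simp only:)
        qed
        finally show ?thesis using leroy_coeff_of_real[of \<alpha> \<beta> m "- real k"] by (simp add: g_def algebra_simps)
      qed
      then have "(\<Sum>k=1..K. exp (- (l * of_nat k)) * g (- of_nat k)) = of_real (- Hfun \<alpha> \<beta> m K t)"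
        unfolding Hfun_def by (simp add: sum_negf[symmetric])
      then have A: "A = of_real (Fm \<alpha> \<beta> m (- t) - Hfun \<alpha> \<beta> m K t)"
        unfolding A_def g_def l_def exp_series_leroy_neg[OF al m t(1)] by simp
      have lb: "\<bar>Im l\<bar> \<le> pi" "0 \<le> Re l" "\<kappa> \<le> Im l" using t k by (auto simp: l_def)
      \<comment> \<open>The integral has dropped out and the inequality no longer mentions X, so
        \<open>eventually_const\<close> turns it into a plain one.\<close>
      have "\<forall>\<^sub>F X::real in at_top. norm A \<le> C * (exp (c * Re l) + exp (- (real K + 1) * Re l)) + D * exp (c * Re l)"
        using C(2)[OF lb(1,2)] D(2)[OF lb(3)]
      proof (eventually_elim)
        case (elim X)
        define J where "J = contour_integral (linepath (of_real c) (of_real X)) (\<lambda>s. exp (l * s) * g s)"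
        have "norm A \<le> norm (A - J) + norm J" using norm_triangle_ineq[of "A - J" J] by simp
        then show ?case using elim unfolding A_def[symmetric] J_def[symmetric] by linarith
      qed
      then have "norm A \<le> C * (exp (c * Re l) + exp (- (real K + 1) * Re l)) + D * exp (c * Re l)"
        by (simp add: eventually_const)
      also have "exp (- (real K + 1) * Re l) = t powr (- real K - 1)" using t by (simp add: l_def powr_def)
      also have "C * (exp (c * Re l) + t powr (- real K - 1)) + D * exp (c * Re l)
         \<le> C * (t powr (- real K - 1) + t powr (- real K - 1)) + D * t powr (- real K - 1)"
      proof -
        have "exp (c * Re l) = t powr c" using t by (simp add: l_def powr_def)
        also have "\<dots> \<le> t powr (- real K - 1)" using elim by (intro powr_mono) (auto simp: c_def)
        finally show ?thesis using C(1) D(1) by (intro add_mono mult_left_mono) auto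
      qed
      finally show ?case unfolding A norm_of_real by (simp add: algebra_simps)
    qed
  qed
qed

section \<open>Averaging over the roots of -t\<close>

lemma sin_mult_sum_cos_odd: "sin x * (\<Sum>j<M. cos ((2 * real j + 1) * x)) = sin (2 * real M * x) / 2"
proof (induction M)
  case (Suc M)
  define A where "A = (2 * real M + 1) * x"
  have "sin (A + x) - sin (A - x) = 2 * (sin x * cos A)" by (simp add: sin_add sin_diff)
  moreover have "A + x = 2 * real (Suc M) * x" "A - x = 2 * real M * x" by (simp_all add: A_def algebra_simps)
  ultimately have "sin (2 * real (Suc M) * x) = sin (2 * real M * x) + 2 * (sin x * cos ((2 * real M + 1) * x))"
    by (simp add: A_def)
  then show ?case using Suc by (simp add: distrib_left)
qed simp

text \<open>Orthogonality for the 2M-th roots of -1. The M angles are those in the upper half-plane;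
  the other roots are their conjugates, hence cosines and the value M in place of 2M.\<close>

lemma sum_cos_odd_multiples:
  assumes M: "M \<ge> 1"
  shows "\<not> 2 * M dvd n \<Longrightarrow> (\<Sum>j<M. cos (real n * (pi * (2 * real j + 1) / (2 * real M)))) = 0"
    and "(\<Sum>j<M. cos (real (2 * M * q) * (pi * (2 * real j + 1) / (2 * real M)))) = real M * (- 1) ^ q"
proof -
  assume n: "\<not> 2 * M dvd n"
  define x where "x = pi * real n / (2 * real M)"
  have "sin x \<noteq> 0"
  proof
    assume "sin x = 0"
    then obtain i where "x = of_int i * pi" by (auto simp: sin_zero_iff_int2)
    then have n': "real n = real_of_int i * (2 * real M)" using M by (simp add: x_def field_simps)
    have "int n = i * (2 * int M)"
    proof -
      from n' have "real_of_int (int n) = real_of_int (i * (2 * int M))" by simp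
      then show ?thesis by (simp only: of_int_eq_iff)
    qed
    then have "int (2 * M) dvd int n" by simp
    then show False using n by (simp only: of_nat_dvd_iff)
  qed
  moreover have "sin (2 * real M * x) = 0" using M by (simp add: x_def mult.commute[of pi])
  ultimately have "(\<Sum>j<M. cos ((2 * real j + 1) * x)) = 0" using sin_mult_sum_cos_odd[of x M] by simp
  then show "(\<Sum>j<M. cos (real n * (pi * (2 * real j + 1) / (2 * real M)))) = 0"
    by (simp add: x_def mult_ac)
next
  have "cos (real (2 * M * q) * (pi * (2 * real j + 1) / (2 * real M))) = (- 1) ^ q" for j
  proof -
    have "real (2 * M * q) * (pi * (2 * real j + 1) / (2 * real M)) = real (q * (2 * j + 1)) * pi"
      using M by (simp add: field_simps)
    then have "cos (real (2 * M * q) * (pi * (2 * real j + 1) / (2 * real M))) = (- 1) ^ (q * (2 * j + 1))"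
      by (simp only: cos_npi)
    also have "\<dots> = ((- 1) ^ (2 * j + 1)) ^ q" by (simp only: power_mult[symmetric] mult.commute)
    finally show ?thesis by simp
  qed
  then show "(\<Sum>j<M. cos (real (2 * M * q) * (pi * (2 * real j + 1) / (2 * real M)))) = real M * (- 1) ^ q"
    by (simp only: sum_constant card_lessThan)
qed

text \<open>Averaging keeps only the indices n = 2 M q, for which \<alpha> / (2M) times n is
  \<alpha> q and the n-th power of each root is (-t)^q. Taking real parts accounts for the conjugate
  roots.\<close>

lemma Fm_eq_average:
  fixes M :: nat
  assumes al: "\<alpha> > 0" and m: "m \<ge> 1" and M: "M \<ge> 1" and t: "t > 0"
  shows "Fm \<alpha> \<beta> m (- t) = (\<Sum>j<M. Re (exp_series (leroy_coeff (\<alpha> / (2 * real M)) \<beta> m)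
       (Complex (ln t / (2 * real M)) (pi * (2 * real j + 1) / (2 * real M))))) / real M"
proof -
  define N where "N = 2 * real M"
  have N: "N > 0" using M by (simp add: N_def)
  define g where "g = leroy_coeff (\<alpha> / N) \<beta> m"
  define l where "l = (\<lambda>j::nat. Complex (ln t / N) (pi * (2 * real j + 1) / N))"
  define S where "S = (\<Sum>j<M. Re (exp_series g (l j)))"
  define T where "T = (\<lambda>n::nat. exp (real n * (ln t / N)) * rGamma (\<alpha> / N * real n + \<beta>) ^ m * (\<Sum>j<M. cos (real n * (pi * (2 * real j + 1) / N))))"
  have dec: "strip_decay g 0 0 (\<alpha> / N * real m * pi / 2 + 1)"
    unfolding g_def using al N by (intro strip_decay_leroy_coeff m) auto
  have trm: "Re (exp (l j * of_nat n) * g (of_nat n)) = exp (real n * (ln t / N)) * rGamma (\<alpha> / N * real n + \<beta>) ^ m * cos (real n * (pi * (2 * real j + 1) / N))" for j n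
  proof -
    have "g (of_nat n) = of_real (rGamma (\<alpha> / N * real n + \<beta>) ^ m)"
      unfolding g_def using leroy_coeff_of_real[of "\<alpha> / N" \<beta> m "real n"] by simp
    then have "Re (exp (l j * of_nat n) * g (of_nat n)) = Re (exp (l j * of_nat n)) * rGamma (\<alpha> / N * real n + \<beta>) ^ m"
      by (simp only: Re_complex_of_real times_complex.sel Im_complex_of_real)
    also have "Re (exp (l j * of_nat n)) = exp (real n * (ln t / N)) * cos (real n * (pi * (2 * real j + 1) / N))"
      by (simp add: Re_exp l_def mult.commute)
    finally show ?thesis by (simp only: mult_ac)
  qed
  have "(\<lambda>n. \<Sum>j<M. Re (exp (l j * of_nat n) * g (of_nat n))) sums S"
    unfolding S_def by (intro sums_sum sums_Re exp_series_sums[OF dec])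
  then have "T sums S" unfolding trm T_def by (simp only: sum_distrib_left)
  moreover have "strict_mono ((*) (2 * M))" using M by (simp add: strict_mono_def)
  moreover have "T n = 0" if "n \<notin> range ((*) (2 * M))" for n
  proof -
    have "\<not> 2 * M dvd n" using that by (auto elim: dvdE)
    then show ?thesis unfolding T_def N_def using sum_cos_odd_multiples(1)[OF M] by simp
  qed
  ultimately have "(\<lambda>q. T (2 * M * q)) sums S" by (subst sums_mono_reindex) auto
  moreover have "T (2 * M * q) = real M * ((- t) ^ q * rGamma (\<alpha> * real q + \<beta>) ^ m)" for q
  proof -
    have 1: "real (2 * M * q) * (ln t / N) = real q * ln t" "\<alpha> / N * real (2 * M * q) = \<alpha> * real q"
      using M by (simp_all add: N_def field_simps)
    have "exp (real q * ln t) = t ^ q" using t by (simp add: exp_of_nat_mult)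
    moreover have "(- t) ^ q = (- 1) ^ q * t ^ q" by (rule power_minus)
    ultimately show ?thesis unfolding T_def 1 unfolding N_def sum_cos_odd_multiples(2)[OF M] by (simp only: mult_ac)
  qed
  ultimately have "(\<lambda>q. real M * ((- t) ^ q * rGamma (\<alpha> * real q + \<beta>) ^ m)) sums S" by simp
  then have "(\<lambda>q. (1 / real M) * (real M * ((- t) ^ q * rGamma (\<alpha> * real q + \<beta>) ^ m))) sums ((1 / real M) * S)"
    by (rule sums_mult)
  then have "(\<lambda>q. (- t) ^ q * rGamma (\<alpha> * real q + \<beta>) ^ m) sums (S / real M)" using M by simp
  then show ?thesis unfolding Fm_altdef by (simp add: sums_iff S_def g_def l_def N_def)
qed

text \<open>With W = exp(L) = m exp(l/a) this is (A0/a) W^(1-b) exp(W). Writing it through the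
  logarithm L fixes the branch of the power.\<close>

definition leroy_main :: "real \<Rightarrow> real \<Rightarrow> nat \<Rightarrow> complex \<Rightarrow> complex" where
  "leroy_main \<alpha> \<beta> m l = (let a = \<alpha> * real m; b = real m * \<beta> - (real m - 1) / 2;
       A0 = (2 * pi) powr ((1 - real m) / 2) * real m powr (b - 1/2); L = l / of_real a + of_real (ln (real m))
     in of_real (A0 / a) * exp (L * of_real (1 - b) + exp L))"

text \<open>The coefficient is split into the Gamma model, whose integral is known, and a remainder
  \<open>r\<close> two powers smaller. The integral of \<open>r\<close> is left open because its
  contour depends on the direction of the saddle point.\<close>

lemma exp_series_leroy_main:
  fixes \<alpha> \<beta> c :: real and m K :: nat
  defines "a \<equiv> \<alpha> * real m" and "b \<equiv> real m * \<beta> - (real m - 1) / 2"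
  assumes al: "\<alpha> > 0" and m: "m \<ge> 1" and a2: "a < 2" and c: "c \<notin> \<int>" "a * c + b - 1 \<notin> \<int>"
  obtains r C where "r holomorphic_on UNIV" "stirling_type r a (- ln \<alpha>) (b + 3/2)" "C > 0"
    "\<And>l. 0 \<le> Im l \<Longrightarrow> Im l \<le> pi \<Longrightarrow> Im l \<le> a * pi \<Longrightarrow> 0 \<le> Re l \<Longrightarrow> \<forall>\<^sub>F X in at_top.
      norm (exp_series (leroy_coeff \<alpha> \<beta> m) l + (\<Sum>k=1..K. exp (- (l * of_nat k)) * leroy_coeff \<alpha> \<beta> m (- of_nat k))
         - leroy_main \<alpha> \<beta> m l - contour_integral (linepath (of_real c) (of_real X)) (\<lambda>s. exp (l * s) * r s))
      \<le> C * (exp (c * Re l) + exp (- (real K + 1) * Re l) + exp (- b * (Re l / a + ln (real m)) + exp (Re l / a + ln (real m)) * cos (Im l / a)))"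
proof -
  define g where "g = leroy_coeff \<alpha> \<beta> m"
  define A0 where "A0 = (2 * pi) powr ((1 - real m) / 2) * real m powr (b - 1/2)"
  have a0: "a > 0" using al m by (simp add: a_def)
  define \<kappa> where "\<kappa> = (a * pi / 2 + pi) / 2"
  have k: "\<kappa> > a * pi / 2" "\<kappa> < pi" using a2 by (auto simp: \<kappa>_def field_simps)
  have dec: "strip_decay g c \<mu> \<kappa>" for c \<mu>
    unfolding g_def using k(1) unfolding a_def by (intro strip_decay_leroy_coeff al m) simp
  have hol: "g holomorphic_on UNIV" unfolding g_def by (rule holomorphic_leroy_coeff)
  obtain A1 where st: "stirling_type (\<lambda>s. rGamma (of_real \<alpha> * s + of_real \<beta>) ^ m
      - exp (of_real (a * ln m) * s) * (of_real A0 * rGamma (of_real a * s + of_real b) + A1 * rGamma (of_real a * s + of_real (b + 1))))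
      a (- ln \<alpha>) (b + 3/2)"
    using stirling_type_rGamma_power_diff[OF al m, of \<beta>] unfolding a_def b_def A0_def by blast
  define q where "q = (\<lambda>s. exp (of_real (a * ln m) * s) * (of_real A0 * rGamma (of_real a * s + of_real b) + A1 * rGamma (of_real a * s + of_real (b + 1))))"
  define r where "r = (\<lambda>s. g s - q s)"
  have holq: "q holomorphic_on UNIV" unfolding q_def by (intro holomorphic_intros)
  have holr: "r holomorphic_on UNIV" unfolding r_def by (intro holomorphic_intros hol holq)
  have str: "stirling_type r a (- ln \<alpha>) (b + 3/2)" using st by (simp add: r_def g_def q_def leroy_coeff_def)
  obtain C1 where C1: "C1 > 0" "\<And>l. \<bar>Im l\<bar> \<le> pi \<Longrightarrow> 0 \<le> Re l \<Longrightarrow> \<forall>\<^sub>F X in at_top.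
       norm (exp_series g l + (\<Sum>k=1..K. exp (- (l * of_nat k)) * g (- of_nat k))
             - contour_integral (linepath (of_real c) (of_real X)) (\<lambda>s. exp (l * s) * g s))
       \<le> C1 * (exp (c * Re l) + exp (- (real K + 1) * Re l))"
    using exp_series_integral[OF hol dec k(2) c(1), of K] by blast
  have mm: "1 \<le> real m" using m by simp
  obtain C2 where C2: "C2 > 0" "\<And>l. 0 \<le> Im l \<Longrightarrow> Im l \<le> a * pi \<Longrightarrow> 0 \<le> Re l \<Longrightarrow> \<forall>\<^sub>F X in at_top.
       norm (contour_integral (linepath (of_real c) (of_real X)) (\<lambda>s. exp (l * s) * q s)
         - of_real (A0 / a) * exp ((l / of_real a + of_real (ln (real m))) * of_real (1 - b) + exp (l / of_real a + of_real (ln (real m)))))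
       \<le> C2 * (exp (c * Re l) + exp (- b * (Re l / a + ln (real m)) + exp (Re l / a + ln (real m)) * cos (Im l / a)))"
    using main_term_integral[OF a0 mm c(2), of A0 A1] unfolding q_def by blast
  have "\<forall>\<^sub>F X in at_top.
      norm (exp_series g l + (\<Sum>k=1..K. exp (- (l * of_nat k)) * g (- of_nat k))
         - leroy_main \<alpha> \<beta> m l - contour_integral (linepath (of_real c) (of_real X)) (\<lambda>s. exp (l * s) * r s))
      \<le> (C1 + C2) * (exp (c * Re l) + exp (- (real K + 1) * Re l) + exp (- b * (Re l / a + ln (real m)) + exp (Re l / a + ln (real m)) * cos (Im l / a)))"
    if l: "0 \<le> Im l" "Im l \<le> pi" "Im l \<le> a * pi" "0 \<le> Re l" for l
  proof -
    have "\<bar>Im l\<bar> \<le> pi" using l by simp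
    from C1(2)[OF this l(4)] C2(2)[OF l(1,3,4)] show ?thesis
    proof eventually_elim
      case (elim X)
      let ?J = "contour_integral (linepath (complex_of_real c) (of_real X))"
      have ci: "(\<lambda>s. exp (l * s) * f s) contour_integrable_on linepath (complex_of_real c) (of_real X)" if "f holomorphic_on UNIV" for f
        by (intro contour_integrable_continuous_linepath holomorphic_on_imp_continuous_on holomorphic_intros holomorphic_on_subset[OF that]) simp
      have "?J (\<lambda>s. exp (l * s) * g s) = ?J (\<lambda>s. exp (l * s) * r s + exp (l * s) * q s)"
        by (simp add: r_def algebra_simps)
      also have "\<dots> = ?J (\<lambda>s. exp (l * s) * r s) + ?J (\<lambda>s. exp (l * s) * q s)"
        by (intro contour_integral_add ci holr holq)
      finally have J: "?J (\<lambda>s. exp (l * s) * g s) = ?J (\<lambda>s. exp (l * s) * r s) + ?J (\<lambda>s. exp (l * s) * q s)" .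
      define E where "E = exp_series g l + (\<Sum>k=1..K. exp (- (l * of_nat k)) * g (- of_nat k))"
      have main: "leroy_main \<alpha> \<beta> m l = of_real (A0 / a) * exp ((l / of_real a + of_real (ln (real m))) * of_real (1 - b) + exp (l / of_real a + of_real (ln (real m))))"
        unfolding leroy_main_def Let_def a_def b_def A0_def ..
      define x y z where "x = exp (c * Re l)" and "y = exp (- (real K + 1) * Re l)"
        and "z = exp (- b * (Re l / a + ln (real m)) + exp (Re l / a + ln (real m)) * cos (Im l / a))"
      have "E - leroy_main \<alpha> \<beta> m l - ?J (\<lambda>s. exp (l * s) * r s)
         = (E - ?J (\<lambda>s. exp (l * s) * g s)) + (?J (\<lambda>s. exp (l * s) * q s) - leroy_main \<alpha> \<beta> m l)"
        unfolding J by simp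
      also have "norm \<dots> \<le> C1 * (x + y) + C2 * (x + z)"
        using elim unfolding main E_def x_def y_def z_def by (intro order_trans[OF norm_triangle_ineq] add_mono)
      also have "\<dots> \<le> (C1 + C2) * (x + y + z)"
        using C1(1) C2(1) by (simp add: x_def y_def z_def algebra_simps)
      finally show ?case unfolding E_def x_def y_def z_def .
    qed
  qed
  then show ?thesis using holr str C1(1) C2(1) by (intro that[of r "C1 + C2"]) (auto simp: g_def)
qed

text \<open>At the root next to the positive axis L is ln t / (\<alpha> m) + ln m + i pi / (\<alpha>
  m), with no M left, and (1 - b) / (\<alpha> m) is \<open>p_exp\<close>.\<close>

lemma Re_leroy_main_eq_Gfun:
  fixes M :: nat
  assumes al: "\<alpha> > 0" and m: "m \<ge> 1" and M: "M \<ge> 1" and t: "t > 0"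
  shows "Re (leroy_main (\<alpha> / (2 * real M)) \<beta> m (Complex (ln t / (2 * real M)) (pi / (2 * real M)))) / real M = Gfun \<alpha> \<beta> m t"
proof -
  define N where "N = 2 * real M"
  have N: "N > 0" using M by (simp add: N_def)
  define b where "b = real m * \<beta> - (real m - 1) / 2"
  define a where "a = \<alpha> / N * real m"
  define A0 where "A0 = (2 * pi) powr ((1 - real m) / 2) * real m powr (b - 1/2)"
  define L where "L = Complex (ln t / N) (pi / N) / of_real a + of_real (ln (real m))"
  define e where "e = 1 / (\<alpha> * real m)"
  have a0: "a > 0" using al m N by (simp add: a_def)
  have mr: "real m > 0" using m by simp
  have ReL: "Re L = ln t * e + ln (real m)" and ImL: "Im L = pi * e"
    using a0 N al m by (simp_all add: L_def Re_divide_of_real Im_divide_of_real a_def e_def field_simps)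
  have p: "(1 - b) * e = p_exp \<alpha> \<beta> m"
    using al m by (simp add: b_def e_def p_exp_def field_simps)
  have eR: "exp (Re L) = real m * t powr e"
    unfolding ReL using t mr by (simp add: exp_add powr_def mult.commute)
  have eL: "Re (exp L) = real m * t powr e * cos (pi * e)" "Im (exp L) = real m * t powr e * sin (pi * e)"
    by (simp_all add: Re_exp Im_exp eR ImL)
  have "Re (exp (L * of_real (1 - b) + exp L)) = exp (Re (L * of_real (1 - b)) + Re (exp L)) * cos (Im (L * of_real (1 - b)) + Im (exp L))"
    by (simp only: Re_exp plus_complex.sel)
  also have "Re (L * of_real (1 - b)) = p_exp \<alpha> \<beta> m * ln t + (1 - b) * ln (real m)"
    unfolding p[symmetric] by (simp add: ReL algebra_simps)
  also have "Im (L * of_real (1 - b)) = pi * p_exp \<alpha> \<beta> m"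
    unfolding p[symmetric] by (simp add: ImL algebra_simps)
  also have "exp (p_exp \<alpha> \<beta> m * ln t + (1 - b) * ln (real m) + Re (exp L)) = t powr p_exp \<alpha> \<beta> m * real m powr (1 - b) * exp (Re (exp L))"
    using t mr by (simp add: exp_add powr_def)
  finally have R: "Re (exp (L * of_real (1 - b) + exp L)) = t powr p_exp \<alpha> \<beta> m * real m powr (1 - b) * exp (Re (exp L)) * cos (pi * p_exp \<alpha> \<beta> m + Im (exp L))" .
  have coef: "A0 / a / real M * real m powr (1 - b) = 2 * a0 \<alpha> m"
  proof -
    have "real m powr (b - 1/2) * real m powr (1 - b) = real m powr (1/2)" by (simp flip: powr_add)
    also have "\<dots> = sqrt (real m)" using mr by (simp add: powr_half_sqrt)
    finally have c1: "A0 * real m powr (1 - b) = (2 * pi) powr ((1 - real m) / 2) * sqrt (real m)" by (simp add: A0_def)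
    have c2: "1 / a / real M = 2 / (\<alpha> * real m)" using M al m by (simp add: a_def N_def field_simps)
    have c3: "sqrt (real m) / real m = 1 / sqrt (real m)" using mr by (simp add: real_div_sqrt field_simps)
    have "A0 / a / real M * real m powr (1 - b) = (A0 * real m powr (1 - b)) * (1 / a / real M)" by simp
    also have "\<dots> = (2 * pi) powr ((1 - real m) / 2) * (sqrt (real m) / real m) * 2 / \<alpha>" unfolding c1 c2 by simp
    also have "\<dots> = 2 * a0 \<alpha> m" unfolding c3 a0_def by (simp add: mult.commute)
    finally show ?thesis .
  qed
  have "leroy_main (\<alpha> / N) \<beta> m (Complex (ln t / N) (pi / N)) = of_real (A0 / a) * exp (L * of_real (1 - b) + exp L)"
    unfolding leroy_main_def Let_def L_def A0_def a_def b_def ..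
  then have "Re (leroy_main (\<alpha> / N) \<beta> m (Complex (ln t / N) (pi / N))) = A0 / a * Re (exp (L * of_real (1 - b) + exp L))"
    by (simp only: Re_complex_of_real Im_complex_of_real times_complex.sel)
  then have "Re (leroy_main (\<alpha> / N) \<beta> m (Complex (ln t / N) (pi / N))) / real M = (A0 / a / real M * real m powr (1 - b)) * t powr p_exp \<alpha> \<beta> m * exp (Re (exp L)) * cos (pi * p_exp \<alpha> \<beta> m + Im (exp L))"
    unfolding R by (simp add: mult_ac)
  then show ?thesis unfolding coef unfolding eL Gfun_def N_def e_def by simp
qed

text \<open>Each condition excludes only countably many points of the interval. Both are needed
  because Abel-Plana is applied once in s and once after the affine substitution.\<close>

lemma exists_shift_non_integer:
  fixes a d u v :: real
  assumes "a \<noteq> 0" "u < v"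
  obtains c where "u < c" "c < v" "c \<notin> \<int>" "a * c + d \<notin> \<int>"
proof -
  have "countable (\<int> :: real set)" by (rule countable_int)
  moreover from this have "countable ((\<lambda>n. (n - d) / a) ` \<int>)" by (rule countable_image)
  ultimately have "countable (\<int> \<union> (\<lambda>n. (n - d) / a) ` \<int>)" by simp
  then have "\<not> {u<..<v} \<subseteq> \<int> \<union> (\<lambda>n. (n - d) / a) ` \<int>"
    using uncountable_open_interval[of u v] assms(2) countable_subset by blast
  then obtain c where c: "c \<in> {u<..<v}" "c \<notin> \<int>" "c \<notin> (\<lambda>n. (n - d) / a) ` \<int>" by blast
  have "a * c + d \<notin> \<int>"
  proof
    assume "a * c + d \<in> \<int>"
    then have "((a * c + d) - d) / a \<in> (\<lambda>n. (n - d) / a) ` \<int>" by (rule imageI)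
    then show False using c(3) assms(1) by simp
  qed
  then show ?thesis using c that by auto
qed

lemma sum_odd_zero:
  fixes f :: "nat \<Rightarrow> real"
  assumes "\<And>k. odd k \<Longrightarrow> f k = 0"
  shows "(\<Sum>k=1..2*K+1. f k) = (\<Sum>k=1..K. f (2 * k))"
  using assms by (induction K) auto

text \<open>Averaging with M = 1 gives a = 1 and Im l = pi/2, so the saddle point lies on the
  imaginary axis and the remainder is integrated along a vertical line, in the borderline case of
  \<open>rotate_to_vertical\<close>.\<close>

lemma Fm_asymp_oscillating:
  assumes al: "\<alpha> > 0" and m: "m \<ge> 1" and am: "\<alpha> * real m = 2"
  shows "(\<lambda>t. Fm \<alpha> \<beta> m (- t) - Gfun \<alpha> \<beta> m t - Hfun \<alpha> \<beta> m K t)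
    \<in> O[at_top](\<lambda>t. t powr (p_exp \<alpha> \<beta> m - 1/2) + t powr (- real K - 1))"
proof -
  define b where "b = real m * \<beta> - (real m - 1) / 2"
  define p where "p = p_exp \<alpha> \<beta> m"
  have p: "p - 1/2 = - b / 2" unfolding p_def p_exp_def mult.assoc am b_def by (simp add: field_simps)
  define g where "g = leroy_coeff (\<alpha> / 2) \<beta> m"
  have a1: "\<alpha> / 2 * real m = 1" using am by simp
  have al2: "\<alpha> / 2 > 0" using al by simp
  \<comment> \<open>The lower end makes the decay exponent b + 3/2 + c larger than 1; the upper end
    makes exp(c Re l) = t^(c/2) at most t^(-b/2), which is t^(p - 1/2).\<close>
  obtain c where c: "- b - 1/2 < c" "c < - b" "c \<notin> \<int>" "1 * c + (b - 1) \<notin> \<int>"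
    using exists_shift_non_integer[of 1 "- b - 1/2" "- b" "b - 1"] by auto
  have cc: "\<alpha> / 2 * real m * c + (real m * \<beta> - (real m - 1) / 2) - 1 \<notin> \<int>"
    using c(4) unfolding a1 b_def[symmetric] by (simp add: algebra_simps)
  \<comment> \<open>The expansion is now in powers of t^(-1/2). Of the first 2K + 1 terms the odd
    ones have vanishing real part and the even ones give \<open>Hfun\<close>; the first omitted
    power is t^(-K-1).\<close>
  obtain r C where r: "r holomorphic_on UNIV" "stirling_type r 1 (- ln (\<alpha> / 2)) (b + 3/2)" and C: "C > 0"
    "\<And>l. 0 \<le> Im l \<Longrightarrow> Im l \<le> pi \<Longrightarrow> Im l \<le> 1 * pi \<Longrightarrow> 0 \<le> Re l \<Longrightarrow> \<forall>\<^sub>F X in at_top.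
      norm (exp_series g l + (\<Sum>k=1..2*K+1. exp (- (l * of_nat k)) * g (- of_nat k))
         - leroy_main (\<alpha> / 2) \<beta> m l - contour_integral (linepath (of_real c) (of_real X)) (\<lambda>s. exp (l * s) * r s))
      \<le> C * (exp (c * Re l) + exp (- (real (2*K+1) + 1) * Re l) + exp (- b * (Re l / 1 + ln (real m)) + exp (Re l / 1 + ln (real m)) * cos (Im l / 1)))"
    using exp_series_leroy_main[OF al2 m _ c(3) cc, of "2*K+1"] unfolding a1 b_def[symmetric] g_def by auto
  have "strip_decay r c (b + 3/2 + 1 * c) (1 * pi / 2)"
    by (rule stirling_type_imp_strip_decay[OF r]) simp
  moreover have "b + 3/2 + 1 * c > 1" using c by simp
  ultimately obtain D where D: "D > 0" "\<And>l. 1 * pi / 2 \<le> Im l \<Longrightarrow> \<forall>\<^sub>F X in at_top.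
       norm (contour_integral (linepath (of_real c) (of_real X)) (\<lambda>s. exp (l * s) * r s)) \<le> D * exp (c * Re l)"
    using rotate_to_vertical[OF r(1)] by blast
  define E where "E = C * (2 + real m powr (- b)) + D"
  show ?thesis
  proof (rule bigoI[where c = E])
    show "\<forall>\<^sub>F t in at_top. norm (Fm \<alpha> \<beta> m (- t) - Gfun \<alpha> \<beta> m t - Hfun \<alpha> \<beta> m K t)
        \<le> E * norm (t powr (p_exp \<alpha> \<beta> m - 1/2) + t powr (- real K - 1))"
      using eventually_ge_at_top[of 1]
    proof eventually_elim
      case (elim t)
      then have t: "t > 0" "ln t \<ge> 0" by auto
      define l where "l = Complex (ln t / 2) (pi / 2)"
      have lb: "0 \<le> Im l" "Im l \<le> pi" "Im l \<le> 1 * pi" "0 \<le> Re l" "1 * pi / 2 \<le> Im l" using t by (auto simp: l_def)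
      define A where "A = exp_series g l + (\<Sum>k=1..2*K+1. exp (- (l * of_nat k)) * g (- of_nat k)) - leroy_main (\<alpha> / 2) \<beta> m l"
      have F: "Re (exp_series g l) = Fm \<alpha> \<beta> m (- t)"
        using Fm_eq_average[OF al m, of 1 t] t by (simp add: g_def l_def)
      have G: "Re (leroy_main (\<alpha> / 2) \<beta> m l) = Gfun \<alpha> \<beta> m t"
        using Re_leroy_main_eq_Gfun[OF al m, of 1 t] t by (simp add: l_def)
      have trm: "Re (exp (- (l * of_nat k)) * g (- of_nat k)) = exp (- (real k * (ln t / 2))) * cos (real k * (pi / 2)) * rGamma (\<beta> - \<alpha> / 2 * real k) ^ m" for k
      proof -
        have "g (- of_nat k) = of_real (rGamma (\<beta> - \<alpha> / 2 * real k) ^ m)"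
          unfolding g_def using leroy_coeff_of_real[of "\<alpha> / 2" \<beta> m "- real k"] by (simp add: algebra_simps)
        then have "Re (exp (- (l * of_nat k)) * g (- of_nat k)) = Re (exp (- (l * of_nat k))) * rGamma (\<beta> - \<alpha> / 2 * real k) ^ m"
          by (simp only: Re_complex_of_real times_complex.sel Im_complex_of_real)
        also have "Re (exp (- (l * of_nat k))) = exp (- (real k * (ln t / 2))) * cos (real k * (pi / 2))"
          by (simp add: Re_exp l_def mult.commute)
        finally show ?thesis .
      qed
      have "Re (\<Sum>k=1..2*K+1. exp (- (l * of_nat k)) * g (- of_nat k)) = (\<Sum>k=1..2*K+1. exp (- (real k * (ln t / 2))) * cos (real k * (pi / 2)) * rGamma (\<beta> - \<alpha> / 2 * real k) ^ m)"
        by (simp only: Re_sum trm)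
      also have "\<dots> = (\<Sum>k=1..K. exp (- (real (2 * k) * (ln t / 2))) * cos (real (2 * k) * (pi / 2)) * rGamma (\<beta> - \<alpha> / 2 * real (2 * k)) ^ m)"
      proof (rule sum_odd_zero)
        fix k :: nat assume "odd k"
        then have "cos (real k * (pi / 2)) = 0" using cos_zero_iff[of "real k * (pi / 2)"] by blast
        then show "exp (- (real k * (ln t / 2))) * cos (real k * (pi / 2)) * rGamma (\<beta> - \<alpha> / 2 * real k) ^ m = 0" by simp
      qed
      also have "\<dots> = (\<Sum>k=1..K. - ((-1) ^ (k + 1) * t powr (- real k) * rGamma (\<beta> - \<alpha> * real k) ^ m))"
      proof (rule sum.cong[OF refl])
        fix k
        have 1: "real (2 * k) * (pi / 2) = real k * pi" "real (2 * k) * (ln t / 2) = real k * ln t" "\<alpha> / 2 * real (2 * k) = \<alpha> * real k" by simp_all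
        have "exp (- (real k * ln t)) = t powr (- real k)" using t by (simp add: powr_def)
        then show "exp (- (real (2 * k) * (ln t / 2))) * cos (real (2 * k) * (pi / 2)) * rGamma (\<beta> - \<alpha> / 2 * real (2 * k)) ^ m
            = - ((-1) ^ (k + 1) * t powr (- real k) * rGamma (\<beta> - \<alpha> * real k) ^ m)"
          unfolding 1 cos_npi by simp
      qed
      also have "\<dots> = - Hfun \<alpha> \<beta> m K t" by (simp add: Hfun_def sum_negf)
      finally have H: "Re (\<Sum>k=1..2*K+1. exp (- (l * of_nat k)) * g (- of_nat k)) = - Hfun \<alpha> \<beta> m K t" .
      have ReA: "Re A = Fm \<alpha> \<beta> m (- t) - Gfun \<alpha> \<beta> m t - Hfun \<alpha> \<beta> m K t"
        unfolding A_def minus_complex.sel plus_complex.sel F G H by simp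
      define B where "B = C * (exp (c * Re l) + exp (- (real (2*K+1) + 1) * Re l) + exp (- b * (Re l / 1 + ln (real m)) + exp (Re l / 1 + ln (real m)) * cos (Im l / 1))) + D * exp (c * Re l)"
      have "\<forall>\<^sub>F X::real in at_top. norm A \<le> B"
        using C(2)[OF lb(1-4)] D(2)[OF lb(5)]
      proof eventually_elim
        case (elim X)
        define J where "J = contour_integral (linepath (of_real c) (of_real X)) (\<lambda>s. exp (l * s) * r s)"
        have "norm A \<le> norm (A - J) + norm J" using norm_triangle_ineq[of "A - J" J] by simp
        then show ?case using elim unfolding A_def[symmetric] J_def[symmetric] B_def by linarith
      qed
      then have AB: "norm A \<le> B" by (simp add: eventually_const)
      define u v where "u = t powr (p - 1/2)" and "v = t powr (- real K - 1)"
      have uv: "u \<ge> 0" "v \<ge> 0" by (simp_all add: u_def v_def)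
      have "exp (c * Re l) = t powr (c / 2)" using t by (simp add: l_def powr_def)
      also have "\<dots> \<le> u" unfolding u_def using elim c by (intro powr_mono) (auto simp: p)
      finally have 1: "exp (c * Re l) \<le> u" .
      have 2: "exp (- (real (2*K+1) + 1) * Re l) = v"
        using t by (simp add: l_def powr_def v_def field_simps)
      \<comment> \<open>The exponential in the last error term is purely oscillating in this
        direction, and only the power of t remains.\<close>
      have e1: "cos (Im l / 1) = 0" by (simp add: l_def)
      have e2: "- b * (Re l / 1 + ln (real m)) = (- b / 2) * ln t + (- b) * ln (real m)" by (simp add: l_def algebra_simps)
      have "exp ((- b / 2) * ln t + (- b) * ln (real m)) = real m powr (- b) * u"
        unfolding exp_add u_def p powr_def using t m by simp
      then have 3: "exp (- b * (Re l / 1 + ln (real m)) + exp (Re l / 1 + ln (real m)) * cos (Im l / 1)) = real m powr (- b) * u"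
        by (simp only: e1 e2 mult_zero_right add_0_right)
      have "B = C * (exp (c * Re l) + v + real m powr (- b) * u) + D * exp (c * Re l)" unfolding B_def 2 3 ..
      also have "\<dots> \<le> C * (u + v + real m powr (- b) * u) + D * u"
        using 1 C(1) D(1) by (intro add_mono mult_left_mono) auto
      also have "\<dots> \<le> E * (u + v)"
      proof -
        have "E * (u + v) = (C * (u + v + real m powr (- b) * u) + D * u) + (C * u + (C * (1 + real m powr (- b)) + D) * v)"
          by (simp add: E_def algebra_simps)
        moreover have "0 \<le> C * u + (C * (1 + real m powr (- b)) + D) * v"
          using C(1) D(1) uv by (intro add_nonneg_nonneg mult_nonneg_nonneg) auto
        ultimately show ?thesis by linarith
      qed
      finally have "norm A \<le> E * (u + v)" using AB by linarith
      then have "\<bar>Re A\<bar> \<le> E * (u + v)" using abs_Re_le_cmod[of A] by linarith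
      then show ?case unfolding ReA using uv by (simp add: u_def v_def p_def)
    qed
  qed
qed

section \<open>Saddle rays of dominant and subdominant roots\<close>

lemma contour_integral_to_0_bound:
  assumes h: "h holomorphic_on UNIV"
  obtains C where "C > 0" "\<And>l. 0 \<le> Re l \<Longrightarrow> norm (contour_integral (linepath (of_real c) 0) (\<lambda>s. exp (l * s) * h s)) \<le> C * exp (\<bar>c\<bar> * Re l)"
proof -
  obtain H where H: "H \<ge> 0" "\<And>s. norm s \<le> \<bar>c\<bar> \<Longrightarrow> norm (h s) \<le> H"
    using entire_bounded_cball[OF h] by blast
  have "norm (contour_integral (linepath (of_real c) 0) (\<lambda>s. exp (l * s) * h s)) \<le> (H * \<bar>c\<bar> + 1) * exp (\<bar>c\<bar> * Re l)" if l: "0 \<le> Re l" for l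
  proof -
    have "norm (contour_integral (linepath (of_real c) 0) (\<lambda>s. exp (l * s) * h s)) \<le> (exp (\<bar>c\<bar> * Re l) * H) * norm (0 - complex_of_real c)"
    proof (rule contour_integral_bound_linepath[OF contour_integrable_continuous_linepath])
      show "continuous_on (closed_segment (complex_of_real c) 0) (\<lambda>s. exp (l * s) * h s)"
        by (intro holomorphic_on_imp_continuous_on holomorphic_intros holomorphic_on_subset[OF h]) simp
      fix s assume "s \<in> closed_segment (complex_of_real c) 0"
      then obtain u where u: "0 \<le> u" "u \<le> 1" "s = (1 - u) *\<^sub>R of_real c + u *\<^sub>R 0"
        unfolding closed_segment_def by blast
      then have s: "s = of_real ((1 - u) * c)" by (simp add: scaleR_conv_of_real)
      have "\<bar>(1 - u) * c\<bar> \<le> 1 * \<bar>c\<bar>" unfolding abs_mult using u by (intro mult_right_mono) auto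
      then have uc: "\<bar>(1 - u) * c\<bar> \<le> \<bar>c\<bar>" by simp
      then have "norm (h s) \<le> H" unfolding s by (intro H(2)) (simp only: norm_of_real)
      moreover have "(1 - u) * c * Re l \<le> \<bar>c\<bar> * Re l" using uc l by (intro mult_right_mono) auto
      then have "norm (exp (l * s)) \<le> exp (\<bar>c\<bar> * Re l)" by (simp add: s mult.commute)
      ultimately show "norm (exp (l * s) * h s) \<le> exp (\<bar>c\<bar> * Re l) * H"
        unfolding norm_mult by (intro mult_mono) auto
    qed (use H in auto)
    also have "\<dots> \<le> (H * \<bar>c\<bar> + 1) * exp (\<bar>c\<bar> * Re l)" by (simp add: algebra_simps)
    finally show ?thesis .
  qed
  then show ?thesis using H(1) by (intro that[of "H * \<bar>c\<bar> + 1"]) (auto intro: add_nonneg_pos)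
qed

text \<open>The ray starts at 0 while Abel-Plana starts at a non-integer c; joining the two costs
  exp(|c| Re l), harmless against an exponential of exp(Re l / a).\<close>

lemma stirling_type_ray_integral:
  assumes h: "h holomorphic_on UNIV" and st: "stirling_type h a d \<nu>" and a: "a > 0" and psi: "0 < \<psi>" "\<psi> < pi / 2"
  obtains C L0 where "C > 0"
    "\<And>l. L0 \<le> Re l \<Longrightarrow> 0 \<le> Re l \<Longrightarrow> a * \<psi> \<le> Im l \<Longrightarrow> \<forall>\<^sub>F X in at_top.
       norm (contour_integral (linepath (of_real c) (of_real X)) (\<lambda>s. exp (l * s) * h s))
         \<le> C * (exp (\<bar>c\<bar> * Re l) + exp ((1 - \<nu>) * (Re l / a + d) + a * cos \<psi> * exp (Re l / a + d)))"
proof -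
  obtain D where D: "\<And>u. u \<ge> 1 \<Longrightarrow> norm (h (of_real u * cis \<psi>))
        \<le> D * u powr (- \<nu>) * exp (a * u * (cos \<psi> * (1 + d - ln u) + \<psi> * sin \<psi>))"
    using stirling_type_ray[OF h st psi] by blast
  have dec: "strip_decay h 0 0 (a * pi / 2 + 1)"
    by (rule strip_decay_weaken[OF stirling_type_imp_strip_decay[OF h st a]]) simp
  obtain C1 L0 where C1: "C1 > 0" "\<And>l. L0 \<le> Re l \<Longrightarrow> a * \<psi> \<le> Im l \<Longrightarrow> \<forall>\<^sub>F X in at_top.
       norm (contour_integral (linepath 0 (of_real X)) (\<lambda>s. exp (l * s) * h s))
         \<le> C1 * (exp (Re l / a + d) powr (1 - \<nu>) * exp (a * cos \<psi> * exp (Re l / a + d)))"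
    using rotate_to_ray[OF h dec a psi D] by blast
  obtain C2 where C2: "C2 > 0" "\<And>l. 0 \<le> Re l \<Longrightarrow> norm (contour_integral (linepath (of_real c) 0) (\<lambda>s. exp (l * s) * h s)) \<le> C2 * exp (\<bar>c\<bar> * Re l)"
    using contour_integral_to_0_bound[OF h] by blast
  have "\<forall>\<^sub>F X in at_top.
       norm (contour_integral (linepath (of_real c) (of_real X)) (\<lambda>s. exp (l * s) * h s))
         \<le> (C1 + C2) * (exp (\<bar>c\<bar> * Re l) + exp ((1 - \<nu>) * (Re l / a + d) + a * cos \<psi> * exp (Re l / a + d)))"
    if l: "L0 \<le> Re l" "0 \<le> Re l" "a * \<psi> \<le> Im l" for l
    using C1(2)[OF l(1,3)]
  proof eventually_elim
    case (elim X)
    let ?f = "\<lambda>s. exp (l * s) * h s"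
    define x y where "x = exp (\<bar>c\<bar> * Re l)" and "y = exp ((1 - \<nu>) * (Re l / a + d) + a * cos \<psi> * exp (Re l / a + d))"
    have "?f holomorphic_on UNIV" by (intro holomorphic_intros h)
    then have "contour_integral (linepath (of_real c) (of_real X)) ?f = contour_integral (linepath (of_real c) 0) ?f + contour_integral (linepath 0 (of_real X)) ?f"
      by (rule contour_integral_entire_linepath_split)
    also have "norm \<dots> \<le> C2 * x + C1 * y"
    proof (intro order_trans[OF norm_triangle_ineq] add_mono)
      show "norm (contour_integral (linepath (of_real c) 0) ?f) \<le> C2 * x" unfolding x_def by (rule C2(2)[OF l(2)])
      show "norm (contour_integral (linepath 0 (of_real X)) ?f) \<le> C1 * y"
      proof -
        have "exp (Re l / a + d) powr (1 - \<nu>) = exp ((1 - \<nu>) * (Re l / a + d))" by (simp add: powr_def)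
        then show ?thesis using elim unfolding y_def exp_add[of "(1 - \<nu>) * (Re l / a + d)"] by simp
      qed
    qed
    also have "\<dots> \<le> (C1 + C2) * (x + y)" using C1(1) C2(1) by (simp add: algebra_simps x_def y_def)
    finally show ?case unfolding x_def y_def .
  qed
  then show ?thesis using C1(1) C2(1) by (intro that[of "C1 + C2" L0]) auto
qed

lemma eventually_linear_le_exp:
  fixes a d u v w :: real
  assumes "a > 0" "d > 0"
  shows "\<forall>\<^sub>F x in at_top. u * x + v \<le> d * exp (x / a + w)"
proof -
  have "((\<lambda>x. (u * x + v) / exp (x / a + w)) \<longlongrightarrow> 0) at_top" using assms(1) by real_asymp
  then have "\<forall>\<^sub>F x in at_top. (u * x + v) / exp (x / a + w) < d" by (rule order_tendstoD) (use assms in simp)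
  then show ?thesis by eventually_elim (simp add: divide_less_eq)
qed

text \<open>The saddle point has argument Im l / a = \<phi>, so the remainder is integrated along
  the ray through it. As cos \<phi> > 0, all pure exponentials in x are dominated by the double
  exponential in the bound.\<close>

lemma leroy_dominant_ray:
  fixes \<alpha> \<beta> \<phi> :: real and m :: nat
  defines "a \<equiv> \<alpha> * real m" and "b \<equiv> real m * \<beta> - (real m - 1) / 2"
  assumes al: "\<alpha> > 0" and m: "m \<ge> 1" and a2: "a < 2" and phi: "0 < \<phi>" "\<phi> < pi / 2" and small: "a * \<phi> \<le> pi"
  shows "(\<lambda>x. Re (exp_series (leroy_coeff \<alpha> \<beta> m) (Complex x (a * \<phi>)) - leroy_main \<alpha> \<beta> m (Complex x (a * \<phi>))))
    \<in> O[at_top](\<lambda>x. exp (- b * (x / a + ln (real m)) + exp (x / a + ln (real m)) * cos \<phi>))"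
proof -
  have a0: "a > 0" using al m by (simp add: a_def)
  have cpos: "cos \<phi> > 0" using phi by (intro cos_gt_zero) auto
  obtain c where c: "c \<notin> \<int>" "a * c + (b - 1) \<notin> \<int>" using exists_shift_non_integer[of a 0 1 "b - 1"] a0 by auto
  then have c': "\<alpha> * real m * c + (real m * \<beta> - (real m - 1) / 2) - 1 \<notin> \<int>" by (simp add: a_def b_def add_diff_eq)
  have a2': "\<alpha> * real m < 2" using a2 by (simp add: a_def)
  obtain r C where r: "r holomorphic_on UNIV" "stirling_type r a (- ln \<alpha>) (b + 3/2)" and C: "C > 0"
    "\<And>l. 0 \<le> Im l \<Longrightarrow> Im l \<le> pi \<Longrightarrow> Im l \<le> a * pi \<Longrightarrow> 0 \<le> Re l \<Longrightarrow> \<forall>\<^sub>F X in at_top.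
      norm (exp_series (leroy_coeff \<alpha> \<beta> m) l + (\<Sum>k=1..0. exp (- (l * of_nat k)) * leroy_coeff \<alpha> \<beta> m (- of_nat k))
         - leroy_main \<alpha> \<beta> m l - contour_integral (linepath (of_real c) (of_real X)) (\<lambda>s. exp (l * s) * r s))
      \<le> C * (exp (c * Re l) + exp (- (real 0 + 1) * Re l) + exp (- b * (Re l / a + ln (real m)) + exp (Re l / a + ln (real m)) * cos (Im l / a)))"
    using exp_series_leroy_main[OF al m a2' c(1) c', of 0] unfolding a_def[symmetric] b_def[symmetric] by blast
  obtain D L0 where D: "D > 0" "\<And>l. L0 \<le> Re l \<Longrightarrow> 0 \<le> Re l \<Longrightarrow> a * \<phi> \<le> Im l \<Longrightarrow> \<forall>\<^sub>F X in at_top.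
       norm (contour_integral (linepath (of_real c) (of_real X)) (\<lambda>s. exp (l * s) * r s))
         \<le> D * (exp (\<bar>c\<bar> * Re l) + exp ((1 - (b + 3/2)) * (Re l / a + - ln \<alpha>) + a * cos \<phi> * exp (Re l / a + - ln \<alpha>)))"
    using stirling_type_ray_integral[OF r a0 phi] by blast
  define T where "T = (\<lambda>x. exp (- b * (x / a + ln (real m)) + exp (x / a + ln (real m)) * cos \<phi>))"
  define E where "E = exp (b * ln (real m) + (b + 1/2) * ln \<alpha>)"
  have ev: "\<forall>\<^sub>F x in at_top. (\<bar>c\<bar> + b / a) * x + b * ln (real m) \<le> cos \<phi> * exp (x / a + ln (real m))"
    by (rule eventually_linear_le_exp[OF a0 cpos])
  show ?thesis unfolding T_def[symmetric]
  proof (rule bigoI[where c = "3 * C + D * (1 + E)"])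
    show "\<forall>\<^sub>F x in at_top. norm (Re (exp_series (leroy_coeff \<alpha> \<beta> m) (Complex x (a * \<phi>)) - leroy_main \<alpha> \<beta> m (Complex x (a * \<phi>)))) \<le> (3 * C + D * (1 + E)) * norm (T x)"
      using ev eventually_ge_at_top[of "max 0 L0"]
    proof eventually_elim
      case (elim x)
      define l where "l = Complex x (a * \<phi>)"
      have "a * \<phi> \<le> a * pi" using a0 phi by (intro mult_left_mono) auto
      then have lb: "0 \<le> Im l" "Im l \<le> pi" "Im l \<le> a * pi" "0 \<le> Re l" "L0 \<le> Re l" "a * \<phi> \<le> Im l"
        using elim a0 phi small by (auto simp: l_def)
      define A where "A = exp_series (leroy_coeff \<alpha> \<beta> m) l - leroy_main \<alpha> \<beta> m l"
      define B where "B = C * (exp (c * x) + exp (- x) + T x) + D * (exp (\<bar>c\<bar> * x) + exp ((1 - (b + 3/2)) * (x / a + - ln \<alpha>) + a * cos \<phi> * exp (x / a + - ln \<alpha>)))"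
      have Tl: "exp (- b * (Re l / a + ln (real m)) + exp (Re l / a + ln (real m)) * cos (Im l / a)) = T x"
        using a0 by (simp add: l_def T_def)
      have "\<forall>\<^sub>F X::real in at_top. norm A \<le> B"
        using C(2)[OF lb(1-4)] D(2)[OF lb(5,4,6)]
      proof eventually_elim
        case (elim X)
        define J where "J = contour_integral (linepath (of_real c) (of_real X)) (\<lambda>s. exp (l * s) * r s)"
        have "norm A \<le> norm (A - J) + norm J" using norm_triangle_ineq[of "A - J" J] by simp
        moreover have "norm (A - J) \<le> C * (exp (c * x) + exp (- x) + T x)"
          using elim(1) unfolding Tl unfolding A_def J_def by (simp add: l_def)
        ultimately show ?case using elim(2) unfolding J_def[symmetric] B_def by (simp add: l_def)
      qed
      then have AB: "norm A \<le> B" by (simp add: eventually_const)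
      have x: "x \<ge> 0" using elim by simp
      have 1: "exp (\<bar>c\<bar> * x) \<le> T x" unfolding T_def using elim(1) by (simp add: algebra_simps add_divide_distrib)
      have "c * x \<le> \<bar>c\<bar> * x" using x by (intro mult_right_mono) auto
      then have 2: "exp (c * x) \<le> T x" using 1 by (meson exp_le_cancel_iff order_trans)
      have "- x \<le> \<bar>c\<bar> * x" using x by (meson abs_ge_zero mult_nonneg_nonneg neg_le_0_iff_le order_trans)
      then have 3: "exp (- x) \<le> T x" using 1 by (meson exp_le_cancel_iff order_trans)
      \<comment> \<open>a times the distance of the saddle point is |W|: the saddle value of the
        remainder carries the same exponential as the main term.\<close>
      have aE: "a * exp (x / a + - ln \<alpha>) = exp (x / a + ln (real m))"
        using al m unfolding exp_add by (simp add: a_def exp_minus)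
      have 4: "exp ((1 - (b + 3/2)) * (x / a + - ln \<alpha>) + a * cos \<phi> * exp (x / a + - ln \<alpha>)) \<le> E * T x"
      proof -
        \<comment> \<open>The summand -x/(2a) is what the second Stirling term has bought: even
          after the crude estimate on the ray the remainder stays below the target.\<close>
        have h1: "(1 - (b + 3/2)) * (x / a + - ln \<alpha>) = (b * ln (real m) + (b + 1/2) * ln \<alpha>) - b * (x / a + ln (real m)) - x / a / 2"
          by (simp add: field_simps)
        have h2: "x / a / 2 \<ge> 0" using x a0 by simp
        have h3: "a * cos \<phi> * exp (x / a + - ln \<alpha>) = exp (x / a + ln (real m)) * cos \<phi>"
          unfolding aE[symmetric] by (simp only: mult_ac)
        have "(1 - (b + 3/2)) * (x / a + - ln \<alpha>) + a * cos \<phi> * exp (x / a + - ln \<alpha>)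
          \<le> (b * ln (real m) + (b + 1/2) * ln \<alpha>) + (- b * (x / a + ln (real m)) + exp (x / a + ln (real m)) * cos \<phi>)"
          unfolding h1 h3 using h2 by simp
        then show ?thesis unfolding E_def T_def exp_add[symmetric] by simp
      qed
      have "B \<le> C * (T x + T x + T x) + D * (T x + E * T x)"
        unfolding B_def using 1 2 3 4 C(1) D(1) by (intro add_mono mult_left_mono) auto
      also have "\<dots> = (3 * C + D * (1 + E)) * T x" by (simp add: algebra_simps)
      finally have "\<bar>Re A\<bar> \<le> (3 * C + D * (1 + E)) * T x" using AB abs_Re_le_cmod[of A] by linarith
      then show ?case by (simp add: A_def l_def T_def)
    qed
  qed
qed

text \<open>A ray of angle \<psi> > \<phi> is still admissible for this root because a \<psi> <=
  \<theta>, and the bound on it has cos \<psi> < cos \<phi> in the exponent. The resulting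
  exponential gain makes the leading Stirling bound sufficient, without any main term.\<close>

lemma leroy_subdominant_ray:
  fixes \<alpha> \<beta> \<phi> \<theta> :: real and m :: nat
  defines "a \<equiv> \<alpha> * real m" and "b \<equiv> real m * \<beta> - (real m - 1) / 2"
  assumes al: "\<alpha> > 0" and m: "m \<ge> 1" and a2: "a < 2" and phi: "0 < \<phi>" "\<phi> < pi / 2" and theta: "a * \<phi> < \<theta>" "\<theta> \<le> pi"
  shows "(\<lambda>x. Re (exp_series (leroy_coeff \<alpha> \<beta> m) (Complex x \<theta>)))
    \<in> O[at_top](\<lambda>x. exp (- b * (x / a + ln (real m)) + exp (x / a + ln (real m)) * cos \<phi>))"
proof -
  have a0: "a > 0" using al m by (simp add: a_def)
  have cpos: "cos \<phi> > 0" using phi by (intro cos_gt_zero) auto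
  \<comment> \<open>The angle has to stay below pi/2 even if the saddle point of this root lies
    further round, since the ray must remain in the right half-plane.\<close>
  have "\<phi> < min (pi / 2) (\<theta> / a)" using phi theta a0 by (simp add: field_simps)
  then obtain \<psi> where psi: "\<phi> < \<psi>" "\<psi> < min (pi / 2) (\<theta> / a)" using dense by blast
  have psi2: "0 < \<psi>" "\<psi> < pi / 2" "a * \<psi> \<le> \<theta>" using psi phi a0 by (auto simp: field_simps)
  have cc: "cos \<psi> < cos \<phi>" using psi phi psi2 by (intro cos_monotone_0_pi) auto
  define g where "g = leroy_coeff \<alpha> \<beta> m"
  have hol: "g holomorphic_on UNIV" unfolding g_def by (rule holomorphic_leroy_coeff)
  have st: "stirling_type g a (- ln \<alpha>) (b - 1/2)"
    unfolding g_def leroy_coeff_def a_def b_def by (rule stirling_type_rGamma_power[OF al])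
  define \<kappa> where "\<kappa> = (a * pi / 2 + pi) / 2"
  have k: "\<kappa> > a * pi / 2" "\<kappa> < pi" using a2 by (auto simp: \<kappa>_def field_simps)
  have dec: "strip_decay g c \<mu> \<kappa>" for c \<mu>
    unfolding g_def using k(1) unfolding a_def by (intro strip_decay_leroy_coeff al m) simp
  obtain c :: real where c: "c \<notin> \<int>" using exists_shift_non_integer[of 1 0 1 0] by auto
  obtain C where C: "C > 0" "\<And>l. \<bar>Im l\<bar> \<le> pi \<Longrightarrow> 0 \<le> Re l \<Longrightarrow> \<forall>\<^sub>F X in at_top.
       norm (exp_series g l + (\<Sum>k=1..0. exp (- (l * of_nat k)) * g (- of_nat k))
             - contour_integral (linepath (of_real c) (of_real X)) (\<lambda>s. exp (l * s) * g s))
       \<le> C * (exp (c * Re l) + exp (- (real 0 + 1) * Re l))"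
    using exp_series_integral[OF hol dec k(2) c, of 0] by blast
  obtain D L0 where D: "D > 0" "\<And>l. L0 \<le> Re l \<Longrightarrow> 0 \<le> Re l \<Longrightarrow> a * \<psi> \<le> Im l \<Longrightarrow> \<forall>\<^sub>F X in at_top.
       norm (contour_integral (linepath (of_real c) (of_real X)) (\<lambda>s. exp (l * s) * g s))
         \<le> D * (exp (\<bar>c\<bar> * Re l) + exp ((1 - (b - 1/2)) * (Re l / a + - ln \<alpha>) + a * cos \<psi> * exp (Re l / a + - ln \<alpha>)))"
    using stirling_type_ray_integral[OF hol st a0 psi2(1,2)] by blast
  define T where "T = (\<lambda>x. exp (- b * (x / a + ln (real m)) + exp (x / a + ln (real m)) * cos \<phi>))"
  have ev: "\<forall>\<^sub>F x in at_top. (\<bar>c\<bar> + b / a) * x + b * ln (real m) \<le> cos \<phi> * exp (x / a + ln (real m))"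
    by (rule eventually_linear_le_exp[OF a0 cpos])
  have ev2: "\<forall>\<^sub>F x in at_top. ((1 - (b - 1/2)) / a + b / a) * x + (b * ln (real m) - (1 - (b - 1/2)) * ln \<alpha>) \<le> (cos \<phi> - cos \<psi>) * exp (x / a + ln (real m))"
    by (rule eventually_linear_le_exp[OF a0]) (use cc in simp)
  show ?thesis unfolding T_def[symmetric] g_def[symmetric]
  proof (rule bigoI[where c = "2 * C + 2 * D"])
    show "\<forall>\<^sub>F x in at_top. norm (Re (exp_series g (Complex x \<theta>))) \<le> (2 * C + 2 * D) * norm (T x)"
      using ev ev2 eventually_ge_at_top[of "max 0 L0"]
    proof eventually_elim
      case (elim x)
      define l where "l = Complex x \<theta>"
      have "0 < \<theta>" using theta a0 phi by (meson less_trans mult_pos_pos)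
      then have lb: "\<bar>Im l\<bar> \<le> pi" "0 \<le> Re l" "L0 \<le> Re l" "a * \<psi> \<le> Im l"
        using elim theta psi2 by (auto simp: l_def)
      define A where "A = exp_series g l"
      define B where "B = C * (exp (c * x) + exp (- x)) + D * (exp (\<bar>c\<bar> * x) + exp ((1 - (b - 1/2)) * (x / a + - ln \<alpha>) + a * cos \<psi> * exp (x / a + - ln \<alpha>)))"
      have "\<forall>\<^sub>F X::real in at_top. norm A \<le> B"
        using C(2)[OF lb(1,2)] D(2)[OF lb(3,2,4)]
      proof eventually_elim
        case (elim X)
        define J where "J = contour_integral (linepath (of_real c) (of_real X)) (\<lambda>s. exp (l * s) * g s)"
        have "norm A \<le> norm (A - J) + norm J" using norm_triangle_ineq[of "A - J" J] by simp
        moreover have "norm (A - J) \<le> C * (exp (c * x) + exp (- x))"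
          using elim(1) unfolding A_def J_def by (simp add: l_def)
        ultimately show ?case using elim(2) unfolding J_def[symmetric] B_def by (simp add: l_def)
      qed
      then have AB: "norm A \<le> B" by (simp add: eventually_const)
      have x: "x \<ge> 0" using elim by simp
      have 1: "exp (\<bar>c\<bar> * x) \<le> T x" unfolding T_def using elim(1) by (simp add: algebra_simps add_divide_distrib)
      have "c * x \<le> \<bar>c\<bar> * x" using x by (intro mult_right_mono) auto
      then have 2: "exp (c * x) \<le> T x" using 1 by (meson exp_le_cancel_iff order_trans)
      have "- x \<le> \<bar>c\<bar> * x" using x by (meson abs_ge_zero mult_nonneg_nonneg neg_le_0_iff_le order_trans)
      then have 3: "exp (- x) \<le> T x" using 1 by (meson exp_le_cancel_iff order_trans)
      have aE: "a * exp (x / a + - ln \<alpha>) = exp (x / a + ln (real m))"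
        using al m unfolding exp_add by (simp add: a_def exp_minus)
      have 4: "exp ((1 - (b - 1/2)) * (x / a + - ln \<alpha>) + a * cos \<psi> * exp (x / a + - ln \<alpha>)) \<le> T x"
      proof -
        have e1: "a * cos \<psi> * exp (x / a + - ln \<alpha>) = exp (x / a + ln (real m)) * cos \<psi>"
          unfolding aE[symmetric] by (simp only: mult_ac)
        have e2: "(1 - (b - 1/2)) * (x / a + - ln \<alpha>) + b * (x / a + ln (real m))
            = ((1 - (b - 1/2)) / a + b / a) * x + (b * ln (real m) - (1 - (b - 1/2)) * ln \<alpha>)"
          using a0 by (simp add: field_simps)
        have e3: "(cos \<phi> - cos \<psi>) * exp (x / a + ln (real m)) = exp (x / a + ln (real m)) * cos \<phi> - exp (x / a + ln (real m)) * cos \<psi>"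
          by (simp add: algebra_simps)
        have "(1 - (b - 1/2)) * (x / a + - ln \<alpha>) + exp (x / a + ln (real m)) * cos \<psi>
          \<le> - b * (x / a + ln (real m)) + exp (x / a + ln (real m)) * cos \<phi>"
          using elim(2) unfolding e2[symmetric] e3 by linarith
        then show ?thesis unfolding T_def e1 by simp
      qed
      have "B \<le> C * (T x + T x) + D * (T x + T x)"
        unfolding B_def using 1 2 3 4 C(1) D(1) by (intro add_mono mult_left_mono) auto
      also have "\<dots> = (2 * C + 2 * D) * T x" by (simp add: algebra_simps)
      finally have "\<bar>Re A\<bar> \<le> (2 * C + 2 * D) * T x" using AB abs_Re_le_cmod[of A] by linarith
      then show ?case by (simp add: A_def l_def T_def)
    qed
  qed
qed

text \<open>The root with index 0 contributes \<open>Gfun\<close> and its error; the others have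
  larger arguments \<theta> and fall under the subdominant estimate with the same comparison
  function.\<close>

lemma Fm_asymp_exponential:
  assumes al: "\<alpha> > 0" and m: "m \<ge> 1" and am: "\<alpha> * real m > 2"
  shows "(\<lambda>t. Fm \<alpha> \<beta> m (- t) - Gfun \<alpha> \<beta> m t)
    \<in> O[at_top](\<lambda>t. t powr (p_exp \<alpha> \<beta> m - 1 / (\<alpha> * real m))
         * exp (real m * t powr (1 / (\<alpha> * real m)) * cos (pi / (\<alpha> * real m))))"
proof -
  \<comment> \<open>With M at least \<alpha> m, the reduced parameter a = \<alpha> m / (2M) is at
    most 1/2, inside the range of the Abel-Plana argument.\<close>
  define M where "M = nat \<lceil>\<alpha> * real m\<rceil>"
  have Mam: "real M \<ge> \<alpha> * real m" unfolding M_def by linarith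
  then have M: "M \<ge> 1" using am by (cases M) auto
  define N where "N = 2 * real M"
  have N: "N > 0" using M by (simp add: N_def)
  define a where "a = \<alpha> / N * real m"
  define b where "b = real m * \<beta> - (real m - 1) / 2"
  \<comment> \<open>The argument of the saddle point for the first root, (pi/N) / a. It is below
    pi/2 because \<alpha> m > 2.\<close>
  define \<phi> where "\<phi> = pi / (\<alpha> * real m)"
  have mr: "real m > 0" using m by simp
  have am0: "\<alpha> * real m > 0" using am by linarith
  have aN: "a = \<alpha> * real m / N" by (simp add: a_def)
  have a0: "a > 0" using am0 N by (simp add: aN)
  have a2: "a < 2" using Mam N am unfolding aN N_def by (simp add: field_simps)
  have phi: "0 < \<phi>" "\<phi> < pi / 2" using am am0 unfolding \<phi>_def by (auto simp: field_simps)
  have aphi: "a * \<phi> = pi / N" using al m by (simp add: aN \<phi>_def)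
  have al': "\<alpha> / N > 0" using al N by simp
  define g where "g = leroy_coeff (\<alpha> / N) \<beta> m"
  define \<theta> where "\<theta> = (\<lambda>j::nat. pi * (2 * real j + 1) / N)"
  define T where "T = (\<lambda>x. exp (- b * (x / a + ln (real m)) + exp (x / a + ln (real m)) * cos \<phi>))"
  have small: "a * \<phi> \<le> pi" unfolding aphi using M by (simp add: N_def field_simps)
  have O1: "(\<lambda>x. Re (exp_series g (Complex x (pi / N)) - leroy_main (\<alpha> / N) \<beta> m (Complex x (pi / N)))) \<in> O[at_top](T)"
    using leroy_dominant_ray[OF al' m, folded a_def b_def, OF a2 phi small, where \<beta> = \<beta>] unfolding aphi g_def T_def by (simp add: b_def)
  have O2: "(\<lambda>x. Re (exp_series g (Complex x (\<theta> j)))) \<in> O[at_top](T)" if j: "j \<in> {1..<M}" for j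
  proof -
    have "pi * 1 < pi * (2 * real j + 1)" using j by (intro mult_strict_left_mono) auto
    then have 1: "a * \<phi> < \<theta> j" unfolding aphi \<theta>_def using N by (intro divide_strict_right_mono) auto
    have "2 * real j + 1 \<le> N" using j unfolding N_def by simp
    then have "pi * (2 * real j + 1) \<le> pi * N" by (intro mult_left_mono) auto
    then have 2: "\<theta> j \<le> pi" unfolding \<theta>_def using N by (simp add: pos_divide_le_eq)
    show ?thesis
      using leroy_subdominant_ray[OF al' m, folded a_def b_def, OF a2 phi 1 2, where \<beta> = \<beta>] unfolding g_def T_def by (simp add: b_def)
  qed
  have "(\<lambda>x. Re (exp_series g (Complex x (pi / N)) - leroy_main (\<alpha> / N) \<beta> m (Complex x (pi / N)))
      + (\<Sum>j\<in>{1..<M}. Re (exp_series g (Complex x (\<theta> j))))) \<in> O[at_top](T)"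
    by (intro sum_in_bigo O1 big_sum_in_bigo O2)
  moreover have "filterlim (\<lambda>t. ln t / N) at_top at_top" using N by real_asymp
  ultimately have "(\<lambda>t. Re (exp_series g (Complex (ln t / N) (pi / N)) - leroy_main (\<alpha> / N) \<beta> m (Complex (ln t / N) (pi / N)))
      + (\<Sum>j\<in>{1..<M}. Re (exp_series g (Complex (ln t / N) (\<theta> j))))) \<in> O[at_top](\<lambda>t. T (ln t / N))"
    by (rule landau_o.big.compose)
  then have "(\<lambda>t. (1 / real M) * (Re (exp_series g (Complex (ln t / N) (pi / N)) - leroy_main (\<alpha> / N) \<beta> m (Complex (ln t / N) (pi / N)))
      + (\<Sum>j\<in>{1..<M}. Re (exp_series g (Complex (ln t / N) (\<theta> j)))))) \<in> O[at_top](\<lambda>t. T (ln t / N))"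
    using M by (subst landau_o.big.cmult_in_iff) auto
  moreover have "\<forall>\<^sub>F t in at_top. (1 / real M) * (Re (exp_series g (Complex (ln t / N) (pi / N)) - leroy_main (\<alpha> / N) \<beta> m (Complex (ln t / N) (pi / N)))
      + (\<Sum>j\<in>{1..<M}. Re (exp_series g (Complex (ln t / N) (\<theta> j))))) = Fm \<alpha> \<beta> m (- t) - Gfun \<alpha> \<beta> m t"
    using eventually_gt_at_top[of 0]
  proof eventually_elim
    case (elim t)
    have "{..<M} = insert 0 {1..<M}" using M by auto
    then have "(\<Sum>j<M. Re (exp_series g (Complex (ln t / N) (\<theta> j)))) = Re (exp_series g (Complex (ln t / N) (pi / N))) + (\<Sum>j\<in>{1..<M}. Re (exp_series g (Complex (ln t / N) (\<theta> j))))"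
      by (simp add: \<theta>_def)
    moreover have "Fm \<alpha> \<beta> m (- t) = (\<Sum>j<M. Re (exp_series g (Complex (ln t / N) (\<theta> j)))) / real M"
      unfolding g_def \<theta>_def N_def by (rule Fm_eq_average[OF al m M elim])
    moreover have "Gfun \<alpha> \<beta> m t = Re (leroy_main (\<alpha> / N) \<beta> m (Complex (ln t / N) (pi / N))) / real M"
      unfolding N_def by (rule Re_leroy_main_eq_Gfun[OF al m M elim, symmetric])
    ultimately show ?case using M by (simp add: field_simps)
  qed
  ultimately have "(\<lambda>t. Fm \<alpha> \<beta> m (- t) - Gfun \<alpha> \<beta> m t) \<in> O[at_top](\<lambda>t. T (ln t / N))"
    by (subst (asm) landau_o.big.in_cong) auto
  also have "(\<lambda>t. T (ln t / N)) \<in> O[at_top](\<lambda>t. t powr (p_exp \<alpha> \<beta> m - 1 / (\<alpha> * real m))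
         * exp (real m * t powr (1 / (\<alpha> * real m)) * cos (pi / (\<alpha> * real m))))"
  proof (rule bigoI[where c = "real m powr (- b)"])
    show "\<forall>\<^sub>F t in at_top. norm (T (ln t / N)) \<le> real m powr (- b) * norm (t powr (p_exp \<alpha> \<beta> m - 1 / (\<alpha> * real m))
         * exp (real m * t powr (1 / (\<alpha> * real m)) * cos (pi / (\<alpha> * real m))))"
      using eventually_gt_at_top[of 0]
    proof eventually_elim
      case (elim t)
      define e where "e = 1 / (\<alpha> * real m)"
      have x: "ln t / N / a = ln t * e" using N by (simp add: aN e_def)
      \<comment> \<open>Identifies the power in the comparison function with the claimed one; what
        is left over is the constant m^(-b).\<close>
      have p: "p_exp \<alpha> \<beta> m - 1 / (\<alpha> * real m) = - b * e"
        using al m by (simp add: b_def e_def p_exp_def field_simps)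
      have eR: "exp (ln t * e + ln (real m)) = real m * t powr e"
        using elim mr by (simp add: exp_add powr_def mult.commute)
      have "- b * (ln t * e + ln (real m)) = (- b) * ln (real m) + (- b * e) * ln t" by (simp add: algebra_simps)
      then have "exp (- b * (ln t * e + ln (real m))) = real m powr (- b) * t powr (- b * e)"
        using elim mr by (simp only: exp_add powr_def) simp
      then have "T (ln t / N) = real m powr (- b) * (t powr (- b * e) * exp (real m * t powr e * cos \<phi>))"
        unfolding T_def x eR exp_add[of "- b * _"] by (simp add: mult.assoc)
      then show ?case unfolding p unfolding e_def[symmetric] \<phi>_def[symmetric] by simp
    qed
  qed
  finally show ?thesis .
qed

theorem theorem4p4:
  fixes \<alpha> \<beta> :: real and m :: nat
  assumes "\<alpha> > 0" and "\<beta> > 0" and "m \<ge> 1"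
  shows "(\<alpha> * real m < 2 \<longrightarrow>
           (\<forall>K::nat. K \<ge> 1 \<longrightarrow>
              (\<lambda>t. Fm \<alpha> \<beta> m (- t) - Hfun \<alpha> \<beta> m K t) \<in> O[at_top](\<lambda>t. t powr (- real K - 1))))
       \<and> (\<alpha> * real m = 2 \<longrightarrow>
           (\<forall>K::nat. K \<ge> 1 \<longrightarrow>
              (\<lambda>t. Fm \<alpha> \<beta> m (- t) - Gfun \<alpha> \<beta> m t - Hfun \<alpha> \<beta> m K t)
                \<in> O[at_top](\<lambda>t. t powr (p_exp \<alpha> \<beta> m - 1/2) + t powr (- real K - 1))))
       \<and> (\<alpha> * real m > 2 \<longrightarrow>
           (\<lambda>t. Fm \<alpha> \<beta> m (- t) - Gfun \<alpha> \<beta> m t)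
             \<in> O[at_top](\<lambda>t. t powr (p_exp \<alpha> \<beta> m - 1 / (\<alpha> * real m))
                   * exp (real m * t powr (1 / (\<alpha> * real m)) * cos (pi / (\<alpha> * real m)))))"
  using Fm_asymp_algebraic[OF assms(1,3)] Fm_asymp_oscillating[OF assms(1,3)] Fm_asymp_exponential[OF assms(1,3)] by blast

end
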